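(* Let $\mathcal{A}$ be a strict monoidal category. There is a 2-adjunction in which the 2-functor $\mathrm{H}_0(\mathcal{A},-)\colon\mathcal{A}\text{-}\mathbf{Mod}\text{-}\mathcal{A}\to\mathbf{Cat}$ is left 2-adjoint to the 2-functor $[\mathcal{A},-]\colon\mathbf{Cat}\to\mathcal{A}\text{-}\mathbf{Mod}\text{-}\mathcal{A}$.
   Context: $[\mathcal{X},\mathcal{Y}]$ denotes the category of functors $\mathcal{X}\to\mathcal{Y}$. $\mathcal{A}$ is a strict monoidal category with tensor product $\otimes$ and unit $I$; all module categories are strict. A 2-adjunction is an adjunction in the 2-category of 2-categories, 2-functors and 2-natural transformations (equivalently, there are 2-natural isomorphisms of hom-categories). The 2-category $\mathcal{A}\text{-}\mathbf{Mod}\text{-}\mathcal{A}$. A $0$-cell is a category $\mathcal{M}$ with a strict left action $\rhd\colon\mathcal{A}\times\mathcal{M}\to\mathcal{M}$ and a strict right action $\lhd\colon\mathcal{M}\times\mathcal{A}\to\mathcal{M}$, together with morphisms $\chi_{A,M,B}\colon A\rhd(M\lhd B)\to(A\rhd M)\lhd B$, natural in $A,M,B$, with $\chi_{A\otimes A',M,B}=\chi_{A,A'\rhd M,B}\circ(A\rhd\chi_{A',M,B})$, $\chi_{A,M,B\otimes B'}=(\chi_{A,M,B}\lhd B')\circ\chi_{A,M\lhd B,B'}$, and $\chi_{A,M,B}=1$ whenever $A=I$ or $B=I$. A $1$-cell $(P,r)\colon\mathcal{M}\to\mathcal{N}$ is a functor $P$ strictly preserving the right action ($PM\lhd B=P(M\lhd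 B)$ naturally), with morphisms $r_{A,M}\colon A\rhd PM\to P(A\rhd M)$ natural in $A,M$ such that $r_{A\otimes B,M}=r_{A,B\rhd M}\circ(A\rhd r_{B,M})$, $P(\chi_{A,M,B})\circ r_{A,M\lhd B}=(r_{A,M}\lhd B)\circ\chi_{A,PM,B}$, and $r_{I,M}=1$. A $2$-cell $\alpha\colon(P,r)\Rightarrow(P',r')$ is a natural transformation $\alpha\colon P\Rightarrow P'$ with $\alpha_{A\rhd M}\circ r_{A,M}=r'_{A,M}\circ(A\rhd\alpha_M)$. The 2-functor $\mathrm{H}_0(\mathcal{A},-)$. The category $\mathrm{H}_0(\mathcal{A},\mathcal{M})$ has the same objects as $\mathcal{M}$; its morphisms are given by taking the morphisms of $\mathcal{M}$ and adjoining morphisms $\phi_{A,M}\colon M\lhd A\to A\rhd M$, natural in $A$ and $M$, subject to $\phi_{I,M}=1$ and to the condition that $\phi_{A\otimes B,M}$ equals the composite $$M\lhd(A\otimes B)=(M\lhd A)\lhd B\xrightarrow{\phi}B\rhd(M\lhd A)\xrightarrow{\chi}(B\rhd M)\lhd A\xrightarrow{\phi}A\rhd(B\rhd M)=(A\otimes B)\rhd M.$$ A $1$-cell $(P,r)$ is sent to the functor equal to $P$ on morphisms of $\mathcal{M}$ and sending $\phi_{A,M}$ to $P(M\lhd A)=PM\lhd A\xrightarrow{\phi}A\rhd PM\xrightarrow{r}P(A\rhd M)$; a $2$-cell $\alpha$ is sent to the natural transformation with the same components. The 2-functor $[\mathcal{A},-]$. For a category $\mathcal{Y}$, $[\mathcal{A},\mathcal{Y}]$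 is the $0$-cell with $(A\rhd F)(B)=F(B\otimes A)$, $(F\lhd A)(B)=F(A\otimes B)$ and $\chi$ the identity; functors and natural transformations act by composition.
   Formalization: 2-cells of A-Mod-A are also required to respect the right action (α at M◁B equals α_M◁B), without which the 2-adjunction fails; Cat and the module categories consist of categories whose objects and arrows lie in an arbitrary universe closed under both constructions. *)

theory Defs
  imports Main "HOL-Library.FuncSet"
begin

section \<open>Categories, functors, natural transformations\<close>

record ('o, 'a) cat =
  Obj :: "'o set"
  Arr :: "'a set"
  Dom :: "'a \<Rightarrow> 'o"
  Cod :: "'a \<Rightarrow> 'o"
  Idn :: "'o \<Rightarrow> 'a"
  Cmp :: "'a \<Rightarrow> 'a \<Rightarrow> 'a"  (infixl "\<cdot>\<index>" 70)

text \<open>Composition is only meaningful on composable arrows, and \<open>Dom\<close>, \<open>Cod\<close>, \<open>Idn\<close> only on the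
  carriers. These values are not normalised elsewhere: two records that agree on the carriers
  are isomorphic as 0-cells, by a functor that is the identity on objects and arrows.\<close>

definition hom :: "('o, 'a, 'z) cat_scheme \<Rightarrow> 'o \<Rightarrow> 'o \<Rightarrow> 'a set" where
  "hom C x y = {f \<in> Arr C. Dom C f = x \<and> Cod C f = y}"

locale category =
  fixes C :: "('o, 'a, 'z) cat_scheme" (structure)
  assumes dom_obj: "f \<in> Arr C \<Longrightarrow> Dom C f \<in> Obj C"
    and cod_obj: "f \<in> Arr C \<Longrightarrow> Cod C f \<in> Obj C"
    and idn_hom: "x \<in> Obj C \<Longrightarrow> Idn C x \<in> hom C x x"
    and cmp_hom: "\<lbrakk>f \<in> Arr C; g \<in> Arr C; Cod C f = Dom C g\<rbrakk>
      \<Longrightarrow> g \<cdot> f \<in> hom C (Dom C f) (Cod C g)"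
    and idn_left: "f \<in> Arr C \<Longrightarrow> Idn C (Cod C f) \<cdot> f = f"
    and idn_right: "f \<in> Arr C \<Longrightarrow> f \<cdot> Idn C (Dom C f) = f"
    and cmp_assoc: "\<lbrakk>f \<in> Arr C; g \<in> Arr C; h \<in> Arr C; Cod C f = Dom C g; Cod C g = Dom C h\<rbrakk>
      \<Longrightarrow> (h \<cdot> g) \<cdot> f = h \<cdot> (g \<cdot> f)"

definition prod_cat ::
  "('o, 'a, 'y) cat_scheme \<Rightarrow> ('p, 'b, 'z) cat_scheme \<Rightarrow> ('o \<times> 'p, 'a \<times> 'b) cat" where
  "prod_cat C D = \<lparr>
     Obj = Obj C \<times> Obj D,
     Arr = Arr C \<times> Arr D,
     Dom = (\<lambda>(f, g). (Dom C f, Dom D g)),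
     Cod = (\<lambda>(f, g). (Cod C f, Cod D g)),
     Idn = (\<lambda>(x, y). (Idn C x, Idn D y)),
     Cmp = (\<lambda>(f', g') (f, g). (f' \<cdot>\<^bsub>C\<^esub> f, g' \<cdot>\<^bsub>D\<^esub> g))\<rparr>"

datatype ('o, 'a, 'p, 'b) fmap = FMap (onObj: "'o \<Rightarrow> 'p") (onArr: "'a \<Rightarrow> 'b")

locale functr = C: category C + D: category D
  for C :: "('o, 'a, 'y) cat_scheme" and D :: "('p, 'b, 'z) cat_scheme" +
  fixes F :: "('o, 'a, 'p, 'b) fmap"
  assumes map_obj: "x \<in> Obj C \<Longrightarrow> onObj F x \<in> Obj D"
    and map_hom: "f \<in> Arr C \<Longrightarrow> onArr F f \<in> hom D (onObj F (Dom C f)) (onObj F (Cod C f))"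
    and map_idn: "x \<in> Obj C \<Longrightarrow> onArr F (Idn C x) = Idn D (onObj F x)"
    and map_cmp: "\<lbrakk>f \<in> Arr C; g \<in> Arr C; Cod C f = Dom C g\<rbrakk>
      \<Longrightarrow> onArr F (g \<cdot>\<^bsub>C\<^esub> f) = onArr F g \<cdot>\<^bsub>D\<^esub> onArr F f"

locale nat_trans = F: functr C D F + G: functr C D G
  for C :: "('o, 'a, 'y) cat_scheme" and D :: "('p, 'b, 'z) cat_scheme" and F and G +
  fixes t :: "'o \<Rightarrow> 'b"
  assumes comp_hom: "x \<in> Obj C \<Longrightarrow> t x \<in> hom D (onObj F x) (onObj G x)"
    and naturality: "f \<in> Arr C
      \<Longrightarrow> onArr G f \<cdot>\<^bsub>D\<^esub> t (Dom C f) = t (Cod C f) \<cdot>\<^bsub>D\<^esub> onArr F f"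

text \<open>Functors and transformations are normalised to \<open>undefined\<close> off their domain, so that
  equality in HOL is equality of functors and of transformations.\<close>

definition funs ::
  "('o, 'a, 'y) cat_scheme \<Rightarrow> ('p, 'b, 'z) cat_scheme \<Rightarrow> ('o, 'a, 'p, 'b) fmap set" where
  "funs C D = {F. functr C D F \<and> onObj F \<in> extensional (Obj C) \<and> onArr F \<in> extensional (Arr C)}"

definition nats ::
  "('o, 'a, 'y) cat_scheme \<Rightarrow> ('p, 'b, 'z) cat_scheme \<Rightarrow>
   ('o, 'a, 'p, 'b) fmap \<Rightarrow> ('o, 'a, 'p, 'b) fmap \<Rightarrow> ('o \<Rightarrow> 'b) set" where
  "nats C D F G = {t. nat_trans C D F G t \<and> t \<in> extensional (Obj C)}"

definition fid :: "('o, 'a, 'z) cat_scheme \<Rightarrow> ('o, 'a, 'o, 'a) fmap" where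
  "fid C = FMap (\<lambda>x\<in>Obj C. x) (\<lambda>f\<in>Arr C. f)"

definition fcomp ::
  "('o, 'a, 'z) cat_scheme \<Rightarrow> ('p, 'b, 'q, 'c) fmap \<Rightarrow> ('o, 'a, 'p, 'b) fmap
   \<Rightarrow> ('o, 'a, 'q, 'c) fmap" where
  "fcomp C G F = FMap (\<lambda>x\<in>Obj C. onObj G (onObj F x)) (\<lambda>f\<in>Arr C. onArr G (onArr F f))"

definition nid ::
  "('o, 'a, 'y) cat_scheme \<Rightarrow> ('p, 'b, 'z) cat_scheme \<Rightarrow> ('o, 'a, 'p, 'b) fmap \<Rightarrow> 'o \<Rightarrow> 'b" where
  "nid C D F = (\<lambda>x\<in>Obj C. Idn D (onObj F x))"

definition nvcomp ::
  "('o, 'a, 'y) cat_scheme \<Rightarrow> ('p, 'b, 'z) cat_scheme \<Rightarrow> ('o \<Rightarrow> 'b) \<Rightarrow> ('o \<Rightarrow> 'b) \<Rightarrow> 'o \<Rightarrow> 'b" where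
  "nvcomp C D s t = (\<lambda>x\<in>Obj C. s x \<cdot>\<^bsub>D\<^esub> t x)"

text \<open>For \<open>t : F \<Rightarrow> F'\<close> between functors \<open>C \<rightarrow> D\<close> and \<open>s : G \<Rightarrow> G'\<close> between functors \<open>D \<rightarrow> E\<close>,
  \<open>nhcomp C E G F' s t\<close> is the horizontal composite \<open>G F \<Rightarrow> G' F'\<close>.\<close>

definition nhcomp ::
  "('o, 'a, 'y) cat_scheme \<Rightarrow> ('q, 'c, 'z) cat_scheme \<Rightarrow> ('p, 'b, 'q, 'c) fmap \<Rightarrow>
   ('o, 'a, 'p, 'b) fmap \<Rightarrow> ('p \<Rightarrow> 'c) \<Rightarrow> ('o \<Rightarrow> 'b) \<Rightarrow> 'o \<Rightarrow> 'c" where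
  "nhcomp C E G F' s t = (\<lambda>x\<in>Obj C. s (onObj F' x) \<cdot>\<^bsub>E\<^esub> onArr G (t x))"


section \<open>2-categories, 2-functors, 2-natural transformations, 2-adjunctions\<close>

text \<open>\<open>Base\<close> is the category of 0-cells and 1-cells; \<open>Vert\<close> is the disjoint union of the
  hom-categories (1-cells, 2-cells, vertical composition); \<open>HCmp\<close> is horizontal composition.\<close>

record ('o, 'm, 't) tcat =
  Base :: "('o, 'm) cat"
  Vert :: "('m, 't) cat"
  HCmp :: "'t \<Rightarrow> 't \<Rightarrow> 't"

definition hdom2 :: "('o, 'm, 't) tcat \<Rightarrow> 't \<Rightarrow> 'o" where
  "hdom2 K \<alpha> = Dom (Base K) (Dom (Vert K) \<alpha>)"

definition hcod2 :: "('o, 'm, 't) tcat \<Rightarrow> 't \<Rightarrow> 'o" where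
  "hcod2 K \<alpha> = Cod (Base K) (Dom (Vert K) \<alpha>)"

locale two_category = Base: category "Base K" + Vert: category "Vert K"
  for K :: "('o, 'm, 't) tcat" +
  assumes vert_obj: "Obj (Vert K) = Arr (Base K)"
    and globular_dom: "\<alpha> \<in> Arr (Vert K) \<Longrightarrow> Dom (Base K) (Cod (Vert K) \<alpha>) = hdom2 K \<alpha>"
    and globular_cod: "\<alpha> \<in> Arr (Vert K) \<Longrightarrow> Cod (Base K) (Cod (Vert K) \<alpha>) = hcod2 K \<alpha>"
    and hcmp_hom: "\<lbrakk>\<alpha> \<in> Arr (Vert K); \<beta> \<in> Arr (Vert K); hcod2 K \<alpha> = hdom2 K \<beta>\<rbrakk> \<Longrightarrow>
      HCmp K \<beta> \<alpha> \<in> hom (Vert K)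
        (Dom (Vert K) \<beta> \<cdot>\<^bsub>Base K\<^esub> Dom (Vert K) \<alpha>)
        (Cod (Vert K) \<beta> \<cdot>\<^bsub>Base K\<^esub> Cod (Vert K) \<alpha>)"
    and hcmp_assoc: "\<lbrakk>\<alpha> \<in> Arr (Vert K); \<beta> \<in> Arr (Vert K); \<gamma> \<in> Arr (Vert K);
        hcod2 K \<alpha> = hdom2 K \<beta>; hcod2 K \<beta> = hdom2 K \<gamma>\<rbrakk> \<Longrightarrow>
      HCmp K (HCmp K \<gamma> \<beta>) \<alpha> = HCmp K \<gamma> (HCmp K \<beta> \<alpha>)"
    and hcmp_idn_left: "\<alpha> \<in> Arr (Vert K) \<Longrightarrow>
      HCmp K (Idn (Vert K) (Idn (Base K) (hcod2 K \<alpha>))) \<alpha> = \<alpha>"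
    and hcmp_idn_right: "\<alpha> \<in> Arr (Vert K) \<Longrightarrow>
      HCmp K \<alpha> (Idn (Vert K) (Idn (Base K) (hdom2 K \<alpha>))) = \<alpha>"
    and hcmp_idn: "\<lbrakk>f \<in> Arr (Base K); g \<in> Arr (Base K); Cod (Base K) f = Dom (Base K) g\<rbrakk> \<Longrightarrow>
      HCmp K (Idn (Vert K) g) (Idn (Vert K) f) = Idn (Vert K) (g \<cdot>\<^bsub>Base K\<^esub> f)"
    and interchange: "\<lbrakk>\<alpha> \<in> Arr (Vert K); \<alpha>' \<in> Arr (Vert K); \<beta> \<in> Arr (Vert K); \<beta>' \<in> Arr (Vert K);
        Cod (Vert K) \<alpha> = Dom (Vert K) \<alpha>'; Cod (Vert K) \<beta> = Dom (Vert K) \<beta>';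
        hcod2 K \<alpha> = hdom2 K \<beta>\<rbrakk> \<Longrightarrow>
      HCmp K (\<beta>' \<cdot>\<^bsub>Vert K\<^esub> \<beta>) (\<alpha>' \<cdot>\<^bsub>Vert K\<^esub> \<alpha>) = HCmp K \<beta>' \<alpha>' \<cdot>\<^bsub>Vert K\<^esub> HCmp K \<beta> \<alpha>"

datatype ('o, 'm, 't, 'p, 'n, 's) tfmap =
  TFMap (on0: "'o \<Rightarrow> 'p") (on1: "'m \<Rightarrow> 'n") (on2: "'t \<Rightarrow> 's")

locale two_functor = K: two_category K + L: two_category L +
    Base: functr "Base K" "Base L" "FMap (on0 F) (on1 F)" +
    Vert: functr "Vert K" "Vert L" "FMap (on1 F) (on2 F)"
  for K :: "('o, 'm, 't) tcat" and L :: "('p, 'n, 's) tcat" and F :: "('o, 'm, 't, 'p, 'n, 's) tfmap" +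
  assumes map_hcmp: "\<lbrakk>\<alpha> \<in> Arr (Vert K); \<beta> \<in> Arr (Vert K); hcod2 K \<alpha> = hdom2 K \<beta>\<rbrakk> \<Longrightarrow>
      on2 F (HCmp K \<beta> \<alpha>) = HCmp L (on2 F \<beta>) (on2 F \<alpha>)"

locale two_natural = F: two_functor K L F + G: two_functor K L G
  for K :: "('o, 'm, 't) tcat" and L :: "('p, 'n, 's) tcat" and F and G +
  fixes \<eta> :: "'o \<Rightarrow> 'n"
  assumes comp_hom: "x \<in> Obj (Base K) \<Longrightarrow> \<eta> x \<in> hom (Base L) (on0 F x) (on0 G x)"
    and naturality1: "f \<in> Arr (Base K) \<Longrightarrow>
      on1 G f \<cdot>\<^bsub>Base L\<^esub> \<eta> (Dom (Base K) f) = \<eta> (Cod (Base K) f) \<cdot>\<^bsub>Base L\<^esub> on1 F f"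
    and naturality2: "\<alpha> \<in> Arr (Vert K) \<Longrightarrow>
      HCmp L (on2 G \<alpha>) (Idn (Vert L) (\<eta> (hdom2 K \<alpha>))) =
      HCmp L (Idn (Vert L) (\<eta> (hcod2 K \<alpha>))) (on2 F \<alpha>)"

definition tfid :: "('o, 'm, 't, 'o, 'm, 't) tfmap" where
  "tfid = TFMap (\<lambda>x. x) (\<lambda>f. f) (\<lambda>\<alpha>. \<alpha>)"

definition tfcomp ::
  "('p, 'n, 's, 'q, 'l, 'r) tfmap \<Rightarrow> ('o, 'm, 't, 'p, 'n, 's) tfmap
   \<Rightarrow> ('o, 'm, 't, 'q, 'l, 'r) tfmap" where
  "tfcomp G F = TFMap (on0 G \<circ> on0 F) (on1 G \<circ> on1 F) (on2 G \<circ> on2 F)"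

text \<open>\<open>F : K \<rightarrow> L\<close> is left 2-adjoint to \<open>G : L \<rightarrow> K\<close>.\<close>

definition two_adjunction ::
  "('o, 'm, 't) tcat \<Rightarrow> ('p, 'n, 's) tcat \<Rightarrow>
   ('o, 'm, 't, 'p, 'n, 's) tfmap \<Rightarrow> ('p, 'n, 's, 'o, 'm, 't) tfmap \<Rightarrow> bool" where
  "two_adjunction K L F G \<longleftrightarrow>
     two_functor K L F \<and> two_functor L K G \<and>
     (\<exists>\<eta> \<epsilon>. two_natural K K tfid (tfcomp G F) \<eta> \<and> two_natural L L (tfcomp F G) tfid \<epsilon> \<and>
        (\<forall>x\<in>Obj (Base K). \<epsilon> (on0 F x) \<cdot>\<^bsub>Base L\<^esub> on1 F (\<eta> x) = Idn (Base L) (on0 F x)) \<and>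
        (\<forall>y\<in>Obj (Base L). on1 G (\<epsilon> y) \<cdot>\<^bsub>Base K\<^esub> \<eta> (on0 G y) = Idn (Base K) (on0 G y)))"


section \<open>The 2-category of categories\<close>

datatype ('c, 'x) cell = Cell (src: 'c) (tgt: 'c) (dat: 'x)

type_synonym 'u fun1 = "(('u, 'u) cat, ('u, 'u, 'u, 'u) fmap) cell"
type_synonym 'u nat2 = "('u fun1, 'u \<Rightarrow> 'u) cell"

text \<open>The categories whose objects and arrows are elements of the type \<open>'u\<close>, which plays the role
  of the universe.\<close>

definition Cat1 :: "(('u, 'u) cat, 'u fun1) cat" where
  "Cat1 = \<lparr>
     Obj = {C. category C},
     Arr = {F. dat F \<in> funs (src F) (tgt F)},
     Dom = src,
     Cod = tgt,
     Idn = (\<lambda>C. Cell C C (fid C)),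
     Cmp = (\<lambda>G F. Cell (src F) (tgt G) (fcomp (src F) (dat G) (dat F)))\<rparr>"

definition CAT :: "(('u, 'u) cat, 'u fun1, 'u nat2) tcat" where
  "CAT = \<lparr>
     Base = Cat1,
     Vert = \<lparr>
       Obj = Arr Cat1,
       Arr = {\<alpha>. src \<alpha> \<in> Arr Cat1 \<and> tgt \<alpha> \<in> Arr Cat1 \<and>
                 src (src \<alpha>) = src (tgt \<alpha>) \<and> tgt (src \<alpha>) = tgt (tgt \<alpha>) \<and>
                 dat \<alpha> \<in> nats (src (src \<alpha>)) (tgt (src \<alpha>)) (dat (src \<alpha>)) (dat (tgt \<alpha>))},
       Dom = src,
       Cod = tgt,
       Idn = (\<lambda>F. Cell F F (nid (src F) (tgt F) (dat F))),
       Cmp = (\<lambda>\<beta> \<alpha>. Cell (src \<alpha>) (tgt \<beta>)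
                (nvcomp (src (src \<alpha>)) (tgt (src \<alpha>)) (dat \<beta>) (dat \<alpha>)))\<rparr>,
     HCmp = (\<lambda>\<beta> \<alpha>. Cell (src \<beta> \<cdot>\<^bsub>Cat1\<^esub> src \<alpha>) (tgt \<beta> \<cdot>\<^bsub>Cat1\<^esub> tgt \<alpha>)
                (nhcomp (src (src \<alpha>)) (tgt (src \<beta>)) (dat (src \<beta>)) (dat (tgt \<alpha>)) (dat \<beta>) (dat \<alpha>)))\<rparr>"


section \<open>Strict monoidal categories and their bimodules\<close>

record ('o, 'a) moncat = "('o, 'a) cat" +
  tob :: "'o \<Rightarrow> 'o \<Rightarrow> 'o"
  tar :: "'a \<Rightarrow> 'a \<Rightarrow> 'a"
  unt :: "'o"

locale strict_monoidal = category A for A :: "('o, 'a) moncat" +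
  assumes tensor_functr: "functr (prod_cat A A) A (FMap (\<lambda>(a, b). tob A a b) (\<lambda>(f, g). tar A f g))"
    and unt_obj: "unt A \<in> Obj A"
    and tob_assoc: "\<lbrakk>a \<in> Obj A; b \<in> Obj A; c \<in> Obj A\<rbrakk> \<Longrightarrow> tob A (tob A a b) c = tob A a (tob A b c)"
    and tar_assoc: "\<lbrakk>f \<in> Arr A; g \<in> Arr A; h \<in> Arr A\<rbrakk> \<Longrightarrow> tar A (tar A f g) h = tar A f (tar A g h)"
    and tob_unt: "a \<in> Obj A \<Longrightarrow> tob A (unt A) a = a" "a \<in> Obj A \<Longrightarrow> tob A a (unt A) = a"
    and tar_unt: "f \<in> Arr A \<Longrightarrow> tar A (Idn A (unt A)) f = f"
      "f \<in> Arr A \<Longrightarrow> tar A f (Idn A (unt A)) = f"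

text \<open>\<open>lob\<close> and \<open>lar\<close> are the left action on objects and arrows, \<open>rob\<close> and \<open>rar\<close> the right one.\<close>

record ('o, 'a, 'u) bimod = "('u, 'u) cat" +
  lob :: "'o \<Rightarrow> 'u \<Rightarrow> 'u"
  lar :: "'a \<Rightarrow> 'u \<Rightarrow> 'u"
  rob :: "'u \<Rightarrow> 'o \<Rightarrow> 'u"
  rar :: "'u \<Rightarrow> 'a \<Rightarrow> 'u"
  chi :: "'o \<Rightarrow> 'u \<Rightarrow> 'o \<Rightarrow> 'u"

locale bimodule = A: strict_monoidal A + M: category M
  for A :: "('o, 'a) moncat" and M :: "('o, 'a, 'u) bimod" +
  assumes left_functr: "functr (prod_cat A M) M (FMap (\<lambda>(a, m). lob M a m) (\<lambda>(f, k). lar M f k))"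
    and lob_tob: "\<lbrakk>a \<in> Obj A; a' \<in> Obj A; m \<in> Obj M\<rbrakk> \<Longrightarrow> lob M (tob A a a') m = lob M a (lob M a' m)"
    and lar_tar: "\<lbrakk>f \<in> Arr A; f' \<in> Arr A; k \<in> Arr M\<rbrakk> \<Longrightarrow> lar M (tar A f f') k = lar M f (lar M f' k)"
    and lob_unt: "m \<in> Obj M \<Longrightarrow> lob M (unt A) m = m"
    and lar_unt: "k \<in> Arr M \<Longrightarrow> lar M (Idn A (unt A)) k = k"
    and right_functr: "functr (prod_cat M A) M (FMap (\<lambda>(m, a). rob M m a) (\<lambda>(k, f). rar M k f))"
    and rob_tob: "\<lbrakk>m \<in> Obj M; b \<in> Obj A; b' \<in> Obj A\<rbrakk> \<Longrightarrow> rob M m (tob A b b') = rob M (rob M m b) b'"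
    and rar_tar: "\<lbrakk>k \<in> Arr M; g \<in> Arr A; g' \<in> Arr A\<rbrakk> \<Longrightarrow> rar M k (tar A g g') = rar M (rar M k g) g'"
    and rob_unt: "m \<in> Obj M \<Longrightarrow> rob M m (unt A) = m"
    and rar_unt: "k \<in> Arr M \<Longrightarrow> rar M k (Idn A (unt A)) = k"
    and chi_hom: "\<lbrakk>a \<in> Obj A; m \<in> Obj M; b \<in> Obj A\<rbrakk> \<Longrightarrow>
      chi M a m b \<in> hom M (lob M a (rob M m b)) (rob M (lob M a m) b)"
    and chi_natural: "\<lbrakk>f \<in> Arr A; k \<in> Arr M; g \<in> Arr A\<rbrakk> \<Longrightarrow>
      rar M (lar M f k) g \<cdot>\<^bsub>M\<^esub> chi M (Dom A f) (Dom M k) (Dom A g) =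
      chi M (Cod A f) (Cod M k) (Cod A g) \<cdot>\<^bsub>M\<^esub> lar M f (rar M k g)"
    and chi_tob_left: "\<lbrakk>a \<in> Obj A; a' \<in> Obj A; m \<in> Obj M; b \<in> Obj A\<rbrakk> \<Longrightarrow>
      chi M (tob A a a') m b = chi M a (lob M a' m) b \<cdot>\<^bsub>M\<^esub> lar M (Idn A a) (chi M a' m b)"
    and chi_tob_right: "\<lbrakk>a \<in> Obj A; m \<in> Obj M; b \<in> Obj A; b' \<in> Obj A\<rbrakk> \<Longrightarrow>
      chi M a m (tob A b b') = rar M (chi M a m b) (Idn A b') \<cdot>\<^bsub>M\<^esub> chi M a (rob M m b) b'"
    and chi_unt_left: "\<lbrakk>m \<in> Obj M; b \<in> Obj A\<rbrakk> \<Longrightarrow> chi M (unt A) m b = Idn M (rob M m b)"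
    and chi_unt_right: "\<lbrakk>a \<in> Obj A; m \<in> Obj M\<rbrakk> \<Longrightarrow> chi M a m (unt A) = Idn M (lob M a m)"

datatype ('o, 'u) bimap = BiMap (bfun: "('u, 'u, 'u, 'u) fmap") (brr: "'o \<times> 'u \<Rightarrow> 'u")

locale bimodule_map = M: bimodule A M + N: bimodule A N + P: functr M N "bfun P"
  for A :: "('o, 'a) moncat" and M :: "('o, 'a, 'u) bimod" and N :: "('o, 'a, 'u) bimod"
    and P :: "('o, 'u) bimap" +
  assumes pres_rob: "\<lbrakk>m \<in> Obj M; b \<in> Obj A\<rbrakk> \<Longrightarrow>
      rob N (onObj (bfun P) m) b = onObj (bfun P) (rob M m b)"
    and pres_rar: "\<lbrakk>k \<in> Arr M; g \<in> Arr A\<rbrakk> \<Longrightarrow>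
      rar N (onArr (bfun P) k) g = onArr (bfun P) (rar M k g)"
    and brr_hom: "\<lbrakk>a \<in> Obj A; m \<in> Obj M\<rbrakk> \<Longrightarrow>
      brr P (a, m) \<in> hom N (lob N a (onObj (bfun P) m)) (onObj (bfun P) (lob M a m))"
    and brr_natural: "\<lbrakk>f \<in> Arr A; k \<in> Arr M\<rbrakk> \<Longrightarrow>
      onArr (bfun P) (lar M f k) \<cdot>\<^bsub>N\<^esub> brr P (Dom A f, Dom M k) =
      brr P (Cod A f, Cod M k) \<cdot>\<^bsub>N\<^esub> lar N f (onArr (bfun P) k)"
    and brr_tob: "\<lbrakk>a \<in> Obj A; b \<in> Obj A; m \<in> Obj M\<rbrakk> \<Longrightarrow>
      brr P (tob A a b, m) = brr P (a, lob M b m) \<cdot>\<^bsub>N\<^esub> lar N (Idn A a) (brr P (b, m))"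
    and brr_chi: "\<lbrakk>a \<in> Obj A; m \<in> Obj M; b \<in> Obj A\<rbrakk> \<Longrightarrow>
      onArr (bfun P) (chi M a m b) \<cdot>\<^bsub>N\<^esub> brr P (a, rob M m b) =
      rar N (brr P (a, m)) (Idn A b) \<cdot>\<^bsub>N\<^esub> chi N a (onObj (bfun P) m) b"
    and brr_unt: "m \<in> Obj M \<Longrightarrow> brr P (unt A, m) = Idn N (onObj (bfun P) m)"

text \<open>\<open>pres_right\<close> is the compatibility of 2-cells with the right action that goes with 1-cells
  strictly preserving it. It says that the components of a 2-cell are natural with respect to the
  arrows \<open>\<phi>\<close> of \<open>H0\<close> below; without it \<open>H0\<close> is not defined on 2-cells.\<close>

locale bimodule_trans = P: bimodule_map A M N P + Q: bimodule_map A M N Q +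
    nat_trans M N "bfun P" "bfun Q" t
  for A :: "('o, 'a) moncat" and M :: "('o, 'a, 'u) bimod" and N :: "('o, 'a, 'u) bimod"
    and P :: "('o, 'u) bimap" and Q :: "('o, 'u) bimap" and t :: "'u \<Rightarrow> 'u" +
  assumes pres_left: "\<lbrakk>a \<in> Obj A; m \<in> Obj M\<rbrakk> \<Longrightarrow>
      t (lob M a m) \<cdot>\<^bsub>N\<^esub> brr P (a, m) = brr Q (a, m) \<cdot>\<^bsub>N\<^esub> lar N (Idn A a) (t m)"
    and pres_right: "\<lbrakk>m \<in> Obj M; b \<in> Obj A\<rbrakk> \<Longrightarrow> t (rob M m b) = rar N (t m) (Idn A b)"

type_synonym ('o, 'a, 'u) bimod1 = "(('o, 'a, 'u) bimod, ('o, 'u) bimap) cell"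
type_synonym ('o, 'a, 'u) bimod2 = "(('o, 'a, 'u) bimod1, 'u \<Rightarrow> 'u) cell"

definition Bimod1 :: "('o, 'a) moncat \<Rightarrow> (('o, 'a, 'u) bimod, ('o, 'a, 'u) bimod1) cat" where
  "Bimod1 A = \<lparr>
     Obj = {M. bimodule A M},
     Arr = {P. bimodule_map A (src P) (tgt P) (dat P) \<and>
               bfun (dat P) \<in> funs (src P) (tgt P) \<and>
               brr (dat P) \<in> extensional (Obj A \<times> Obj (src P))},
     Dom = src,
     Cod = tgt,
     Idn = (\<lambda>M. Cell M M (BiMap (fid M) (\<lambda>(a, m)\<in>Obj A \<times> Obj M. Idn M (lob M a m)))),
     Cmp = (\<lambda>Q P. Cell (src P) (tgt Q) (BiMap
              (fcomp (src P) (bfun (dat Q)) (bfun (dat P)))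
              (\<lambda>(a, m)\<in>Obj A \<times> Obj (src P).
                 onArr (bfun (dat Q)) (brr (dat P) (a, m)) \<cdot>\<^bsub>tgt Q\<^esub>
                 brr (dat Q) (a, onObj (bfun (dat P)) m))))\<rparr>"

definition BIMOD ::
  "('o, 'a) moncat \<Rightarrow> (('o, 'a, 'u) bimod, ('o, 'a, 'u) bimod1, ('o, 'a, 'u) bimod2) tcat" where
  "BIMOD A = \<lparr>
     Base = Bimod1 A,
     Vert = \<lparr>
       Obj = Arr (Bimod1 A),
       Arr = {\<alpha>. src \<alpha> \<in> Arr (Bimod1 A) \<and> tgt \<alpha> \<in> Arr (Bimod1 A) \<and>
                 src (src \<alpha>) = src (tgt \<alpha>) \<and> tgt (src \<alpha>) = tgt (tgt \<alpha>) \<and>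
                 bimodule_trans A (src (src \<alpha>)) (tgt (src \<alpha>)) (dat (src \<alpha>)) (dat (tgt \<alpha>)) (dat \<alpha>) \<and>
                 dat \<alpha> \<in> extensional (Obj (src (src \<alpha>)))},
       Dom = src,
       Cod = tgt,
       Idn = (\<lambda>P. Cell P P (nid (src P) (tgt P) (bfun (dat P)))),
       Cmp = (\<lambda>\<beta> \<alpha>. Cell (src \<alpha>) (tgt \<beta>)
                (nvcomp (src (src \<alpha>)) (tgt (src \<alpha>)) (dat \<beta>) (dat \<alpha>)))\<rparr>,
     HCmp = (\<lambda>\<beta> \<alpha>. Cell (src \<beta> \<cdot>\<^bsub>Bimod1 A\<^esub> src \<alpha>) (tgt \<beta> \<cdot>\<^bsub>Bimod1 A\<^esub> tgt \<alpha>)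
                (nhcomp (src (src \<alpha>)) (tgt (src \<beta>))
                   (bfun (dat (src \<beta>))) (bfun (dat (tgt \<alpha>))) (dat \<beta>) (dat \<alpha>)))\<rparr>"


section \<open>The arrows of \<open>H0\<close> by generators and relations\<close>

text \<open>Formal composites of arrows of \<open>M\<close> and the adjoined arrows \<open>\<phi>\<close>:
  \<open>Phi a m\<close> stands for the arrow from \<open>rob M m a\<close> to \<open>lob M a m\<close>.\<close>

datatype ('o, 'u) hterm = Emb 'u | Phi 'o 'u | Circ "('o, 'u) hterm" "('o, 'u) hterm"

primrec hdom :: "('o, 'a, 'u) bimod \<Rightarrow> ('o, 'u) hterm \<Rightarrow> 'u" where
  "hdom M (Emb f) = Dom M f"
| "hdom M (Phi a m) = rob M m a"
| "hdom M (Circ t s) = hdom M s"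

primrec hcod :: "('o, 'a, 'u) bimod \<Rightarrow> ('o, 'u) hterm \<Rightarrow> 'u" where
  "hcod M (Emb f) = Cod M f"
| "hcod M (Phi a m) = lob M a m"
| "hcod M (Circ t s) = hcod M t"

primrec hwf :: "('o, 'a) moncat \<Rightarrow> ('o, 'a, 'u) bimod \<Rightarrow> ('o, 'u) hterm \<Rightarrow> bool" where
  "hwf A M (Emb f) \<longleftrightarrow> f \<in> Arr M"
| "hwf A M (Phi a m) \<longleftrightarrow> a \<in> Obj A \<and> m \<in> Obj M"
| "hwf A M (Circ t s) \<longleftrightarrow> hwf A M t \<and> hwf A M s \<and> hcod M s = hdom M t"

inductive heq :: "('o, 'a) moncat \<Rightarrow> ('o, 'a, 'u) bimod \<Rightarrow> ('o, 'u) hterm \<Rightarrow> ('o, 'u) hterm \<Rightarrow> bool"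
  for A :: "('o, 'a) moncat" and M :: "('o, 'a, 'u) bimod" where
  heq_refl: "hwf A M t \<Longrightarrow> heq A M t t"
| heq_sym: "heq A M s t \<Longrightarrow> heq A M t s"
| heq_trans: "\<lbrakk>heq A M s t; heq A M t u\<rbrakk> \<Longrightarrow> heq A M s u"
| heq_circ: "\<lbrakk>heq A M t t'; heq A M s s'; hcod M s = hdom M t\<rbrakk> \<Longrightarrow> heq A M (Circ t s) (Circ t' s')"
| heq_assoc: "\<lbrakk>hwf A M s; hwf A M t; hwf A M u; hcod M s = hdom M t; hcod M t = hdom M u\<rbrakk> \<Longrightarrow>
    heq A M (Circ (Circ u t) s) (Circ u (Circ t s))"
| heq_idn_left: "hwf A M t \<Longrightarrow> heq A M (Circ (Emb (Idn M (hcod M t))) t) t"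
| heq_idn_right: "hwf A M t \<Longrightarrow> heq A M (Circ t (Emb (Idn M (hdom M t)))) t"
| heq_emb: "\<lbrakk>f \<in> Arr M; g \<in> Arr M; Cod M f = Dom M g\<rbrakk> \<Longrightarrow>
    heq A M (Circ (Emb g) (Emb f)) (Emb (g \<cdot>\<^bsub>M\<^esub> f))"
| heq_phi_natural: "\<lbrakk>f \<in> Arr A; k \<in> Arr M\<rbrakk> \<Longrightarrow>
    heq A M (Circ (Phi (Cod A f) (Cod M k)) (Emb (rar M k f)))
            (Circ (Emb (lar M f k)) (Phi (Dom A f) (Dom M k)))"
| heq_phi_unt: "m \<in> Obj M \<Longrightarrow> heq A M (Phi (unt A) m) (Emb (Idn M m))"
| heq_phi_tob: "\<lbrakk>a \<in> Obj A; b \<in> Obj A; m \<in> Obj M\<rbrakk> \<Longrightarrow>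
    heq A M (Phi (tob A a b) m)
            (Circ (Phi a (lob M b m)) (Circ (Emb (chi M b m a)) (Phi b (rob M m a))))"

primrec hmap :: "('o, 'u) bimap \<Rightarrow> ('o, 'u) hterm \<Rightarrow> ('o, 'u) hterm" where
  "hmap P (Emb f) = Emb (onArr (bfun P) f)"
| "hmap P (Phi a m) = Circ (Emb (brr P (a, m))) (Phi a (onObj (bfun P) m))"
| "hmap P (Circ t s) = Circ (hmap P t) (hmap P s)"


section \<open>A universe closed under both constructions\<close>

text \<open>For \<open>A\<close> with objects in \<open>'o\<close> and arrows in \<open>'a\<close>, this type is a universe closed under
  the two constructions below, with the elements of an arbitrary type \<open>'x\<close> as atoms. Hence every
  category with objects and arrows of type \<open>'x\<close> is isomorphic, via \<open>Atom\<close>, to one in the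
  universe. The other constructors make functors out of \<open>A\<close>, transformations between them and
  formal composites into elements of the universe.\<close>

datatype ('o, 'a, 'x) univ =
    Atom 'x
  | FunCode (unFun: "('o, 'a, ('o, 'a, 'x) univ, ('o, 'a, 'x) univ) fmap")
  | NatCode (unNat: "(('o, 'a, 'x) univ, 'o \<Rightarrow> ('o, 'a, 'x) univ) cell")
  | TermCode (unTerm: "('o, ('o, 'a, 'x) univ) hterm")

subsection \<open>The 2-functor \<open>H0\<close>\<close>

text \<open>An equivalence class of formal composites is represented by a chosen element.\<close>

definition hcls ::
  "('o, 'a) moncat \<Rightarrow> ('o, 'a, ('o, 'a, 'x) univ) bimod \<Rightarrow> ('o, ('o, 'a, 'x) univ) hterm
   \<Rightarrow> ('o, 'a, 'x) univ" where
  "hcls A M t = TermCode (SOME s. heq A M t s)"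

definition H0_cat ::
  "('o, 'a) moncat \<Rightarrow> ('o, 'a, ('o, 'a, 'x) univ) bimod
   \<Rightarrow> (('o, 'a, 'x) univ, ('o, 'a, 'x) univ) cat" where
  "H0_cat A M = \<lparr>
     Obj = Obj M,
     Arr = hcls A M ` {t. hwf A M t},
     Dom = (\<lambda>u. hdom M (unTerm u)),
     Cod = (\<lambda>u. hcod M (unTerm u)),
     Idn = (\<lambda>m. hcls A M (Emb (Idn M m))),
     Cmp = (\<lambda>v u. hcls A M (Circ (unTerm v) (unTerm u)))\<rparr>"

definition H0_fun ::
  "('o, 'a) moncat \<Rightarrow> ('o, 'a, ('o, 'a, 'x) univ) bimod1 \<Rightarrow> ('o, 'a, 'x) univ fun1" where
  "H0_fun A P = Cell (H0_cat A (src P)) (H0_cat A (tgt P)) (FMap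
     (\<lambda>m\<in>Obj (H0_cat A (src P)). onObj (bfun (dat P)) m)
     (\<lambda>u\<in>Arr (H0_cat A (src P)). hcls A (tgt P) (hmap (dat P) (unTerm u))))"

definition H0_nat ::
  "('o, 'a) moncat \<Rightarrow> ('o, 'a, ('o, 'a, 'x) univ) bimod2 \<Rightarrow> ('o, 'a, 'x) univ nat2" where
  "H0_nat A \<alpha> = Cell (H0_fun A (src \<alpha>)) (H0_fun A (tgt \<alpha>))
     (\<lambda>m\<in>Obj (H0_cat A (src (src \<alpha>))). hcls A (tgt (src \<alpha>)) (Emb (dat \<alpha> m)))"

definition H0 where
  "H0 A = TFMap (H0_cat A) (H0_fun A) (H0_nat A)"

subsection \<open>The 2-functor \<open>[A,-]\<close>\<close>

definition Expo_lob ::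
  "('o, 'a) moncat \<Rightarrow> 'o \<Rightarrow> ('o, 'a, 'x) univ \<Rightarrow> ('o, 'a, 'x) univ" where
  "Expo_lob A a F = FunCode (FMap
     (\<lambda>b\<in>Obj A. onObj (unFun F) (tob A b a))
     (\<lambda>g\<in>Arr A. onArr (unFun F) (tar A g (Idn A a))))"

definition Expo_rob ::
  "('o, 'a) moncat \<Rightarrow> ('o, 'a, 'x) univ \<Rightarrow> 'o \<Rightarrow> ('o, 'a, 'x) univ" where
  "Expo_rob A F a = FunCode (FMap
     (\<lambda>b\<in>Obj A. onObj (unFun F) (tob A a b))
     (\<lambda>g\<in>Arr A. onArr (unFun F) (tar A (Idn A a) g)))"

definition Expo_idn ::
  "('o, 'a) moncat \<Rightarrow> (('o, 'a, 'x) univ, ('o, 'a, 'x) univ) cat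
   \<Rightarrow> ('o, 'a, 'x) univ \<Rightarrow> ('o, 'a, 'x) univ" where
  "Expo_idn A Y F = NatCode (Cell F F (nid A Y (unFun F)))"

text \<open>For \<open>f : a \<rightarrow> a'\<close> in \<open>A\<close> and \<open>t : F \<Rightarrow> G\<close>, the component at \<open>b\<close> of the left action of \<open>f\<close>
  on \<open>t\<close> is the composite \<open>F (b \<otimes> a) \<rightarrow> F (b \<otimes> a') \<rightarrow> G (b \<otimes> a')\<close>; dually for the right action.\<close>

definition Expo_cat ::
  "('o, 'a) moncat \<Rightarrow> (('o, 'a, 'x) univ, ('o, 'a, 'x) univ) cat
   \<Rightarrow> ('o, 'a, ('o, 'a, 'x) univ) bimod" where
  "Expo_cat A Y = \<lparr>
     Obj = FunCode ` funs A Y,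
     Arr = {NatCode (Cell (FunCode F) (FunCode G) t) | F G t.
              F \<in> funs A Y \<and> G \<in> funs A Y \<and> t \<in> nats A Y F G},
     Dom = (\<lambda>t. src (unNat t)),
     Cod = (\<lambda>t. tgt (unNat t)),
     Idn = Expo_idn A Y,
     Cmp = (\<lambda>s t. NatCode (Cell (src (unNat t)) (tgt (unNat s))
              (nvcomp A Y (dat (unNat s)) (dat (unNat t))))),
     lob = Expo_lob A,
     lar = (\<lambda>f t. NatCode (Cell
              (Expo_lob A (Dom A f) (src (unNat t))) (Expo_lob A (Cod A f) (tgt (unNat t)))
              (\<lambda>b\<in>Obj A. dat (unNat t) (tob A b (Cod A f)) \<cdot>\<^bsub>Y\<^esub>
                         onArr (unFun (src (unNat t))) (tar A (Idn A b) f)))),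
     rob = Expo_rob A,
     rar = (\<lambda>t f. NatCode (Cell
              (Expo_rob A (src (unNat t)) (Dom A f)) (Expo_rob A (tgt (unNat t)) (Cod A f))
              (\<lambda>b\<in>Obj A. dat (unNat t) (tob A (Cod A f) b) \<cdot>\<^bsub>Y\<^esub>
                         onArr (unFun (src (unNat t))) (tar A f (Idn A b))))),
     chi = (\<lambda>a F b. Expo_idn A Y (Expo_lob A a (Expo_rob A F b)))\<rparr>"

definition Expo_post ::
  "('o, 'a) moncat \<Rightarrow> ('o, 'a, 'x) univ fun1 \<Rightarrow> ('o, 'a, 'x) univ \<Rightarrow> ('o, 'a, 'x) univ" where
  "Expo_post A G F = FunCode (fcomp A (dat G) (unFun F))"

definition Expo_fun ::
  "('o, 'a) moncat \<Rightarrow> ('o, 'a, 'x) univ fun1 \<Rightarrow> ('o, 'a, ('o, 'a, 'x) univ) bimod1" where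
  "Expo_fun A G = Cell (Expo_cat A (src G)) (Expo_cat A (tgt G)) (BiMap
     (FMap
       (\<lambda>F\<in>Obj (Expo_cat A (src G)). Expo_post A G F)
       (\<lambda>t\<in>Arr (Expo_cat A (src G)). NatCode (Cell
          (Expo_post A G (src (unNat t))) (Expo_post A G (tgt (unNat t)))
          (\<lambda>b\<in>Obj A. onArr (dat G) (dat (unNat t) b)))))
     (\<lambda>(a, F)\<in>Obj A \<times> Obj (Expo_cat A (src G)).
        Expo_idn A (tgt G) (Expo_lob A a (Expo_post A G F))))"

definition Expo_nat ::
  "('o, 'a) moncat \<Rightarrow> ('o, 'a, 'x) univ nat2 \<Rightarrow> ('o, 'a, ('o, 'a, 'x) univ) bimod2" where
  "Expo_nat A \<gamma> = Cell (Expo_fun A (src \<gamma>)) (Expo_fun A (tgt \<gamma>))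
     (\<lambda>F\<in>Obj (Expo_cat A (src (src \<gamma>))). NatCode (Cell
        (Expo_post A (src \<gamma>) F) (Expo_post A (tgt \<gamma>) F)
        (\<lambda>b\<in>Obj A. dat \<gamma> (onObj (unFun F) b))))"

definition Expo where
  "Expo A = TFMap (Expo_cat A) (Expo_fun A) (Expo_nat A)"

end

theory Submission imports Defs begin

text \<open>A functor \<open>H0(A,M) \<rightarrow> Y\<close> amounts to a functor \<open>F : M \<rightarrow> Y\<close> together with arrows
\<open>\<psi> a m : F (m \<lhd> a) \<rightarrow> F (a \<rhd> m)\<close> that are natural, trivial at the unit and compatible with \<open>\<otimes>\<close> through
\<open>\<chi>\<close>, because \<open>H0(A,M)\<close> is obtained by adjoining exactly such arrows to \<open>M\<close>. A 1-cell
\<open>(P, r) : M \<rightarrow> [A,Y]\<close> amounts to the same data: strict preservation of the right action forces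
\<open>P m b = (P m \<lhd> b) I = P (m \<lhd> b) I\<close>, so \<open>P\<close> is determined by \<open>F m = P m I\<close>, and the component of
\<open>r a m\<close> at \<open>I\<close> is an arrow \<open>F (m \<lhd> a) = P m a \<rightarrow> P (a \<rhd> m) I = F (a \<rhd> m)\<close>; the conditions on \<open>r\<close>
with respect to \<open>\<chi>\<close> recover the components of \<open>r\<close> at every \<open>b\<close> from those at \<open>I\<close>.

Accordingly the adjunction is given by its unit and counit.

\<^item> The unit \<open>M \<rightarrow> [A, H0(A,M)]\<close> sends \<open>m\<close> to its orbit \<open>b \<mapsto> m \<lhd> b\<close> under the right action. Its
  comparison with the left action has at \<open>b\<close> the component
  \<open>m \<lhd> b \<lhd> a \<rightarrow> a \<rhd> (m \<lhd> b) \<rightarrow> (a \<rhd> m) \<lhd> b\<close>, which is \<open>\<phi>\<close> followed by \<open>\<chi>\<close>. The relation that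
  expresses \<open>\<phi>\<close> at a tensor product through \<open>\<phi>\<close> and \<open>\<chi>\<close> is what makes this multiplicative in \<open>a\<close>
  (\<open>bimodule_map_unit_cell\<close>).
\<^item> The counit \<open>H0(A,[A,Y]) \<rightarrow> Y\<close> evaluates a functor at \<open>I\<close>. It sends \<open>\<phi>\<close> to an identity,
  since \<open>(F \<lhd> a) I = F (a \<otimes> I) = F a = F (I \<otimes> a) = (a \<rhd> F) I\<close> (\<open>cocone_counit\<close>).

The triangle identities then reduce to \<open>m \<lhd> I = m\<close>, to \<open>\<chi> a m I = 1\<close> and to \<open>(F \<lhd> b) I = F b\<close>
(\<open>triangle_H0\<close>, \<open>triangle_Expo\<close>).

Two tools carry the verification. Functors out of \<open>H0(A,M)\<close> and transformations between them are
controlled by the generators: \<open>trace_cocone.lift_funs\<close> gives existence, \<open>H0_functor_eqI\<close> uniqueness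
and \<open>H0_nat_transI\<close> the two-dimensional part. And the actions on \<open>[A,Y]\<close> are precomposition with
\<open>- \<otimes> a\<close> and \<open>a \<otimes> -\<close>, so that the bimodule laws of \<open>[A,Y]\<close> (\<open>bimodule_Expo\<close>) are instances of the
associativity and interchange laws for composing functors and transformations.\<close>

section \<open>Composition of functors and of transformations\<close>

text \<open>Typing of arrows is handled by rewriting: the rules below let the simplifier compute domains and
codomains, and so discharge the composability conditions of the category laws by itself.\<close>

context category
begin

lemma idn_simps [simp]:
  assumes "x \<in> Obj C"
  shows "Idn C x \<in> Arr C" "Dom C (Idn C x) = x" "Cod C (Idn C x) = x"
  using idn_hom[OF assms] by (auto simp: hom_def)

lemma cmp_simps [simp]:
  assumes "f \<in> Arr C" "g \<in> Arr C" "Cod C f = Dom C g"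
  shows "g \<cdot> f \<in> Arr C" "Dom C (g \<cdot> f) = Dom C f" "Cod C (g \<cdot> f) = Cod C g"
  using cmp_hom[OF assms] by (auto simp: hom_def)

lemma cmp_idn [simp]:
  "\<lbrakk>f \<in> Arr C; Cod C f = x\<rbrakk> \<Longrightarrow> Idn C x \<cdot> f = f"
  "\<lbrakk>f \<in> Arr C; Dom C f = x\<rbrakk> \<Longrightarrow> f \<cdot> Idn C x = f"
  using idn_left idn_right by auto

lemmas [simp] = dom_obj cod_obj cmp_assoc

end

context functr
begin

lemma map_arr [simp]:
  assumes "f \<in> Arr C"
  shows "onArr F f \<in> Arr D" "Dom D (onArr F f) = onObj F (Dom C f)"
    "Cod D (onArr F f) = onObj F (Cod C f)"
  using map_hom[OF assms] by (auto simp: hom_def)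

lemmas [simp] = map_obj map_idn map_cmp

end

text \<open>Composites are kept bracketed to the right, where an equation between two composites of two arrows
cannot be used for rewriting once a third arrow stands to their right. This rule, and the next one under a
functor, extend such an equation by an arrow on the right.\<close>

lemma (in category) cmp_eq_assoc:
  assumes "g \<cdot> f = g' \<cdot> f'"
    and "f \<in> Arr C" "g \<in> Arr C" "Cod C f = Dom C g"
    and "f' \<in> Arr C" "g' \<in> Arr C" "Cod C f' = Dom C g'"
    and "h \<in> Arr C" "Cod C h = Dom C f"
  shows "g \<cdot> (f \<cdot> h) = g' \<cdot> (f' \<cdot> h)"
proof -
  have "Dom C (g \<cdot> f) = Dom C (g' \<cdot> f')" by (simp only: assms(1))
  then have "Dom C f = Dom C f'" using assms(2-7) by simp
  then show ?thesis
    using assms cmp_assoc[of h f g] cmp_assoc[of h f' g'] by simp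
qed

lemma (in functr) map_cmp_eq_assoc:
  assumes "g \<cdot>\<^bsub>C\<^esub> f = g' \<cdot>\<^bsub>C\<^esub> f'"
    and "f \<in> Arr C" "g \<in> Arr C" "Cod C f = Dom C g"
    and "f' \<in> Arr C" "g' \<in> Arr C" "Cod C f' = Dom C g'"
    and "h \<in> Arr D" "Cod D h = onObj F (Dom C f)"
  shows "onArr F g \<cdot>\<^bsub>D\<^esub> (onArr F f \<cdot>\<^bsub>D\<^esub> h) = onArr F g' \<cdot>\<^bsub>D\<^esub> (onArr F f' \<cdot>\<^bsub>D\<^esub> h)"
proof -
  have "onArr F (g \<cdot>\<^bsub>C\<^esub> f) = onArr F (g' \<cdot>\<^bsub>C\<^esub> f')" by (simp only: assms(1))
  then have "onArr F g \<cdot>\<^bsub>D\<^esub> onArr F f = onArr F g' \<cdot>\<^bsub>D\<^esub> onArr F f'"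
    using assms(2-7) by simp
  from D.cmp_eq_assoc[OF this] show ?thesis using assms by simp
qed

context nat_trans
begin

lemma comp_simps [simp]:
  assumes "x \<in> Obj C"
  shows "t x \<in> Arr D" "Dom D (t x) = onObj F x" "Cod D (t x) = onObj G x"
  using comp_hom[OF assms] by (auto simp: hom_def)

lemma natural:
  "\<lbrakk>f \<in> Arr C; Dom C f = x; Cod C f = y\<rbrakk> \<Longrightarrow> onArr G f \<cdot>\<^bsub>D\<^esub> t x = t y \<cdot>\<^bsub>D\<^esub> onArr F f"
  using naturality by blast

lemma natural_assoc:
  assumes "f \<in> Arr C" "Dom C f = x" "Cod C f = y" "h \<in> Arr D" "Cod D h = onObj F x"
  shows "onArr G f \<cdot>\<^bsub>D\<^esub> (t x \<cdot>\<^bsub>D\<^esub> h) = t y \<cdot>\<^bsub>D\<^esub> (onArr F f \<cdot>\<^bsub>D\<^esub> h)"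
proof -
  have "x \<in> Obj C" "y \<in> Obj C" using assms by auto
  then show ?thesis
    using assms natural[OF assms(1-3)] by (simp flip: F.D.cmp_assoc)
qed

end

lemma functrI:
  assumes "category C" "category D"
    and "\<And>x. x \<in> Obj C \<Longrightarrow> onObj F x \<in> Obj D"
    and "\<And>f. f \<in> Arr C \<Longrightarrow> onArr F f \<in> Arr D"
    and "\<And>f. f \<in> Arr C \<Longrightarrow> Dom D (onArr F f) = onObj F (Dom C f)"
    and "\<And>f. f \<in> Arr C \<Longrightarrow> Cod D (onArr F f) = onObj F (Cod C f)"
    and "\<And>x. x \<in> Obj C \<Longrightarrow> onArr F (Idn C x) = Idn D (onObj F x)"
    and "\<And>f g. \<lbrakk>f \<in> Arr C; g \<in> Arr C; Cod C f = Dom C g\<rbrakk>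
      \<Longrightarrow> onArr F (g \<cdot>\<^bsub>C\<^esub> f) = onArr F g \<cdot>\<^bsub>D\<^esub> onArr F f"
  shows "functr C D F"
  using assms by (simp add: functr_def functr_axioms_def hom_def)

lemma nat_transI:
  assumes "functr C D F" "functr C D G"
    and "\<And>x. x \<in> Obj C \<Longrightarrow> t x \<in> Arr D"
    and "\<And>x. x \<in> Obj C \<Longrightarrow> Dom D (t x) = onObj F x"
    and "\<And>x. x \<in> Obj C \<Longrightarrow> Cod D (t x) = onObj G x"
    and "\<And>f. f \<in> Arr C \<Longrightarrow> onArr G f \<cdot>\<^bsub>D\<^esub> t (Dom C f) = t (Cod C f) \<cdot>\<^bsub>D\<^esub> onArr F f"
  shows "nat_trans C D F G t"
  using assms by (simp add: nat_trans_def nat_trans_axioms_def hom_def)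

lemma funs_functr [dest]: "F \<in> funs C D \<Longrightarrow> functr C D F"
  by (simp add: funs_def)

lemma nats_nat_trans [dest]: "t \<in> nats C D F G \<Longrightarrow> nat_trans C D F G t"
  by (simp add: nats_def)

lemma funs_eqI:
  assumes "F \<in> funs C D" "G \<in> funs C E"
    and "\<And>x. x \<in> Obj C \<Longrightarrow> onObj F x = onObj G x"
    and "\<And>f. f \<in> Arr C \<Longrightarrow> onArr F f = onArr G f"
  shows "F = G"
  using assms by (auto simp: funs_def intro!: fmap.expand extensionalityI)

lemma nats_eqI:
  assumes "s \<in> nats C D F G" "t \<in> nats C E F' G'"
    and "\<And>x. x \<in> Obj C \<Longrightarrow> s x = t x"
  shows "s = t"
  using assms by (auto simp: nats_def intro!: extensionalityI)

lemma natsI: "\<lbrakk>nat_trans C D F G t; t \<in> extensional (Obj C)\<rbrakk> \<Longrightarrow> t \<in> nats C D F G"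
  by (simp add: nats_def)

lemma funsI: "\<lbrakk>functr C D F; onObj F \<in> extensional (Obj C); onArr F \<in> extensional (Arr C)\<rbrakk>
    \<Longrightarrow> F \<in> funs C D"
  by (simp add: funs_def)

lemma nats_extensional: "t \<in> nats C D F G \<Longrightarrow> t \<in> extensional (Obj C)"
  by (simp add: nats_def)

lemma fcomp_simps [simp]:
  "x \<in> Obj C \<Longrightarrow> onObj (fcomp C G F) x = onObj G (onObj F x)"
  "f \<in> Arr C \<Longrightarrow> onArr (fcomp C G F) f = onArr G (onArr F f)"
  by (simp_all add: fcomp_def)

lemma fid_simps [simp]:
  "x \<in> Obj C \<Longrightarrow> onObj (fid C) x = x"
  "f \<in> Arr C \<Longrightarrow> onArr (fid C) f = f"
  by (simp_all add: fid_def)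

lemma nid_apply [simp]: "x \<in> Obj C \<Longrightarrow> nid C D F x = Idn D (onObj F x)"
  by (simp add: nid_def)

lemma nvcomp_apply [simp]: "x \<in> Obj C \<Longrightarrow> nvcomp C D s t x = s x \<cdot>\<^bsub>D\<^esub> t x"
  by (simp add: nvcomp_def)

lemma nhcomp_apply [simp]:
  "x \<in> Obj C \<Longrightarrow> nhcomp C E G F' s t x = s (onObj F' x) \<cdot>\<^bsub>E\<^esub> onArr G (t x)"
  by (simp add: nhcomp_def)

lemma ext_simps [simp]:
  "onObj (fcomp C G F) \<in> extensional (Obj C)" "onArr (fcomp C G F) \<in> extensional (Arr C)"
  "onObj (fid C) \<in> extensional (Obj C)" "onArr (fid C) \<in> extensional (Arr C)"
  "nid C D F \<in> extensional (Obj C)"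
  by (simp_all add: fcomp_def fid_def nid_def)

lemma ext_comp_simps [simp]:
  "nvcomp C D s t \<in> extensional (Obj C)" "nhcomp C E G F' s' t' \<in> extensional (Obj C)"
  by (simp_all add: nvcomp_def nhcomp_def)

lemma fid_funs: assumes "category C" shows "fid C \<in> funs C C"
proof -
  interpret category C by fact
  show ?thesis by (auto simp: funs_def intro!: functrI category_axioms)
qed

lemma fcomp_functr:
  assumes "functr C D F" "functr D E G" shows "functr C E (fcomp C G F)"
proof -
  interpret F: functr C D F by fact
  interpret G: functr D E G by fact
  show ?thesis by (rule functrI) (simp_all add: F.C.category_axioms G.D.category_axioms)
qed

lemma fcomp_funs:
  assumes "functr C D F" "functr D E G" shows "fcomp C G F \<in> funs C E"
  using fcomp_functr[OF assms] by (simp add: funs_def)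

lemma fcomp_assoc:
  assumes "functr C D F"
  shows "fcomp C H (fcomp C G F) = fcomp C (fcomp D H G) F"
proof -
  interpret F: functr C D F by fact
  show ?thesis by (auto simp: fcomp_def intro!: restrict_ext)
qed

lemma fcomp_fid:
  assumes "F \<in> funs C D" shows "fcomp C (fid D) F = F" "fcomp C F (fid C) = F"
proof -
  interpret F: functr C D F using assms by auto
  have "onObj F \<in> extensional (Obj C)" "onArr F \<in> extensional (Arr C)"
    using assms by (auto simp: funs_def)
  then show "fcomp C (fid D) F = F" "fcomp C F (fid C) = F"
    by (auto intro!: fmap.expand extensionalityI[where A="Obj C"] extensionalityI[where A="Arr C"])
qed

lemma nid_nats: assumes "functr C D F" shows "nid C D F \<in> nats C D F F"
proof -
  interpret F: functr C D F by fact
  show ?thesis by (auto simp: nats_def intro!: nat_transI assms)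
qed

lemma nvcomp_nats:
  assumes "nat_trans C D F G t" "nat_trans C D G H s" shows "nvcomp C D s t \<in> nats C D F H"
proof -
  interpret t: nat_trans C D F G t by fact
  interpret s: nat_trans C D G H s by fact
  show ?thesis
    by (auto simp: nats_def s.natural t.natural s.natural_assoc t.natural_assoc
        intro!: nat_transI t.F.functr_axioms s.G.functr_axioms)
qed

lemma nvcomp_assoc:
  assumes "nat_trans C D F G t" "nat_trans C D G H s" "nat_trans C D H L r"
  shows "nvcomp C D (nvcomp C D r s) t = nvcomp C D r (nvcomp C D s t)"
proof -
  interpret t: nat_trans C D F G t by fact
  interpret s: nat_trans C D G H s by fact
  interpret r: nat_trans C D H L r by fact
  show ?thesis by (auto simp: nvcomp_def)
qed

lemma nvcomp_nid:
  assumes "t \<in> nats C D F G" shows "nvcomp C D (nid C D G) t = t" "nvcomp C D t (nid C D F) = t"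
proof -
  interpret t: nat_trans C D F G t using assms by auto
  have "t \<in> extensional (Obj C)" using assms by (simp add: nats_def)
  then show "nvcomp C D (nid C D G) t = t" "nvcomp C D t (nid C D F) = t"
    by (auto intro!: extensionalityI[where A="Obj C"])
qed

lemma nhcomp_nats:
  assumes "nat_trans C D F F' t" "nat_trans D E G G' s"
  shows "nhcomp C E G F' s t \<in> nats C E (fcomp C G F) (fcomp C G' F')"
proof -
  interpret t: nat_trans C D F F' t by fact
  interpret s: nat_trans D E G G' s by fact
  show ?thesis
    by (auto simp: nats_def t.natural s.natural s.natural_assoc simp flip: s.F.map_cmp
        intro!: nat_transI fcomp_functr t.F.functr_axioms t.G.functr_axioms s.F.functr_axioms
          s.G.functr_axioms)
qed

lemma nhcomp_assoc:
  assumes "nat_trans C D F F' t" "nat_trans D E G G' s" "nat_trans E X H H' r"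
  shows "nhcomp C X (fcomp D H G) F' (nhcomp D X H G' r s) t
    = nhcomp C X H (fcomp C G' F') r (nhcomp C E G F' s t)"
proof -
  interpret t: nat_trans C D F F' t by fact
  interpret s: nat_trans D E G G' s by fact
  interpret r: nat_trans E X H H' r by fact
  show ?thesis by (auto simp: nhcomp_def)
qed

lemma nhcomp_nid_left:
  assumes "t \<in> nats C D F F'" shows "nhcomp C D (fid D) F' (nid D D (fid D)) t = t"
proof -
  interpret t: nat_trans C D F F' t using assms by auto
  have "t \<in> extensional (Obj C)" using assms by (simp add: nats_def)
  then show ?thesis by (auto intro!: extensionalityI[where A="Obj C"])
qed

lemma nhcomp_nid_right:
  assumes "t \<in> nats C D F F'" shows "nhcomp C D F (fid C) t (nid C C (fid C)) = t"
proof -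
  interpret t: nat_trans C D F F' t using assms by auto
  have "t \<in> extensional (Obj C)" using assms by (simp add: nats_def)
  then show ?thesis by (auto intro!: extensionalityI[where A="Obj C"])
qed

lemma nhcomp_nid:
  assumes "functr C D F" "functr D E G"
  shows "nhcomp C E G F (nid D E G) (nid C D F) = nid C E (fcomp C G F)"
proof -
  interpret F: functr C D F by fact
  interpret G: functr D E G by fact
  show ?thesis by (auto simp: nhcomp_def nid_def)
qed

text \<open>Both sides are composites of four components; they differ by one naturality square of \<open>s\<close>, at a
component of \<open>t'\<close>.\<close>

lemma nhcomp_interchange:
  assumes "nat_trans C D F F' t" "nat_trans C D F' F'' t'"
    and "nat_trans D E G G' s" "nat_trans D E G' G'' s'"
  shows "nhcomp C E G F'' (nvcomp D E s' s) (nvcomp C D t' t)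
    = nvcomp C E (nhcomp C E G' F'' s' t') (nhcomp C E G F' s t)"
proof -
  interpret t: nat_trans C D F F' t by fact
  interpret t': nat_trans C D F' F'' t' by fact
  interpret s: nat_trans D E G G' s by fact
  interpret s': nat_trans D E G' G'' s' by fact
  show ?thesis by (auto simp: nhcomp_def nvcomp_def s.natural s.natural_assoc)
qed

section \<open>2-categories and the 2-category of categories\<close>

lemma two_categoryI:
  assumes "category (Base K)" "category (Vert K)" "two_category_axioms K"
  shows "two_category K"
  using assms by (simp add: two_category_def)

lemma two_functorI:
  assumes "two_category K" "two_category L"
    and "functr (Base K) (Base L) (FMap (on0 F) (on1 F))"
    and "functr (Vert K) (Vert L) (FMap (on1 F) (on2 F))"
    and "\<And>\<alpha> \<beta>. \<lbrakk>\<alpha> \<in> Arr (Vert K); \<beta> \<in> Arr (Vert K); hcod2 K \<alpha> = hdom2 K \<beta>\<rbrakk> \<Longrightarrow>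
      on2 F (HCmp K \<beta> \<alpha>) = HCmp L (on2 F \<beta>) (on2 F \<alpha>)"
  shows "two_functor K L F"
  using assms by (simp add: two_functor_def two_functor_axioms_def)

lemma two_functor_tfid: assumes "two_category K" shows "two_functor K K tfid"
proof -
  interpret two_category K by fact
  show ?thesis
    by (rule two_functorI[OF assms assms]) (auto simp: tfid_def intro!: functrI Base.category_axioms Vert.category_axioms)
qed

lemma two_functor_tfcomp:
  assumes "two_functor K L F" "two_functor L X G" shows "two_functor K X (tfcomp G F)"
proof -
  interpret F: two_functor K L F by fact
  interpret G: two_functor L X G by fact
  show ?thesis
  proof (rule two_functorI)
    show "functr (Base K) (Base X) (FMap (on0 (tfcomp G F)) (on1 (tfcomp G F)))"
      using F.Base.map_arr F.Base.map_obj F.Base.map_idn F.Base.map_cmp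
        G.Base.map_arr G.Base.map_obj G.Base.map_idn G.Base.map_cmp
      by (intro functrI) (auto simp: tfcomp_def F.K.Base.category_axioms G.L.Base.category_axioms)
    show "functr (Vert K) (Vert X) (FMap (on1 (tfcomp G F)) (on2 (tfcomp G F)))"
      using F.Vert.map_arr F.Vert.map_obj F.Vert.map_idn F.Vert.map_cmp
        G.Vert.map_arr G.Vert.map_obj G.Vert.map_idn G.Vert.map_cmp
      by (intro functrI) (auto simp: tfcomp_def F.K.Vert.category_axioms G.L.Vert.category_axioms)
    show "on2 (tfcomp G F) (HCmp K \<beta> \<alpha>) = HCmp X (on2 (tfcomp G F) \<beta>) (on2 (tfcomp G F) \<alpha>)"
      if "\<alpha> \<in> Arr (Vert K)" "\<beta> \<in> Arr (Vert K)" "hcod2 K \<alpha> = hdom2 K \<beta>" for \<alpha> \<beta>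
      using that F.map_hcmp G.map_hcmp F.Vert.map_arr F.Base.map_arr F.K.vert_obj F.K.Vert.dom_obj
      by (simp add: tfcomp_def hcod2_def hdom2_def)
  qed (rule F.K.two_category_axioms G.L.two_category_axioms)+
qed

lemma two_naturalI:
  assumes "two_functor K L F" "two_functor K L G"
    and "\<And>x. x \<in> Obj (Base K) \<Longrightarrow> \<eta> x \<in> hom (Base L) (on0 F x) (on0 G x)"
    and "\<And>f. f \<in> Arr (Base K) \<Longrightarrow>
      on1 G f \<cdot>\<^bsub>Base L\<^esub> \<eta> (Dom (Base K) f) = \<eta> (Cod (Base K) f) \<cdot>\<^bsub>Base L\<^esub> on1 F f"
    and "\<And>\<alpha>. \<alpha> \<in> Arr (Vert K) \<Longrightarrow>
      HCmp L (on2 G \<alpha>) (Idn (Vert L) (\<eta> (hdom2 K \<alpha>))) =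
      HCmp L (Idn (Vert L) (\<eta> (hcod2 K \<alpha>))) (on2 F \<alpha>)"
  shows "two_natural K L F G \<eta>"
  using assms by (simp add: two_natural_def two_natural_axioms_def)

lemma tf_simps [simp]: "on0 tfid x = x" "on1 tfid f = f" "on2 tfid \<alpha> = \<alpha>"
  "on0 (tfcomp G F) x = on0 G (on0 F x)" "on1 (tfcomp G F) f = on1 G (on1 F f)"
  "on2 (tfcomp G F) \<alpha> = on2 G (on2 F \<alpha>)"
  by (simp_all add: tfid_def tfcomp_def)

lemma category_Cat1: "category Cat1"
proof
qed (auto simp: Cat1_def hom_def fid_funs fcomp_fid intro!: fcomp_funs fcomp_assoc[symmetric]
     cell.expand intro: functr.axioms dest: funs_functr)

lemma CAT_simps [simp]: "Base CAT = Cat1" "Obj (Vert CAT) = Arr Cat1"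
  "Dom (Vert CAT) = src" "Cod (Vert CAT) = tgt"
  "Dom Cat1 = src" "Cod Cat1 = tgt"
  "hdom2 CAT \<alpha> = src (src \<alpha>)" "hcod2 CAT \<alpha> = tgt (src \<alpha>)"
  by (simp_all add: CAT_def Cat1_def hdom2_def hcod2_def)

lemma category_Vert_CAT: "category (Vert CAT)"
    by standard
      (auto simp: CAT_def Cat1_def hom_def nvcomp_nid intro!: nid_nats nvcomp_nats nvcomp_assoc cell.expand)

lemma two_category_CAT: "two_category CAT"
  by (rule two_categoryI; (simp add: category_Cat1 category_Vert_CAT)?)
    (auto simp: two_category_axioms_def CAT_def Cat1_def hdom2_def hcod2_def hom_def 
      nhcomp_nid_left nhcomp_nid_right fcomp_fid
     intro!: fcomp_funs nhcomp_nats nhcomp_assoc nhcomp_nid nhcomp_interchange fcomp_assoc[symmetric] cell.expand)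

lemma CAT_cell_simps [simp]:
  "\<alpha> \<in> Arr (Vert CAT) \<longleftrightarrow> src \<alpha> \<in> Arr Cat1 \<and> tgt \<alpha> \<in> Arr Cat1 \<and>
                 src (src \<alpha>) = src (tgt \<alpha>) \<and> tgt (src \<alpha>) = tgt (tgt \<alpha>) \<and>
                 dat \<alpha> \<in> nats (src (src \<alpha>)) (tgt (src \<alpha>)) (dat (src \<alpha>)) (dat (tgt \<alpha>))"
  "Obj Cat1 = {C. category C}"
  "F \<in> Arr Cat1 \<longleftrightarrow> dat F \<in> funs (src F) (tgt F)"
  "Idn Cat1 C = Cell C C (fid C)"
  "Cmp Cat1 G F = Cell (src F) (tgt G) (fcomp (src F) (dat G) (dat F))"
  "Idn (Vert CAT) F = Cell F F (nid (src F) (tgt F) (dat F))"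
  "Cmp (Vert CAT) \<beta> \<alpha> = Cell (src \<alpha>) (tgt \<beta>)
                (nvcomp (src (src \<alpha>)) (tgt (src \<alpha>)) (dat \<beta>) (dat \<alpha>))"
  "HCmp CAT \<beta> \<alpha> = Cell (Cmp Cat1 (src \<beta>) (src \<alpha>)) (Cmp Cat1 (tgt \<beta>) (tgt \<alpha>))
                (nhcomp (src (src \<alpha>)) (tgt (src \<beta>)) (dat (src \<beta>)) (dat (tgt \<alpha>)) (dat \<beta>) (dat \<alpha>))"
  by (simp_all add: CAT_def Cat1_def)

lemma Cat1_arrE:
  assumes "F \<in> Arr Cat1" obtains C D f where "F = Cell C D f" "f \<in> funs C D" "functr C D f"
  using assms by (cases F) auto

lemma CAT_arrE:
  assumes "\<alpha> \<in> Arr (Vert CAT)"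
  obtains C D f g t where "\<alpha> = Cell (Cell C D f) (Cell C D g) t"
    "f \<in> funs C D" "g \<in> funs C D" "t \<in> nats C D f g" "nat_trans C D f g t"
proof -
  obtain F G t where \<alpha>: "\<alpha> = Cell F G t" by (cases \<alpha>)
  obtain C D f where F: "F = Cell C D f" by (cases F)
  obtain C' D' g where G: "G = Cell C' D' g" by (cases G)
  have [simp]: "C' = C" "D' = D" using assms by (simp_all add: \<alpha> F G)
  from assms show thesis by (intro that[of C D f g t]) (auto simp: \<alpha> F G)
qed

section \<open>The 2-category of bimodules\<close>

lemma prod_cat_simps [simp]:
  "Obj (prod_cat C D) = Obj C \<times> Obj D" "Arr (prod_cat C D) = Arr C \<times> Arr D"
  "Dom (prod_cat C D) (f, g) = (Dom C f, Dom D g)" "Cod (prod_cat C D) (f, g) = (Cod C f, Cod D g)"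
  "Idn (prod_cat C D) (x, y) = (Idn C x, Idn D y)"
  "Cmp (prod_cat C D) (f', g') (f, g) = (Cmp C f' f, Cmp D g' g)"
  by (simp_all add: prod_cat_def)

text \<open>The actions of a bimodule are functors on product categories, so exhibiting a bimodule requires
these to be categories.\<close>

lemma category_prod:
  assumes "category C" "category D" shows "category (prod_cat C D)"
proof -
  interpret C: category C by fact
  interpret D: category D by fact
  show ?thesis by standard (auto simp: hom_def)
qed

context strict_monoidal
begin

lemma tob_obj [simp]: "\<lbrakk>a \<in> Obj A; b \<in> Obj A\<rbrakk> \<Longrightarrow> tob A a b \<in> Obj A"
  using functr.map_obj[OF tensor_functr, of "(a, b)"] by simp

lemma tar_simps [simp]:
  assumes "f \<in> Arr A" "g \<in> Arr A"
  shows "tar A f g \<in> Arr A" "Dom A (tar A f g) = tob A (Dom A f) (Dom A g)"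
    "Cod A (tar A f g) = tob A (Cod A f) (Cod A g)"
  using functr.map_hom[OF tensor_functr, of "(f, g)"] assms by (simp_all add: hom_def)

lemma tar_idn [simp]:
  "\<lbrakk>a \<in> Obj A; b \<in> Obj A\<rbrakk> \<Longrightarrow> tar A (Idn A a) (Idn A b) = Idn A (tob A a b)"
  using functr.map_idn[OF tensor_functr, of "(a, b)"] by simp

lemma tar_cmp:
  "\<lbrakk>f \<in> Arr A; f' \<in> Arr A; Cod A f = Dom A f'; g \<in> Arr A; g' \<in> Arr A; Cod A g = Dom A g'\<rbrakk>
    \<Longrightarrow> tar A f' g' \<cdot>\<^bsub>A\<^esub> tar A f g = tar A (f' \<cdot>\<^bsub>A\<^esub> f) (g' \<cdot>\<^bsub>A\<^esub> g)"
  using functr.map_cmp[OF tensor_functr, of "(f, g)" "(f', g')"] by simp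

lemmas [simp] = unt_obj tob_assoc tar_assoc tob_unt tar_unt

end

context bimodule
begin

lemma lob_obj [simp]: "\<lbrakk>a \<in> Obj A; m \<in> Obj M\<rbrakk> \<Longrightarrow> lob M a m \<in> Obj M"
  using functr.map_obj[OF left_functr, of "(a, m)"] by simp

lemma lar_simps [simp]:
  assumes "f \<in> Arr A" "k \<in> Arr M"
  shows "lar M f k \<in> Arr M" "Dom M (lar M f k) = lob M (Dom A f) (Dom M k)"
    "Cod M (lar M f k) = lob M (Cod A f) (Cod M k)"
  using functr.map_hom[OF left_functr, of "(f, k)"] assms by (simp_all add: hom_def)

lemma lar_idn [simp]:
  "\<lbrakk>a \<in> Obj A; m \<in> Obj M\<rbrakk> \<Longrightarrow> lar M (Idn A a) (Idn M m) = Idn M (lob M a m)"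
  using functr.map_idn[OF left_functr, of "(a, m)"] by simp

lemma lar_cmp:
  "\<lbrakk>f \<in> Arr A; f' \<in> Arr A; Cod A f = Dom A f'; k \<in> Arr M; k' \<in> Arr M; Cod M k = Dom M k'\<rbrakk>
    \<Longrightarrow> lar M (f' \<cdot>\<^bsub>A\<^esub> f) (k' \<cdot>\<^bsub>M\<^esub> k) = lar M f' k' \<cdot>\<^bsub>M\<^esub> lar M f k"
  using functr.map_cmp[OF left_functr, of "(f, k)" "(f', k')"] by simp

lemma lar_idn_cmp [simp]:
  "\<lbrakk>a \<in> Obj A; k \<in> Arr M; k' \<in> Arr M; Cod M k = Dom M k'\<rbrakk>
    \<Longrightarrow> lar M (Idn A a) (k' \<cdot>\<^bsub>M\<^esub> k) = lar M (Idn A a) k' \<cdot>\<^bsub>M\<^esub> lar M (Idn A a) k"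
  using lar_cmp[of "Idn A a" "Idn A a" k k'] by simp

lemma rob_obj [simp]: "\<lbrakk>m \<in> Obj M; a \<in> Obj A\<rbrakk> \<Longrightarrow> rob M m a \<in> Obj M"
  using functr.map_obj[OF right_functr, of "(m, a)"] by simp

lemma rar_simps [simp]:
  assumes "k \<in> Arr M" "f \<in> Arr A"
  shows "rar M k f \<in> Arr M" "Dom M (rar M k f) = rob M (Dom M k) (Dom A f)"
    "Cod M (rar M k f) = rob M (Cod M k) (Cod A f)"
  using functr.map_hom[OF right_functr, of "(k, f)"] assms by (simp_all add: hom_def)

lemma rar_idn [simp]:
  "\<lbrakk>m \<in> Obj M; a \<in> Obj A\<rbrakk> \<Longrightarrow> rar M (Idn M m) (Idn A a) = Idn M (rob M m a)"
  using functr.map_idn[OF right_functr, of "(m, a)"] by simp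

lemma rar_cmp:
  "\<lbrakk>k \<in> Arr M; k' \<in> Arr M; Cod M k = Dom M k'; f \<in> Arr A; f' \<in> Arr A; Cod A f = Dom A f'\<rbrakk>
    \<Longrightarrow> rar M (k' \<cdot>\<^bsub>M\<^esub> k) (f' \<cdot>\<^bsub>A\<^esub> f) = rar M k' f' \<cdot>\<^bsub>M\<^esub> rar M k f"
  using functr.map_cmp[OF right_functr, of "(k, f)" "(k', f')"] by simp

lemma rar_cmp_idn [simp]:
  "\<lbrakk>a \<in> Obj A; k \<in> Arr M; k' \<in> Arr M; Cod M k = Dom M k'\<rbrakk>
    \<Longrightarrow> rar M (k' \<cdot>\<^bsub>M\<^esub> k) (Idn A a) = rar M k' (Idn A a) \<cdot>\<^bsub>M\<^esub> rar M k (Idn A a)"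
  using rar_cmp[of k k' "Idn A a" "Idn A a"] by simp

lemma chi_simps [simp]:
  assumes "a \<in> Obj A" "m \<in> Obj M" "b \<in> Obj A"
  shows "chi M a m b \<in> Arr M" "Dom M (chi M a m b) = lob M a (rob M m b)"
    "Cod M (chi M a m b) = rob M (lob M a m) b"
  using chi_hom[OF assms] by (auto simp: hom_def)

lemmas [simp] = lob_tob lar_tar lob_unt lar_unt rob_tob rar_tar rob_unt rar_unt
  chi_unt_left chi_unt_right

end

text \<open>The naturality and compatibility conditions on \<open>r\<close> are needed in the middle of longer composites,
hence the versions with an arrow to the right.\<close>

context bimodule_map
begin

lemma brr_simps [simp]:
  assumes "a \<in> Obj A" "m \<in> Obj M"
  shows "brr P (a, m) \<in> Arr N" "Dom N (brr P (a, m)) = lob N a (onObj (bfun P) m)"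
    "Cod N (brr P (a, m)) = onObj (bfun P) (lob M a m)"
  using brr_hom[OF assms] by (auto simp: hom_def)

lemmas [simp] = pres_rob pres_rar brr_unt

lemma brr_nat:
  "\<lbrakk>f \<in> Arr A; k \<in> Arr M; Dom A f = a; Dom M k = m; Cod A f = a'; Cod M k = m'\<rbrakk> \<Longrightarrow>
      onArr (bfun P) (lar M f k) \<cdot>\<^bsub>N\<^esub> brr P (a, m) =
      brr P (a', m') \<cdot>\<^bsub>N\<^esub> lar N f (onArr (bfun P) k)"
  using brr_natural by blast

lemma brr_nat_assoc:
  assumes "f \<in> Arr A" "k \<in> Arr M" "Dom A f = a" "Dom M k = m" "Cod A f = a'" "Cod M k = m'"
    "h \<in> Arr N" "Cod N h = lob N a (onObj (bfun P) m)"
  shows "onArr (bfun P) (lar M f k) \<cdot>\<^bsub>N\<^esub> (brr P (a, m) \<cdot>\<^bsub>N\<^esub> h) =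
      brr P (a', m') \<cdot>\<^bsub>N\<^esub> (lar N f (onArr (bfun P) k) \<cdot>\<^bsub>N\<^esub> h)"
  by (rule N.M.cmp_eq_assoc[OF brr_nat]; use assms in force)

end

context bimodule_trans
begin

lemma pres_left_assoc:
  assumes "a \<in> Obj A" "m \<in> Obj M" "h \<in> Arr N" "Cod N h = lob N a (onObj (bfun P) m)"
  shows "t (lob M a m) \<cdot>\<^bsub>N\<^esub> (brr P (a, m) \<cdot>\<^bsub>N\<^esub> h)
    = brr Q (a, m) \<cdot>\<^bsub>N\<^esub> (lar N (Idn A a) (t m) \<cdot>\<^bsub>N\<^esub> h)"
  by (rule P.N.M.cmp_eq_assoc[OF pres_left]; use assms in force)

end

definition bimap_id :: "('o, 'a) moncat \<Rightarrow> ('o, 'a, 'u) bimod \<Rightarrow> ('o, 'u) bimap" where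
  "bimap_id A M = BiMap (fid M) (\<lambda>(a, m)\<in>Obj A \<times> Obj M. Idn M (lob M a m))"

definition bimap_comp :: "('o, 'a) moncat \<Rightarrow> ('o, 'a, 'u) bimod \<Rightarrow> ('o, 'a, 'u) bimod
   \<Rightarrow> ('o, 'u) bimap \<Rightarrow> ('o, 'u) bimap \<Rightarrow> ('o, 'u) bimap" where
  "bimap_comp A M R Q P = BiMap (fcomp M (bfun Q) (bfun P))
     (\<lambda>(a, m)\<in>Obj A \<times> Obj M.
        onArr (bfun Q) (brr P (a, m)) \<cdot>\<^bsub>R\<^esub> brr Q (a, onObj (bfun P) m))"

lemma bimap_simps [simp]:
  "bfun (bimap_id A M) = fid M" "bfun (bimap_comp A M R Q P) = fcomp M (bfun Q) (bfun P)"
  "\<lbrakk>a \<in> Obj A; m \<in> Obj M\<rbrakk> \<Longrightarrow> brr (bimap_id A M) (a, m) = Idn M (lob M a m)"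
  "\<lbrakk>a \<in> Obj A; m \<in> Obj M\<rbrakk> \<Longrightarrow> brr (bimap_comp A M R Q P) (a, m)
    = onArr (bfun Q) (brr P (a, m)) \<cdot>\<^bsub>R\<^esub> brr Q (a, onObj (bfun P) m)"
  "brr (bimap_id A M) \<in> extensional (Obj A \<times> Obj M)"
  "brr (bimap_comp A M R Q P) \<in> extensional (Obj A \<times> Obj M)"
  by (simp_all add: bimap_id_def bimap_comp_def)

lemma bimodule_mapI:
  assumes "bimodule A M" "bimodule A N" "functr M N (bfun P)" "bimodule_map_axioms A M N P"
  shows "bimodule_map A M N P"
  using assms by (simp add: bimodule_map_def)

lemma bimodule_map_id: assumes "bimodule A M" shows "bimodule_map A M M (bimap_id A M)"
proof -
  interpret bimodule A M by fact
  show ?thesis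
    by (rule bimodule_mapI)
      (auto simp: bimodule_axioms bimodule_map_axioms_def fid_funs M.category_axioms hom_def
        intro!: funs_functr)
qed

text \<open>The composite comparison is \<open>A \<rhd> QPm \<rightarrow> Q(A \<rhd> Pm) \<rightarrow> QP(A \<rhd> m)\<close>. Each condition holds by applying \<open>Q\<close>
to the condition for \<open>P\<close> and then using the condition for \<open>Q\<close> at the object \<open>P m\<close>.\<close>

lemma bimodule_map_comp:
  assumes "bimodule_map A M N P" "bimodule_map A N R Q"
  shows "bimodule_map A M R (bimap_comp A M R Q P)"
proof -
  interpret P: bimodule_map A M N P by fact
  interpret Q: bimodule_map A N R Q by fact
  have 1: "functr M R (bfun (bimap_comp A M R Q P))"
    by (simp add: fcomp_functr[OF P.P.functr_axioms Q.P.functr_axioms])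
  show ?thesis
  proof (rule bimodule_mapI[OF _ _ 1], goal_cases)
    case 3
    have natural: "onArr (bfun Q) (onArr (bfun P) (lar M f k)) \<cdot>\<^bsub>R\<^esub>
        (onArr (bfun Q) (brr P (Dom A f, Dom M k)) \<cdot>\<^bsub>R\<^esub>
          brr Q (Dom A f, onObj (bfun P) (Dom M k))) =
      onArr (bfun Q) (brr P (Cod A f, Cod M k)) \<cdot>\<^bsub>R\<^esub>
        (brr Q (Cod A f, onObj (bfun P) (Cod M k)) \<cdot>\<^bsub>R\<^esub>
          lar R f (onArr (bfun Q) (onArr (bfun P) k)))"
      if "f \<in> Arr A" "k \<in> Arr M" for f k
      using that Q.P.map_cmp_eq_assoc[OF P.brr_natural[OF that]] by (simp add: Q.brr_nat)
    have chi: "onArr (bfun Q) (onArr (bfun P) (chi M a m b)) \<cdot>\<^bsub>R\<^esub>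
        (onArr (bfun Q) (brr P (a, rob M m b)) \<cdot>\<^bsub>R\<^esub> brr Q (a, onObj (bfun P) (rob M m b))) =
      rar R (onArr (bfun Q) (brr P (a, m))) (Idn A b) \<cdot>\<^bsub>R\<^esub>
        (rar R (brr Q (a, onObj (bfun P) m)) (Idn A b) \<cdot>\<^bsub>R\<^esub>
          chi R a (onObj (bfun Q) (onObj (bfun P) m)) b)"
      if "a \<in> Obj A" "m \<in> Obj M" "b \<in> Obj A" for a m b
      using that Q.P.map_cmp_eq_assoc[OF P.brr_chi[OF that], of "brr Q (a, onObj (bfun P) (rob M m b))"]
      by (simp add: Q.brr_chi flip: P.pres_rob)
    show ?case
      by (auto simp: bimodule_map_axioms_def hom_def natural chi P.brr_tob Q.brr_tob
          Q.brr_nat_assoc)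
  qed (rule P.M.bimodule_axioms Q.N.bimodule_axioms)+
qed

lemma bimodule_transI:
  assumes "bimodule_map A M N P" "bimodule_map A M N Q"
    and "t \<in> nats M N (bfun P) (bfun Q)"
    and "\<And>a m. \<lbrakk>a \<in> Obj A; m \<in> Obj M\<rbrakk> \<Longrightarrow>
      t (lob M a m) \<cdot>\<^bsub>N\<^esub> brr P (a, m) = brr Q (a, m) \<cdot>\<^bsub>N\<^esub> lar N (Idn A a) (t m)"
    and "\<And>m b. \<lbrakk>m \<in> Obj M; b \<in> Obj A\<rbrakk> \<Longrightarrow> t (rob M m b) = rar N (t m) (Idn A b)"
  shows "bimodule_trans A M N P Q t"
  using assms by (auto simp: bimodule_trans_def bimodule_trans_axioms_def nats_def)

lemma bimodule_trans_nid:
  assumes "bimodule_map A M N P"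
  shows "bimodule_trans A M N P P (nid M N (bfun P))"
proof -
  interpret bimodule_map A M N P by fact
  show ?thesis
    by (rule bimodule_transI) (auto simp: assms intro!: nid_nats P.functr_axioms)
qed

lemma bimodule_trans_nvcomp:
  assumes "bimodule_trans A M N P Q t" "bimodule_trans A M N Q R s"
  shows "bimodule_trans A M N P R (nvcomp M N s t)"
proof -
  interpret t: bimodule_trans A M N P Q t by fact
  interpret s: bimodule_trans A M N Q R s by fact
  show ?thesis
    by (rule bimodule_transI)
      (auto simp: t.P.bimodule_map_axioms s.Q.bimodule_map_axioms t.pres_left t.pres_right 
        s.pres_left s.pres_right t.pres_left_assoc s.pres_left_assoc
       intro!: nvcomp_nats t.nat_trans_axioms s.nat_trans_axioms)
qed

text \<open>For compatibility with the left action, apply \<open>Q\<close> to the condition on \<open>t\<close>, slide the comparison of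
\<open>Q\<close> past \<open>Q t\<close> by its naturality, and use the condition on \<open>s\<close> at \<open>P' m\<close>.\<close>

lemma bimodule_trans_nhcomp:
  assumes "bimodule_trans A M N P P' t" "bimodule_trans A N R Q Q' s"
  shows "bimodule_trans A M R (bimap_comp A M R Q P) (bimap_comp A M R Q' P')
    (nhcomp M R (bfun Q) (bfun P') s t)"
proof -
  interpret t: bimodule_trans A M N P P' t by fact
  interpret s: bimodule_trans A N R Q Q' s by fact
  show ?thesis
  proof (rule bimodule_transI)
    fix a m assume m: "a \<in> Obj A" "m \<in> Obj M"
    have "onArr (bfun Q) (t (lob M a m)) \<cdot>\<^bsub>R\<^esub> (onArr (bfun Q) (brr P (a, m)) \<cdot>\<^bsub>R\<^esub>
         brr Q (a, onObj (bfun P) m)) = onArr (bfun Q) (brr P' (a, m)) \<cdot>\<^bsub>R\<^esub>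
         (onArr (bfun Q) (lar N (Idn A a) (t m)) \<cdot>\<^bsub>R\<^esub> brr Q (a, onObj (bfun P) m))"
      by (rule s.P.P.map_cmp_eq_assoc[OF t.pres_left]) (use m in auto)
    then show "nhcomp M R (bfun Q) (bfun P') s t (lob M a m) \<cdot>\<^bsub>R\<^esub> brr (bimap_comp A M R Q P) (a, m) =
      brr (bimap_comp A M R Q' P') (a, m) \<cdot>\<^bsub>R\<^esub> lar R (Idn A a) (nhcomp M R (bfun Q) (bfun P') s t m)"
      using m by (simp add: s.P.brr_nat s.natural_assoc[symmetric] s.pres_left s.pres_left_assoc)
  qed (auto simp: t.pres_right s.pres_right bimodule_map_comp[OF t.P.bimodule_map_axioms s.P.bimodule_map_axioms]
    bimodule_map_comp[OF t.Q.bimodule_map_axioms s.Q.bimodule_map_axioms] simp flip: t.Q.pres_rob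
    intro!: nhcomp_nats t.nat_trans_axioms s.nat_trans_axioms)
qed

lemma bimap_eqI:
  assumes "bfun P = bfun Q"
    and "brr P \<in> extensional (Obj A \<times> Obj M)" "brr Q \<in> extensional (Obj A \<times> Obj M)"
    and "\<And>a m. \<lbrakk>a \<in> Obj A; m \<in> Obj M\<rbrakk> \<Longrightarrow> brr P (a, m) = brr Q (a, m)"
  shows "P = Q"
  using assms by (auto intro!: bimap.expand extensionalityI)

lemma Bimod1_simps [simp]:
  "Obj (Bimod1 A) = {M. bimodule A M}" "Dom (Bimod1 A) = src" "Cod (Bimod1 A) = tgt"
  "Idn (Bimod1 A) M = Cell M M (bimap_id A M)"
  "Cmp (Bimod1 A) R P = Cell (src P) (tgt R) (bimap_comp A (src P) (tgt R) (dat R) (dat P))"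
  "P \<in> Arr (Bimod1 A) \<longleftrightarrow> bimodule_map A (src P) (tgt P) (dat P) \<and>
     bfun (dat P) \<in> funs (src P) (tgt P) \<and> brr (dat P) \<in> extensional (Obj A \<times> Obj (src P))"
  by (simp_all add: Bimod1_def bimap_id_def bimap_comp_def)

lemma bimap_comp_id:
  assumes "bimodule_map A M N P" "bfun P \<in> funs M N" "brr P \<in> extensional (Obj A \<times> Obj M)"
  shows "bimap_comp A M N P (bimap_id A M) = P" "bimap_comp A M N (bimap_id A N) P = P"
proof -
  interpret bimodule_map A M N P by fact
  show "bimap_comp A M N P (bimap_id A M) = P" "bimap_comp A M N (bimap_id A N) P = P"
    by (rule bimap_eqI[of _ _ A M]; simp add: assms fcomp_fid[OF assms(2)])+
qed

lemma bimap_comp_assoc: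
  assumes "bimodule_map A M N P" "bimodule_map A N L Q" "bimodule_map A L X R"
  shows "bimap_comp A M X (bimap_comp A N X R Q) P = bimap_comp A M X R (bimap_comp A M L Q P)"
proof -
  interpret P: bimodule_map A M N P by fact
  interpret Q: bimodule_map A N L Q by fact
  interpret R: bimodule_map A L X R by fact
  show ?thesis
    by (rule bimap_eqI[of _ _ A M]; simp add: fcomp_assoc[OF P.P.functr_axioms])
qed

lemma bimodule_map_functr: "bimodule_map A M N P \<Longrightarrow> functr M N (bfun P)"
  by (simp add: bimodule_map_def)

lemma bimodule_map_bimodule:
  "bimodule_map A M N P \<Longrightarrow> bimodule A M" "bimodule_map A M N P \<Longrightarrow> bimodule A N"
  by (simp_all add: bimodule_map_def)

lemma bimodule_category: "bimodule A M \<Longrightarrow> category M"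
  by (simp add: bimodule_def)

lemma bimodule_trans_nat: "bimodule_trans A M N P Q t \<Longrightarrow> nat_trans M N (bfun P) (bfun Q) t"
  by (simp add: bimodule_trans_def)

lemma bimodule_trans_nats:
  "\<lbrakk>bimodule_trans A M N P Q t; t \<in> extensional (Obj M)\<rbrakk> \<Longrightarrow> t \<in> nats M N (bfun P) (bfun Q)"
  by (simp add: bimodule_trans_def nats_def)

lemma category_Bimod1: "category (Bimod1 A)"
  by standard
    (auto simp: hom_def bimap_comp_id bimap_comp_assoc bimodule_category bimodule_map_functr
      intro!: bimodule_map_id bimodule_map_comp fid_funs fcomp_funs cell.expand
      intro: bimodule_map_bimodule)

lemma BIMOD_simps [simp]: "Base (BIMOD A) = Bimod1 A" 
  "Obj (Vert (BIMOD A)) = Arr (Bimod1 A)"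
  "Dom (Vert (BIMOD A)) = src" "Cod (Vert (BIMOD A)) = tgt"
  "hdom2 (BIMOD A) \<alpha> = src (src \<alpha>)" "hcod2 (BIMOD A) \<alpha> = tgt (src \<alpha>)"
  "\<alpha> \<in> Arr (Vert (BIMOD A)) \<longleftrightarrow> src \<alpha> \<in> Arr (Bimod1 A) \<and> tgt \<alpha> \<in> Arr (Bimod1 A) \<and>
     src (src \<alpha>) = src (tgt \<alpha>) \<and> tgt (src \<alpha>) = tgt (tgt \<alpha>) \<and>
     bimodule_trans A (src (src \<alpha>)) (tgt (src \<alpha>)) (dat (src \<alpha>)) (dat (tgt \<alpha>)) (dat \<alpha>) \<and>
     dat \<alpha> \<in> extensional (Obj (src (src \<alpha>)))"
  "Idn (Vert (BIMOD A)) P = Cell P P (nid (src P) (tgt P) (bfun (dat P)))"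
  "Cmp (Vert (BIMOD A)) \<beta> \<alpha> = Cell (src \<alpha>) (tgt \<beta>)
                (nvcomp (src (src \<alpha>)) (tgt (src \<alpha>)) (dat \<beta>) (dat \<alpha>))"
  "HCmp (BIMOD A) \<beta> \<alpha> = Cell (Cmp (Bimod1 A) (src \<beta>) (src \<alpha>)) (Cmp (Bimod1 A) (tgt \<beta>) (tgt \<alpha>))
                (nhcomp (src (src \<alpha>)) (tgt (src \<beta>))
                   (bfun (dat (src \<beta>))) (bfun (dat (tgt \<alpha>))) (dat \<beta>) (dat \<alpha>))"
  by (simp_all add: BIMOD_def hdom2_def hcod2_def Bimod1_def bimap_id_def bimap_comp_def)

lemma category_Vert_BIMOD: "category (Vert (BIMOD A))"
  by standard
    (auto simp: hom_def bimodule_map_functr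
      intro!: bimodule_trans_nid nvcomp_assoc nvcomp_nid bimodule_trans_nats cell.expand 
     intro: bimodule_trans_nvcomp bimodule_trans_nat)

text \<open>2-cells of bimodules compose as transformations do, so beyond closure under the compositions only
the laws for 1-cells are new.\<close>

lemma two_category_BIMOD: "two_category (BIMOD A)"
  by (rule two_categoryI; (simp add: category_Bimod1 category_Vert_BIMOD)?)
    (auto simp: two_category_axioms_def hom_def bimap_comp_id bimap_comp_assoc
      bimodule_map_functr
      intro!: nhcomp_nid_left nhcomp_nid_right bimodule_trans_nats fcomp_funs nhcomp_nid nhcomp_interchange nhcomp_assoc cell.expand
        bimodule_map_comp bimodule_trans_nhcomp
      intro: bimodule_trans_nat bimodule_map_functr)

section \<open>The universal property of \<open>H0\<close>\<close>

text \<open>Arrows of \<open>H0\<close> are codes of terms, which only exist in a universe type; this fixes the types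
accordingly.\<close>

locale univ_bimodule = bimodule A M
  for A :: "('o, 'a) moncat" and M :: "('o, 'a, ('o, 'a, 'x) univ) bimod"

definition H0_emb :: "('o, 'a) moncat \<Rightarrow> ('o, 'a, ('o, 'a, 'x) univ) bimod
    \<Rightarrow> ('o, 'a, 'x) univ \<Rightarrow> ('o, 'a, 'x) univ" where
  "H0_emb A M f = hcls A M (Emb f)"

definition H0_phi :: "('o, 'a) moncat \<Rightarrow> ('o, 'a, ('o, 'a, 'x) univ) bimod
    \<Rightarrow> 'o \<Rightarrow> ('o, 'a, 'x) univ \<Rightarrow> ('o, 'a, 'x) univ" where
  "H0_phi A M a m = hcls A M (Phi a m)"

lemma H0_cat_obj [simp]: "Obj (H0_cat A M) = Obj M"
  by (simp add: H0_cat_def)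

context bimodule
begin

lemma hwf_obj: "hwf A M t \<Longrightarrow> hdom M t \<in> Obj M \<and> hcod M t \<in> Obj M"
  by (induction t) auto

text \<open>The relations identify only parallel, well-formed terms. This is what makes \<open>Dom\<close> and \<open>Cod\<close> of
\<open>H0\<close>, which are read off a chosen representative, independent of the choice.\<close>

lemma heq_hwf:
  "heq A M s t \<Longrightarrow> hwf A M s \<and> hwf A M t \<and> hdom M s = hdom M t \<and> hcod M s = hcod M t"
  by (induction rule: heq.induct) (auto simp: hwf_obj)

end

context univ_bimodule
begin

text \<open>By symmetry and transitivity, equivalent terms have the same class as a predicate, so the choice
operator picks the same representative for both.\<close>

lemma hcls_eqI: assumes "heq A M s t" shows "hcls A M s = hcls A M t"
proof -
  have "heq A M s = heq A M t"
    using assms by (blast intro: heq_sym heq_trans)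
  then show ?thesis by (simp add: hcls_def)
qed

lemma heq_unTerm:
  assumes "hwf A M t" shows "heq A M t (unTerm (hcls A M t))"
  using someI[of "heq A M t", OF heq_refl[OF assms]] by (simp add: hcls_def)

lemma hcls_simps [simp]:
  assumes "hwf A M t"
  shows "hcls A M t \<in> Arr (H0_cat A M)" "Dom (H0_cat A M) (hcls A M t) = hdom M t"
    "Cod (H0_cat A M) (hcls A M t) = hcod M t"
  using assms heq_hwf[OF heq_unTerm[OF assms]] by (auto simp: H0_cat_def)

lemma hcls_cmp:
  assumes "hwf A M s" "hwf A M t" "hcod M s = hdom M t"
  shows "hcls A M t \<cdot>\<^bsub>H0_cat A M\<^esub> hcls A M s = hcls A M (Circ t s)"
proof -
  have "heq A M (Circ t s) (Circ (unTerm (hcls A M t)) (unTerm (hcls A M s)))"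
    by (intro heq_circ heq_unTerm assms)
  from hcls_eqI[OF this] show ?thesis by (simp add: H0_cat_def)
qed

lemma H0_arrE:
  assumes "u \<in> Arr (H0_cat A M)" obtains t where "hwf A M t" "u = hcls A M t"
  using assms by (auto simp: H0_cat_def)

lemma H0_idn: "Idn (H0_cat A M) m = hcls A M (Emb (Idn M m))"
  by (simp add: H0_cat_def)

text \<open>Every arrow is the class of a well-formed term and composition is computed on terms, so each
category law is the corresponding rule of the term congruence.\<close>

lemma category_H0: "category (H0_cat A M)"
proof
  fix f assume "f \<in> Arr (H0_cat A M)"
  then obtain t where t: "hwf A M t" "f = hcls A M t" by (rule H0_arrE)
  then show "Dom (H0_cat A M) f \<in> Obj (H0_cat A M)" "Cod (H0_cat A M) f \<in> Obj (H0_cat A M)"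
    by (simp_all add: hwf_obj)
  show "Idn (H0_cat A M) (Cod (H0_cat A M) f) \<cdot>\<^bsub>H0_cat A M\<^esub> f = f"
    "f \<cdot>\<^bsub>H0_cat A M\<^esub> Idn (H0_cat A M) (Dom (H0_cat A M) f) = f"
    using t hcls_eqI[OF heq_idn_left[OF t(1)]] hcls_eqI[OF heq_idn_right[OF t(1)]]
    by (simp_all add: H0_idn hcls_cmp hwf_obj)
next
  fix x assume "x \<in> Obj (H0_cat A M)"
  then show "Idn (H0_cat A M) x \<in> hom (H0_cat A M) x x"
    by (simp add: H0_idn hom_def)
next
  fix f g assume "f \<in> Arr (H0_cat A M)" "g \<in> Arr (H0_cat A M)"
    "Cod (H0_cat A M) f = Dom (H0_cat A M) g"
  then show "g \<cdot>\<^bsub>H0_cat A M\<^esub> f \<in> hom (H0_cat A M) (Dom (H0_cat A M) f) (Cod (H0_cat A M) g)"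
    by (elim H0_arrE) (simp add: hcls_cmp hom_def)
next
  fix f g h assume "f \<in> Arr (H0_cat A M)" "g \<in> Arr (H0_cat A M)" "h \<in> Arr (H0_cat A M)"
    "Cod (H0_cat A M) f = Dom (H0_cat A M) g" "Cod (H0_cat A M) g = Dom (H0_cat A M) h"
  then show "h \<cdot>\<^bsub>H0_cat A M\<^esub> g \<cdot>\<^bsub>H0_cat A M\<^esub> f = h \<cdot>\<^bsub>H0_cat A M\<^esub> (g \<cdot>\<^bsub>H0_cat A M\<^esub> f)"
    by (elim H0_arrE) (simp add: hcls_cmp hcls_eqI[OF heq_assoc])
qed

sublocale H0: category "H0_cat A M"
  by (rule category_H0)

lemma H0_emb_simps [simp]:
  assumes "f \<in> Arr M"
  shows "H0_emb A M f \<in> Arr (H0_cat A M)" "Dom (H0_cat A M) (H0_emb A M f) = Dom M f"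
    "Cod (H0_cat A M) (H0_emb A M f) = Cod M f"
  using assms by (simp_all add: H0_emb_def)

lemma H0_emb_idn [simp]: "H0_emb A M (Idn M m) = Idn (H0_cat A M) m"
  by (simp add: H0_emb_def H0_idn)

lemma H0_emb_cmp [simp]:
  "\<lbrakk>f \<in> Arr M; g \<in> Arr M; Cod M f = Dom M g\<rbrakk>
    \<Longrightarrow> H0_emb A M (g \<cdot>\<^bsub>M\<^esub> f) = H0_emb A M g \<cdot>\<^bsub>H0_cat A M\<^esub> H0_emb A M f"
  by (simp add: H0_emb_def hcls_cmp hcls_eqI[OF heq_emb])

lemma H0_emb_functr: "functr M (H0_cat A M) (FMap (\<lambda>m. m) (H0_emb A M))"
  by (rule functrI) (simp_all add: M.category_axioms category_H0)

lemmas H0_emb_eq_assoc = functr.map_cmp_eq_assoc[OF H0_emb_functr, unfolded fmap.sel]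

lemma H0_phi_simps [simp]:
  assumes "a \<in> Obj A" "m \<in> Obj M"
  shows "H0_phi A M a m \<in> Arr (H0_cat A M)" "Dom (H0_cat A M) (H0_phi A M a m) = rob M m a"
    "Cod (H0_cat A M) (H0_phi A M a m) = lob M a m"
  using assms by (simp_all add: H0_phi_def)

lemma H0_phi_unt [simp]: "m \<in> Obj M \<Longrightarrow> H0_phi A M (unt A) m = Idn (H0_cat A M) m"
  using hcls_eqI[OF heq_phi_unt] by (simp add: H0_phi_def H0_idn)

lemma H0_phi_natural:
  assumes "f \<in> Arr A" "k \<in> Arr M" "Dom A f = a" "Dom M k = m" "Cod A f = a'" "Cod M k = m'"
  shows "H0_phi A M a' m' \<cdot>\<^bsub>H0_cat A M\<^esub> H0_emb A M (rar M k f)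
    = H0_emb A M (lar M f k) \<cdot>\<^bsub>H0_cat A M\<^esub> H0_phi A M a m"
  using hcls_eqI[OF heq_phi_natural[OF assms(1,2)]] assms
  by (auto simp: H0_phi_def H0_emb_def hcls_cmp)

lemma H0_phi_natural_assoc:
  assumes "f \<in> Arr A" "k \<in> Arr M" "Dom A f = a" "Dom M k = m" "Cod A f = a'" "Cod M k = m'"
    and "h \<in> Arr (H0_cat A M)" "Cod (H0_cat A M) h = rob M m a"
  shows "H0_phi A M a' m' \<cdot>\<^bsub>H0_cat A M\<^esub> (H0_emb A M (rar M k f) \<cdot>\<^bsub>H0_cat A M\<^esub> h)
    = H0_emb A M (lar M f k) \<cdot>\<^bsub>H0_cat A M\<^esub> (H0_phi A M a m \<cdot>\<^bsub>H0_cat A M\<^esub> h)"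
  by (rule H0.cmp_eq_assoc[OF H0_phi_natural]; use assms in force)

lemma H0_phi_tob:
  assumes "a \<in> Obj A" "b \<in> Obj A" "m \<in> Obj M"
  shows "H0_phi A M (tob A a b) m = H0_phi A M a (lob M b m) \<cdot>\<^bsub>H0_cat A M\<^esub>
    (H0_emb A M (chi M b m a) \<cdot>\<^bsub>H0_cat A M\<^esub> H0_phi A M b (rob M m a))"
  using hcls_eqI[OF heq_phi_tob[OF assms]] assms
  by (simp add: H0_phi_def H0_emb_def hcls_cmp)

text \<open>The generators generate: from here on terms are needed only to define functors out of \<open>H0\<close>.\<close>

lemma H0_induct [consumes 1, case_names emb phi cmp]:
  assumes "u \<in> Arr (H0_cat A M)"
    and "\<And>f. f \<in> Arr M \<Longrightarrow> P (H0_emb A M f)"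
    and "\<And>a m. \<lbrakk>a \<in> Obj A; m \<in> Obj M\<rbrakk> \<Longrightarrow> P (H0_phi A M a m)"
    and "\<And>u v. \<lbrakk>u \<in> Arr (H0_cat A M); v \<in> Arr (H0_cat A M);
        Cod (H0_cat A M) u = Dom (H0_cat A M) v; P u; P v\<rbrakk> \<Longrightarrow> P (v \<cdot>\<^bsub>H0_cat A M\<^esub> u)"
  shows "P u"
proof -
  have "hwf A M t \<Longrightarrow> P (hcls A M t)" for t
  proof (induction t)
    case (Circ t s)
    then show ?case using assms(4)[of "hcls A M s" "hcls A M t"] by (simp add: hcls_cmp)
  qed (use assms(2,3) in \<open>auto simp: H0_emb_def H0_phi_def\<close>)
  with assms(1) show ?thesis by (auto elim: H0_arrE)
qed

text \<open>The squares at which a family is natural are closed under composition, so the generators suffice.\<close>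

lemma H0_nat_transI:
  assumes "functr (H0_cat A M) Y F" "functr (H0_cat A M) Y G"
    and typed: "\<And>m. m \<in> Obj M \<Longrightarrow> t m \<in> hom Y (onObj F m) (onObj G m)"
    and emb: "\<And>f. f \<in> Arr M \<Longrightarrow> onArr G (H0_emb A M f) \<cdot>\<^bsub>Y\<^esub> t (Dom M f)
      = t (Cod M f) \<cdot>\<^bsub>Y\<^esub> onArr F (H0_emb A M f)"
    and phi: "\<And>a m. \<lbrakk>a \<in> Obj A; m \<in> Obj M\<rbrakk> \<Longrightarrow>
      onArr G (H0_phi A M a m) \<cdot>\<^bsub>Y\<^esub> t (rob M m a) = t (lob M a m) \<cdot>\<^bsub>Y\<^esub> onArr F (H0_phi A M a m)"
  shows "nat_trans (H0_cat A M) Y F G t"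
proof -
  interpret F: functr "H0_cat A M" Y F by fact
  interpret G: functr "H0_cat A M" Y G by fact
  have typed' [simp]: "t m \<in> Arr Y" "Dom Y (t m) = onObj F m" "Cod Y (t m) = onObj G m"
    if "m \<in> Obj M" for m using typed[OF that] by (auto simp: hom_def)
  have "onArr G u \<cdot>\<^bsub>Y\<^esub> t (Dom (H0_cat A M) u) = t (Cod (H0_cat A M) u) \<cdot>\<^bsub>Y\<^esub> onArr F u"
    if "u \<in> Arr (H0_cat A M)" for u
    using that
  proof (induction rule: H0_induct)
    case (cmp u v)
    have [simp]: "Dom (H0_cat A M) u \<in> Obj M" "Dom (H0_cat A M) v \<in> Obj M" "Cod (H0_cat A M) v \<in> Obj M"
      using cmp(1,2) H0.dom_obj H0.cod_obj by auto
    from cmp F.D.cmp_eq_assoc[OF cmp(5), of "onArr F u"] show ?case by simp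
  qed (simp_all add: emb phi)
  then show ?thesis
    by (intro nat_transI assms(1,2)) auto
qed

lemma H0_functor_eqI:
  assumes "F \<in> funs (H0_cat A M) Y" "G \<in> funs (H0_cat A M) Y"
    and obj: "\<And>m. m \<in> Obj M \<Longrightarrow> onObj F m = onObj G m"
    and "\<And>f. f \<in> Arr M \<Longrightarrow> onArr F (H0_emb A M f) = onArr G (H0_emb A M f)"
    and "\<And>a m. \<lbrakk>a \<in> Obj A; m \<in> Obj M\<rbrakk> \<Longrightarrow> onArr F (H0_phi A M a m) = onArr G (H0_phi A M a m)"
  shows "F = G"
proof (rule funs_eqI[OF assms(1,2)])
  interpret F: functr "H0_cat A M" Y F using assms(1) by auto
  interpret G: functr "H0_cat A M" Y G using assms(2) by auto
  show "onArr F u = onArr G u" if "u \<in> Arr (H0_cat A M)" for u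
    using that by (induction rule: H0_induct) (simp_all add: assms)
qed (simp add: obj)

end

text \<open>The value of a formal composite in \<open>Y\<close>, once arrows of \<open>M\<close> are interpreted by \<open>F\<close> and the adjoined
arrows \<open>\<phi>\<close> by \<open>\<psi>\<close>.\<close>

primrec heval :: "('p, 'b, 'z) cat_scheme \<Rightarrow> ('u, 'u, 'p, 'b) fmap \<Rightarrow> ('o \<Rightarrow> 'u \<Rightarrow> 'b)
    \<Rightarrow> ('o, 'u) hterm \<Rightarrow> 'b" where
  "heval Y F \<psi> (Emb f) = onArr F f"
| "heval Y F \<psi> (Phi a m) = \<psi> a m"
| "heval Y F \<psi> (Circ t s) = heval Y F \<psi> t \<cdot>\<^bsub>Y\<^esub> heval Y F \<psi> s"

definition H0_lift where
  "H0_lift A M Y F \<psi> = FMap (\<lambda>m\<in>Obj M. onObj F m)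
    (\<lambda>u\<in>Arr (H0_cat A M). heval Y F \<psi> (unTerm u))"

text \<open>The data that \<open>H0(A,M)\<close> classifies: a functor on \<open>M\<close> that identifies the two actions up to a map, as
a trace does with \<open>x y\<close> and \<open>y x\<close>. Each assumption mirrors one of the relations imposed on \<open>\<phi>\<close>.\<close>

locale trace_cocone = univ_bimodule A M + F: functr M Y F
  for A :: "('o, 'a) moncat" and M :: "('o, 'a, ('o, 'a, 'x) univ) bimod"
    and Y :: "('p, 'b, 'z) cat_scheme" and F +
  fixes \<psi> :: "'o \<Rightarrow> ('o, 'a, 'x) univ \<Rightarrow> 'b"
  assumes psi_hom: "\<lbrakk>a \<in> Obj A; m \<in> Obj M\<rbrakk>
      \<Longrightarrow> \<psi> a m \<in> hom Y (onObj F (rob M m a)) (onObj F (lob M a m))"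
    and psi_natural: "\<lbrakk>f \<in> Arr A; k \<in> Arr M\<rbrakk>
      \<Longrightarrow> \<psi> (Cod A f) (Cod M k) \<cdot>\<^bsub>Y\<^esub> onArr F (rar M k f)
        = onArr F (lar M f k) \<cdot>\<^bsub>Y\<^esub> \<psi> (Dom A f) (Dom M k)"
    and psi_unt: "m \<in> Obj M \<Longrightarrow> \<psi> (unt A) m = Idn Y (onObj F m)"
    and psi_tob: "\<lbrakk>a \<in> Obj A; b \<in> Obj A; m \<in> Obj M\<rbrakk> \<Longrightarrow> \<psi> (tob A a b) m
        = \<psi> a (lob M b m) \<cdot>\<^bsub>Y\<^esub> (onArr F (chi M b m a) \<cdot>\<^bsub>Y\<^esub> \<psi> b (rob M m a))"
begin

lemma heval_simps:
  "hwf A M t \<Longrightarrow> heval Y F \<psi> t \<in> Arr Y \<and> Dom Y (heval Y F \<psi> t) = onObj F (hdom M t)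
    \<and> Cod Y (heval Y F \<psi> t) = onObj F (hcod M t)"
  by (induction t) (use psi_hom in \<open>auto simp: hom_def\<close>)

text \<open>Rule induction: the category rules hold in \<open>Y\<close>, the rule on composites of arrows of \<open>M\<close> is
functoriality of \<open>F\<close>, and the rules on \<open>\<phi>\<close> are the assumptions on \<open>\<psi>\<close>.\<close>

lemma heval_heq: "heq A M s t \<Longrightarrow> heval Y F \<psi> s = heval Y F \<psi> t"
  by (induction rule: heq.induct)
    (auto simp: heval_simps hwf_obj psi_natural psi_unt psi_tob)

lemma lift_hcls: "hwf A M t \<Longrightarrow> onArr (H0_lift A M Y F \<psi>) (hcls A M t) = heval Y F \<psi> t"
  using heval_heq[OF heq_unTerm] by (simp add: H0_lift_def)

lemma lift_simps [simp]:
  "m \<in> Obj M \<Longrightarrow> onObj (H0_lift A M Y F \<psi>) m = onObj F m"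
  "f \<in> Arr M \<Longrightarrow> onArr (H0_lift A M Y F \<psi>) (H0_emb A M f) = onArr F f"
  "\<lbrakk>a \<in> Obj A; m \<in> Obj M\<rbrakk> \<Longrightarrow> onArr (H0_lift A M Y F \<psi>) (H0_phi A M a m) = \<psi> a m"
  by (simp_all add: H0_emb_def H0_phi_def lift_hcls) (simp add: H0_lift_def)

text \<open>Existence in the universal property of \<open>H0(A,M)\<close>; uniqueness is \<open>H0_functor_eqI\<close>.\<close>

lemma lift_funs: "H0_lift A M Y F \<psi> \<in> funs (H0_cat A M) Y"
proof -
  have "functr (H0_cat A M) Y (H0_lift A M Y F \<psi>)"
    by (rule functrI)
      (auto elim!: H0_arrE simp: H0.category_axioms F.D.category_axioms lift_hcls heval_simps hwf_obj
        H0_idn hcls_cmp)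
  then show ?thesis by (simp add: funs_def H0_lift_def)
qed

end

section \<open>\<open>H0\<close> is a 2-functor\<close>

lemma univ_bimoduleI: "bimodule A M \<Longrightarrow> univ_bimodule A M"
  by (simp add: univ_bimodule_def)

locale univ_bimodule_map = bimodule_map A M N P
  for A :: "('o, 'a) moncat" and M N :: "('o, 'a, ('o, 'a, 'x) univ) bimod" and P
begin

sublocale M: univ_bimodule A M by (rule univ_bimoduleI[OF M.bimodule_axioms])
sublocale N: univ_bimodule A N by (rule univ_bimoduleI[OF N.bimodule_axioms])

text \<open>A 1-cell \<open>(P, r)\<close> followed by \<open>N \<rightarrow> H0(A,N)\<close>, with \<open>\<psi>\<close> the composite of \<open>\<phi>\<close> and \<open>r\<close>, is a cocone. This
is where strict preservation of the right action enters: it makes \<open>\<phi>\<close> at \<open>P m\<close> start at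
\<open>P (m \<lhd> a)\<close>.\<close>

lemma cocone: "trace_cocone A M (H0_cat A N) (FMap (onObj (bfun P)) (\<lambda>f. H0_emb A N (onArr (bfun P) f)))
   (\<lambda>a m. H0_emb A N (brr P (a, m)) \<cdot>\<^bsub>H0_cat A N\<^esub> H0_phi A N a (onObj (bfun P) m))"
proof -
  interpret F: functr M "H0_cat A N" "FMap (onObj (bfun P)) (\<lambda>f. H0_emb A N (onArr (bfun P) f))"
    by (rule functrI) (simp_all add: M.M.category_axioms N.category_H0)
  show ?thesis
  proof (standard, goal_cases)
    case (2 f k)
    from N.H0_emb_eq_assoc[OF brr_natural[OF 2], of "H0_phi A N (Dom A f) (onObj (bfun P) (Dom M k))"]
    show ?case using 2 by (simp add: N.H0_phi_natural flip: pres_rar)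
  next
    case (4 a b m)
    \<comment> \<open>Trade \<open>P \<chi>\<close> and \<open>r\<close> for \<open>r \<lhd> a\<close> and the \<open>\<chi>\<close> of \<open>N\<close>; then \<open>\<phi>\<close>, being natural, turns \<open>r \<lhd> a\<close>
      into \<open>a \<rhd> r\<close>, which is a factor of \<open>r\<close> at the tensor product.\<close>
    have "onArr (bfun P) (chi M b m a) \<cdot>\<^bsub>N\<^esub> brr P (b, rob M m a) =
        rar N (brr P (b, m)) (Idn A a) \<cdot>\<^bsub>N\<^esub> chi N b (onObj (bfun P) m) a"
      using brr_chi 4 by simp
    from N.H0_emb_eq_assoc[OF this, of "H0_phi A N b (onObj (bfun P) (rob M m a))"]
    show ?case
      using 4 by (simp add: brr_tob N.H0_phi_tob N.H0_phi_natural_assoc flip: pres_rob)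
  qed (simp_all add: hom_def flip: pres_rob)
qed

lemma hwf_hmap:
  "hwf A M t \<Longrightarrow> hwf A N (hmap P t) \<and> hdom N (hmap P t) = onObj (bfun P) (hdom M t)
    \<and> hcod N (hmap P t) = onObj (bfun P) (hcod M t)"
  by (induction t) auto

text \<open>Translating terms along \<open>P\<close> and then taking classes agrees with evaluating them in \<open>H0(A,N)\<close>, so the
action of \<open>H0\<close> on 1-cells falls under the universal property.\<close>

lemma H0_fun_eq_lift: "dat (H0_fun A (Cell M N P)) = H0_lift A M (H0_cat A N)
   (FMap (onObj (bfun P)) (\<lambda>f. H0_emb A N (onArr (bfun P) f)))
   (\<lambda>a m. H0_emb A N (brr P (a, m)) \<cdot>\<^bsub>H0_cat A N\<^esub> H0_phi A N a (onObj (bfun P) m))"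
   (is "_ = H0_lift A M _ ?F ?p")
proof -
  have *: "hwf A M t \<Longrightarrow> hcls A N (hmap P t) = heval (H0_cat A N) ?F ?p t" for t
  proof (induction t)
    case (Circ t s)
    have "hcls A N (hmap P (Circ t s))
        = hcls A N (hmap P t) \<cdot>\<^bsub>H0_cat A N\<^esub> hcls A N (hmap P s)"
      using Circ.prems by (simp add: N.hcls_cmp hwf_hmap)
    with Circ show ?case by simp
  qed (simp_all add: H0_emb_def H0_phi_def N.hcls_cmp)
  have "hcls A N (hmap P (unTerm u)) = heval (H0_cat A N) ?F ?p (unTerm u)"
    if "u \<in> Arr (H0_cat A M)" for u
    using that by (auto elim!: M.H0_arrE intro!: * dest: M.heq_unTerm M.heq_hwf)
  then show ?thesis
    by (auto simp: H0_fun_def H0_lift_def intro!: restrict_ext)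
qed

lemma H0_fun_funs: "dat (H0_fun A (Cell M N P)) \<in> funs (H0_cat A M) (H0_cat A N)"
  by (simp add: H0_fun_eq_lift trace_cocone.lift_funs[OF cocone])

lemma H0_fun_simps [simp]:
  "m \<in> Obj M \<Longrightarrow> onObj (dat (H0_fun A (Cell M N P))) m = onObj (bfun P) m"
  "f \<in> Arr M \<Longrightarrow> onArr (dat (H0_fun A (Cell M N P))) (H0_emb A M f) = H0_emb A N (onArr (bfun P) f)"
  "\<lbrakk>a \<in> Obj A; m \<in> Obj M\<rbrakk> \<Longrightarrow> onArr (dat (H0_fun A (Cell M N P))) (H0_phi A M a m) =
     H0_emb A N (brr P (a, m)) \<cdot>\<^bsub>H0_cat A N\<^esub> H0_phi A N a (onObj (bfun P) m)"
  by (simp_all add: H0_fun_eq_lift trace_cocone.lift_simps[OF cocone])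

end

lemma univ_bimodule_mapI: "bimodule_map A M N P \<Longrightarrow> univ_bimodule_map A M N P"
  by (simp add: univ_bimodule_map_def)

lemma H0_fun_cells [simp]: "src (H0_fun A P) = H0_cat A (src P)" "tgt (H0_fun A P) = H0_cat A (tgt P)"
  by (simp_all add: H0_fun_def)

lemma H0_fun_id:
  assumes "bimodule A M"
  shows "H0_fun A (Cell M M (bimap_id A M)) = Cell (H0_cat A M) (H0_cat A M) (fid (H0_cat A M))"
proof -
  interpret univ_bimodule_map A M M "bimap_id A M"
    by (intro univ_bimodule_mapI bimodule_map_id assms)
  have "dat (H0_fun A (Cell M M (bimap_id A M))) = fid (H0_cat A M)"
    by (rule M.H0_functor_eqI[OF H0_fun_funs]) (simp_all add: fid_funs M.category_H0)
  then show ?thesis by (auto intro: cell.expand)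
qed

text \<open>On \<open>\<phi>\<close> both sides are \<open>\<phi>\<close> followed by the comparison of \<open>Q\<close> and by \<open>Q\<close> of the comparison of \<open>P\<close>.\<close>

lemma H0_fun_comp:
  assumes "bimodule_map A M N P" "bimodule_map A N R Q"
  shows "dat (H0_fun A (Cell M R (bimap_comp A M R Q P)))
    = fcomp (H0_cat A M) (dat (H0_fun A (Cell N R Q))) (dat (H0_fun A (Cell M N P)))"
proof -
  interpret P: univ_bimodule_map A M N P by (rule univ_bimodule_mapI) fact
  interpret Q: univ_bimodule_map A N R Q by (rule univ_bimodule_mapI) fact
  interpret QP: univ_bimodule_map A M R "bimap_comp A M R Q P"
    by (rule univ_bimodule_mapI[OF bimodule_map_comp[OF assms]])
  interpret FQ: functr "H0_cat A N" "H0_cat A R" "dat (H0_fun A (Cell N R Q))"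
    using Q.H0_fun_funs by auto
  show ?thesis
    by (rule P.M.H0_functor_eqI[OF QP.H0_fun_funs])
      (auto simp: fcomp_funs[OF funs_functr[OF P.H0_fun_funs] FQ.functr_axioms] simp flip: P.pres_rob)
qed

text \<open>Naturality with respect to \<open>\<phi>\<close> uses both compatibilities of a 2-cell: \<open>t\<close> at \<open>m \<lhd> a\<close> is \<open>t m \<lhd> a\<close>, which
\<open>\<phi>\<close> carries to \<open>a \<rhd> t m\<close>, and this passes through the comparison maps to become \<open>t\<close> at \<open>a \<rhd> m\<close>.\<close>

lemma H0_nat_nats:
  assumes "bimodule_trans A M N P Q t"
  shows "(\<lambda>m\<in>Obj M. H0_emb A N (t m)) \<in> nats (H0_cat A M) (H0_cat A N)
    (dat (H0_fun A (Cell M N P))) (dat (H0_fun A (Cell M N Q)))"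
proof -
  interpret t: bimodule_trans A M N P Q t by fact
  interpret P: univ_bimodule_map A M N P by (rule univ_bimodule_mapI[OF t.P.bimodule_map_axioms])
  interpret Q: univ_bimodule_map A M N Q by (rule univ_bimodule_mapI[OF t.Q.bimodule_map_axioms])
  have emb: "H0_emb A N (onArr (bfun Q) f) \<cdot>\<^bsub>H0_cat A N\<^esub> H0_emb A N (t (Dom M f))
      = H0_emb A N (t (Cod M f)) \<cdot>\<^bsub>H0_cat A N\<^esub> H0_emb A N (onArr (bfun P) f)"
    if "f \<in> Arr M" for f
    using t.naturality[OF that] that by (simp flip: P.N.H0_emb_cmp)
  have phi: "H0_emb A N (brr Q (a, m)) \<cdot>\<^bsub>H0_cat A N\<^esub> (H0_phi A N a (onObj (bfun Q) m) 
        \<cdot>\<^bsub>H0_cat A N\<^esub> H0_emb A N (rar N (t m) (Idn A a)))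
      = H0_emb A N (t (lob M a m)) \<cdot>\<^bsub>H0_cat A N\<^esub> 
        (H0_emb A N (brr P (a, m)) \<cdot>\<^bsub>H0_cat A N\<^esub> H0_phi A N a (onObj (bfun P) m))"
    if "a \<in> Obj A" "m \<in> Obj M" for a m
    using P.N.H0_emb_eq_assoc[OF t.pres_left[OF that], of "H0_phi A N a (onObj (bfun P) m)"] that
      P.N.H0_phi_natural[of "Idn A a" "t m"]
    by simp
  have "nat_trans (H0_cat A M) (H0_cat A N) (dat (H0_fun A (Cell M N P))) (dat (H0_fun A (Cell M N Q)))
    (\<lambda>m\<in>Obj M. H0_emb A N (t m))"
    by (rule P.M.H0_nat_transI)
      (auto simp: P.H0_fun_funs Q.H0_fun_funs funs_functr emb phi t.pres_right hom_def)
  then show ?thesis by (simp add: nats_def)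
qed

lemma H0_simps [simp]: "on0 (H0 A) = H0_cat A" "on1 (H0 A) = H0_fun A" "on2 (H0 A) = H0_nat A"
  by (simp_all add: H0_def)

lemma H0_nat_cells [simp]: "src (H0_nat A \<alpha>) = H0_fun A (src \<alpha>)" "tgt (H0_nat A \<alpha>) = H0_fun A (tgt \<alpha>)"
  "dat (H0_nat A \<alpha>) = (\<lambda>m\<in>Obj (src (src \<alpha>)). H0_emb A (tgt (src \<alpha>)) (dat \<alpha> m))"
  by (simp_all add: H0_nat_def H0_emb_def)

lemma H0_fun_dat:
  assumes "bimodule_map A (src P) (tgt P) (dat P)"
  shows "dat (H0_fun A P) \<in> funs (H0_cat A (src P)) (H0_cat A (tgt P))"
  using univ_bimodule_map.H0_fun_funs[OF univ_bimodule_mapI[OF assms]] by simp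

lemma category_H0_cat: "bimodule A M \<Longrightarrow> category (H0_cat A M)"
  by (rule univ_bimodule.category_H0[OF univ_bimoduleI])

lemma Bimod1_arrE:
  assumes "P \<in> Arr (Bimod1 A)"
  obtains M N p where "P = Cell M N p" "bimodule_map A M N p" "bfun p \<in> funs M N"
    "brr p \<in> extensional (Obj A \<times> Obj M)" "bimodule A M" "bimodule A N"
  using assms by (cases P) (auto dest: bimodule_map_bimodule)

text \<open>The cells of \<open>BIMOD\<close> carry their sources and targets; this normal form, in which the two 1-cells
visibly share them, is the one in which the equations between cells are checked.\<close>

lemma BIMOD_arrE:
  assumes "\<alpha> \<in> Arr (Vert (BIMOD A))"
  obtains M N p q t where "\<alpha> = Cell (Cell M N p) (Cell M N q) t"
    "bimodule_trans A M N p q t" "t \<in> extensional (Obj M)" "t \<in> nats M N (bfun p) (bfun q)"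
    "Cell M N p \<in> Arr (Bimod1 A)" "Cell M N q \<in> Arr (Bimod1 A)"
    "bimodule_map A M N p" "bimodule_map A M N q"
proof -
  obtain P Q t where \<alpha>: "\<alpha> = Cell P Q t" by (cases \<alpha>)
  obtain M N p where P: "P = Cell M N p" by (cases P)
  obtain M' N' q where Q: "Q = Cell M' N' q" by (cases Q)
  have [simp]: "M' = M" "N' = N" using assms by (simp_all add: \<alpha> P Q)
  from assms show thesis
    by (intro that[of M N p q t]) (auto simp: \<alpha> P Q intro: bimodule_trans_nats)
qed

lemma functr_H0_Base: "functr (Bimod1 A) Cat1 (FMap (H0_cat A) (H0_fun A))"
proof (rule functrI, goal_cases)
  case (8 P Q)
  obtain M N p where P: "P = Cell M N p" "bimodule_map A M N p" using 8(1) by (rule Bimod1_arrE)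
  obtain N' R q where Q: "Q = Cell N' R q" "bimodule_map A N' R q" using 8(2) by (rule Bimod1_arrE)
  have "N' = N" using 8(3) P Q by simp
  then show ?case using P Q by (simp add: H0_fun_comp cell.expand)
qed (simp_all add: category_Bimod1 category_Cat1 category_H0_cat H0_fun_dat H0_fun_id)

lemma functr_H0_Vert: "functr (Vert (BIMOD A)) (Vert CAT) (FMap (H0_fun A) (H0_nat A))"
proof (rule functrI, goal_cases)
  case (4 \<alpha>)
  obtain M N p q t where \<alpha>: "\<alpha> = Cell (Cell M N p) (Cell M N q) t" "bimodule_trans A M N p q t"
      "bimodule_map A M N p" "bimodule_map A M N q"
    using 4 by (rule BIMOD_arrE)
  then show ?case
    using H0_fun_dat[of A "Cell M N p"] H0_fun_dat[of A "Cell M N q"] H0_nat_nats by simp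
next
  case (7 P)
  then have "P \<in> Arr (Bimod1 A)" by (simp only: BIMOD_simps)
  then obtain M N p where P: "P = Cell M N p" "bimodule_map A M N p"
    by (rule Bimod1_arrE)
  interpret P: univ_bimodule_map A M N p using P(2) by (rule univ_bimodule_mapI)
  show ?case by (auto simp: P(1) nid_def intro!: cell.expand restrict_ext)
next
  case (8 \<alpha> \<beta>)
  obtain M N p q t where \<alpha>: "\<alpha> = Cell (Cell M N p) (Cell M N q) t" "bimodule_trans A M N p q t"
    using 8(1) by (rule BIMOD_arrE)
  obtain M' N' q' r s where \<beta>: "\<beta> = Cell (Cell M' N' q') (Cell M' N' r) s" "bimodule_trans A M' N' q' r s"
    using 8(2) by (rule BIMOD_arrE)
  have [simp]: "M' = M" "N' = N" "q' = q" using 8(3) by (simp_all add: \<alpha> \<beta>)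
  interpret t: bimodule_trans A M N p q t by fact
  interpret s: bimodule_trans A M N q r s using \<beta>(2) by simp
  interpret univ_bimodule A N by (rule univ_bimoduleI) (rule t.P.N.bimodule_axioms)
  show ?case by (auto simp: \<alpha> \<beta> nvcomp_def intro!: cell.expand restrict_ext)
qed (simp_all add: category_Vert_BIMOD category_Vert_CAT H0_fun_dat)

lemma two_functor_H0: "two_functor (BIMOD A) CAT (H0 A)"
proof (rule two_functorI, goal_cases)
  case (5 \<alpha> \<beta>)
  obtain M N p q t where \<alpha>: "\<alpha> = Cell (Cell M N p) (Cell M N q) t" "bimodule_trans A M N p q t"
    using 5(1) by (rule BIMOD_arrE)
  obtain N' R p' q' s where \<beta>: "\<beta> = Cell (Cell N' R p') (Cell N' R q') s" "bimodule_trans A N' R p' q' s"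
    using 5(2) by (rule BIMOD_arrE)
  have [simp]: "N' = N" using 5(3) by (simp_all add: \<alpha> \<beta>)
  interpret t: bimodule_trans A M N p q t by fact
  interpret s: bimodule_trans A N R p' q' s using \<beta>(2) by simp
  interpret P': univ_bimodule_map A N R p' by (rule univ_bimodule_mapI) (rule s.P.bimodule_map_axioms)
  interpret Q: univ_bimodule_map A M N q by (rule univ_bimodule_mapI) (rule t.Q.bimodule_map_axioms)
  show ?case
    by (auto simp: \<alpha> \<beta> nhcomp_def H0_fun_comp[OF t.P.bimodule_map_axioms s.P.bimodule_map_axioms]
        H0_fun_comp[OF t.Q.bimodule_map_axioms s.Q.bimodule_map_axioms] intro!: cell.expand restrict_ext)
qed (simp_all add: two_category_BIMOD two_category_CAT functr_H0_Base functr_H0_Vert)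

section \<open>The bimodule of functors out of \<open>A\<close>\<close>

text \<open>The functors \<open>- \<otimes> a\<close> and \<open>a \<otimes> -\<close>, and the transformations between them induced by an arrow of \<open>A\<close>:
the left action of \<open>A\<close> on \<open>[A,Y]\<close> is precomposition with the former and the right action with the
latter, on objects by composition of functors and on arrows by horizontal composition.\<close>

definition tensR :: "('o, 'a) moncat \<Rightarrow> 'o \<Rightarrow> ('o, 'a, 'o, 'a) fmap" where
  "tensR A a = FMap (\<lambda>b\<in>Obj A. tob A b a) (\<lambda>g\<in>Arr A. tar A g (Idn A a))"

definition tensL :: "('o, 'a) moncat \<Rightarrow> 'o \<Rightarrow> ('o, 'a, 'o, 'a) fmap" where
  "tensL A a = FMap (\<lambda>b\<in>Obj A. tob A a b) (\<lambda>g\<in>Arr A. tar A (Idn A a) g)"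

definition tensR_nat :: "('o, 'a) moncat \<Rightarrow> 'a \<Rightarrow> 'o \<Rightarrow> 'a" where
  "tensR_nat A f = (\<lambda>b\<in>Obj A. tar A (Idn A b) f)"

definition tensL_nat :: "('o, 'a) moncat \<Rightarrow> 'a \<Rightarrow> 'o \<Rightarrow> 'a" where
  "tensL_nat A f = (\<lambda>b\<in>Obj A. tar A f (Idn A b))"

lemma tens_simps [simp]:
  "b \<in> Obj A \<Longrightarrow> onObj (tensR A a) b = tob A b a" "g \<in> Arr A \<Longrightarrow> onArr (tensR A a) g = tar A g (Idn A a)"
  "b \<in> Obj A \<Longrightarrow> onObj (tensL A a) b = tob A a b" "g \<in> Arr A \<Longrightarrow> onArr (tensL A a) g = tar A (Idn A a) g"
  "b \<in> Obj A \<Longrightarrow> tensR_nat A f b = tar A (Idn A b) f"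
  "b \<in> Obj A \<Longrightarrow> tensL_nat A f b = tar A f (Idn A b)"
  by (simp_all add: tensR_def tensL_def tensR_nat_def tensL_nat_def)

lemma tens_ext [simp]:
  "onObj (tensR A a) \<in> extensional (Obj A)" "onArr (tensR A a) \<in> extensional (Arr A)"
  "onObj (tensL A a) \<in> extensional (Obj A)" "onArr (tensL A a) \<in> extensional (Arr A)"
  "tensR_nat A f \<in> extensional (Obj A)" "tensL_nat A f \<in> extensional (Obj A)"
  by (simp_all add: tensR_def tensL_def tensR_nat_def tensL_nat_def)

lemma bimoduleI:
  assumes "strict_monoidal A" "category M" "bimodule_axioms A M" shows "bimodule A M"
  using assms by (simp add: bimodule_def)

context strict_monoidal
begin

lemma tens_funs:
  assumes "a \<in> Obj A" shows "tensR A a \<in> funs A A" "tensL A a \<in> funs A A"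
  using assms by (auto simp: funs_def tar_cmp category_axioms intro!: functrI)

lemmas tens_functr [simp] = tens_funs[THEN funs_functr]

lemma tens_nats:
  assumes "f \<in> Arr A"
  shows "tensR_nat A f \<in> nats A A (tensR A (Dom A f)) (tensR A (Cod A f))"
    "tensL_nat A f \<in> nats A A (tensL A (Dom A f)) (tensL A (Cod A f))"
  using assms by (auto simp: nats_def tar_cmp intro!: nat_transI)

lemmas tens_nat_trans [simp] = tens_nats[THEN nats_nat_trans]

lemma tens_unt: "tensR A (unt A) = fid A" "tensL A (unt A) = fid A"
  by (auto simp: tensR_def tensL_def fid_def intro!: restrict_ext)

lemma tens_tob:
  assumes "a \<in> Obj A" "b \<in> Obj A"
  shows "tensR A (tob A a b) = fcomp A (tensR A b) (tensR A a)"
    "tensL A (tob A a b) = fcomp A (tensL A a) (tensL A b)"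
    "fcomp A (tensL A b) (tensR A a) = fcomp A (tensR A a) (tensL A b)"
  using assms by (auto simp: tensR_def tensL_def fcomp_def simp flip: tar_idn intro!: restrict_ext)

text \<open>As \<open>(a \<otimes> b) \<rhd> F = F(- \<otimes> a \<otimes> b) = a \<rhd> (b \<rhd> F)\<close>, the factor \<open>b\<close> is the inner one; the
last equation says that the two actions commute strictly, whence \<open>\<chi> = 1\<close> on \<open>[A,Y]\<close>. All iterated
actions are normalised to the left-nested form with left actions innermost.\<close>

lemma act_tob:
  assumes "a \<in> Obj A" "b \<in> Obj A"
  shows "fcomp A F (tensR A (tob A a b)) = fcomp A (fcomp A F (tensR A b)) (tensR A a)"
    "fcomp A F (tensL A (tob A a b)) = fcomp A (fcomp A F (tensL A a)) (tensL A b)"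
    "fcomp A (fcomp A F (tensL A b)) (tensR A a) = fcomp A (fcomp A F (tensR A a)) (tensL A b)"
  using assms fcomp_assoc[OF tens_functr(1)[OF assms(1)], of F]
    fcomp_assoc[OF tens_functr(2)[OF assms(2)], of F]
  by (simp_all add: tens_tob(1,2)) (metis tens_tob(3))

lemma tens_nat_idn:
  assumes "a \<in> Obj A"
  shows "tensR_nat A (Idn A a) = nid A A (tensR A a)" "tensL_nat A (Idn A a) = nid A A (tensL A a)"
  using assms by (auto simp: tensR_nat_def tensL_nat_def nid_def intro!: restrict_ext)

lemma tens_nat_cmp:
  assumes "f \<in> Arr A" "g \<in> Arr A" "Cod A f = Dom A g"
  shows "tensR_nat A (g \<cdot>\<^bsub>A\<^esub> f) = nvcomp A A (tensR_nat A g) (tensR_nat A f)"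
    "tensL_nat A (g \<cdot>\<^bsub>A\<^esub> f) = nvcomp A A (tensL_nat A g) (tensL_nat A f)"
  using assms by (auto simp: tensR_nat_def tensL_nat_def nvcomp_def tar_cmp intro!: restrict_ext)

lemma tens_nat_tar:
  assumes "f \<in> Arr A" "g \<in> Arr A"
  shows "tensR_nat A (tar A f g)
      = nhcomp A A (tensR A (Dom A g)) (tensR A (Cod A f)) (tensR_nat A g) (tensR_nat A f)"
    "tensL_nat A (tar A f g)
      = nhcomp A A (tensL A (Dom A f)) (tensL A (Cod A g)) (tensL_nat A f) (tensL_nat A g)"
    "nhcomp A A (tensL A (Dom A g)) (tensR A (Cod A f)) (tensL_nat A g) (tensR_nat A f)
      = nhcomp A A (tensR A (Dom A f)) (tensL A (Cod A g)) (tensR_nat A f) (tensL_nat A g)"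
  using assms by (auto simp: tensR_nat_def tensL_nat_def nhcomp_def tar_cmp simp flip: tar_idn tar_assoc
      intro!: restrict_ext)

end

abbreviation ncode where "ncode F G t \<equiv> NatCode (Cell (FunCode F) (FunCode G) t)"

lemma Expo_cat_simps [simp]:
  "Obj (Expo_cat A Y) = FunCode ` funs A Y"
  "Arr (Expo_cat A Y) = {ncode F G t | F G t. F \<in> funs A Y \<and> G \<in> funs A Y \<and> t \<in> nats A Y F G}"
  "Dom (Expo_cat A Y) (ncode F G t) = FunCode F" "Cod (Expo_cat A Y) (ncode F G t) = FunCode G"
  "Idn (Expo_cat A Y) (FunCode F) = ncode F F (nid A Y F)"
  "Cmp (Expo_cat A Y) (ncode G' H s) (ncode F G t) = ncode F H (nvcomp A Y s t)"
  by (simp_all add: Expo_cat_def Expo_idn_def)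

locale functor_bimodule = strict_monoidal A + Y: category Y
  for A :: "('o, 'a) moncat" and Y :: "(('o, 'a, 'x) univ, ('o, 'a, 'x) univ) cat"
begin

lemma lob_rob_eq:
  "Expo_lob A a (FunCode F) = FunCode (fcomp A F (tensR A a))"
  "Expo_rob A (FunCode F) a = FunCode (fcomp A F (tensL A a))"
  by (auto simp: Expo_lob_def Expo_rob_def fcomp_def tensR_def tensL_def intro!: restrict_ext)

text \<open>The actions in terms of composition. The component of \<open>f \<rhd> t\<close> at \<open>b\<close> in the definition of \<open>[A,Y]\<close> is
literally that of the horizontal composite of \<open>t\<close> with \<open>- \<otimes> f\<close>.\<close>

lemma action_simps [simp]:
  "lob (Expo_cat A Y) a (FunCode F) = FunCode (fcomp A F (tensR A a))"
  "rob (Expo_cat A Y) (FunCode F) a = FunCode (fcomp A F (tensL A a))"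
  "f \<in> Arr A \<Longrightarrow> lar (Expo_cat A Y) f (ncode F G t) =
    ncode (fcomp A F (tensR A (Dom A f))) (fcomp A G (tensR A (Cod A f)))
      (nhcomp A Y F (tensR A (Cod A f)) t (tensR_nat A f))"
  "f \<in> Arr A \<Longrightarrow> rar (Expo_cat A Y) (ncode F G t) f =
    ncode (fcomp A F (tensL A (Dom A f))) (fcomp A G (tensL A (Cod A f)))
      (nhcomp A Y F (tensL A (Cod A f)) t (tensL_nat A f))"
  "chi (Expo_cat A Y) a (FunCode F) b
    = Idn (Expo_cat A Y) (FunCode (fcomp A (fcomp A F (tensL A b)) (tensR A a)))"
  by (auto simp: Expo_cat_def lob_rob_eq nhcomp_def intro!: restrict_ext)

lemma functr_funs [simp]: "F \<in> funs A Y \<Longrightarrow> functr A Y F" by auto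

lemma nats_nat [simp]: "t \<in> nats A Y F G \<Longrightarrow> nat_trans A Y F G t" by auto

lemma funs_act [simp]:
  "\<lbrakk>F \<in> funs A Y; a \<in> Obj A\<rbrakk> \<Longrightarrow> fcomp A F (tensR A a) \<in> funs A Y"
  "\<lbrakk>F \<in> funs A Y; a \<in> Obj A\<rbrakk> \<Longrightarrow> fcomp A F (tensL A a) \<in> funs A Y"
  by (auto intro!: fcomp_funs)

lemma nats_act [simp]:
  "\<lbrakk>t \<in> nats A Y F G; f \<in> Arr A\<rbrakk> \<Longrightarrow> nhcomp A Y F (tensR A (Cod A f)) t (tensR_nat A f)
    \<in> nats A Y (fcomp A F (tensR A (Dom A f))) (fcomp A G (tensR A (Cod A f)))"
  "\<lbrakk>t \<in> nats A Y F G; f \<in> Arr A\<rbrakk> \<Longrightarrow> nhcomp A Y F (tensL A (Cod A f)) t (tensL_nat A f)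
    \<in> nats A Y (fcomp A F (tensL A (Dom A f))) (fcomp A G (tensL A (Cod A f)))"
  by (auto intro!: nhcomp_nats)

lemma nats_nid [simp]: "F \<in> funs A Y \<Longrightarrow> nid A Y F \<in> nats A Y F F"
  by (auto intro!: nid_nats)

lemma category_Expo: "category (Expo_cat A Y)"
  by standard (auto simp: hom_def nvcomp_nid intro!: nvcomp_nats nvcomp_assoc intro: nats_nat_trans)

text \<open>Functoriality of the actions is the interchange law.\<close>

lemma act_interchange:
  assumes "f \<in> Arr A" "g \<in> Arr A" "Cod A f = Dom A g" "t \<in> nats A Y F G" "s \<in> nats A Y G H"
  shows "nhcomp A Y F (tensR A (Cod A g)) (nvcomp A Y s t) (tensR_nat A (g \<cdot>\<^bsub>A\<^esub> f))
    = nvcomp A Y (nhcomp A Y G (tensR A (Cod A g)) s (tensR_nat A g))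
        (nhcomp A Y F (tensR A (Dom A g)) t (tensR_nat A f))"
    "nhcomp A Y F (tensL A (Cod A g)) (nvcomp A Y s t) (tensL_nat A (g \<cdot>\<^bsub>A\<^esub> f))
    = nvcomp A Y (nhcomp A Y G (tensL A (Cod A g)) s (tensL_nat A g))
        (nhcomp A Y F (tensL A (Dom A g)) t (tensL_nat A f))"
  using tens_nat_trans[OF assms(1)] tens_nat_trans[OF assms(2)] assms
  by (auto simp: tens_nat_cmp intro: nhcomp_interchange[OF _ _ nats_nat_trans nats_nat_trans])

lemma act_nhcomp_assoc:
  assumes "f \<in> Arr A" "g \<in> Arr A" "t \<in> nats A Y F G"
  shows "nhcomp A Y (fcomp A F (tensR A (Dom A f))) (tensR A (Cod A g))
       (nhcomp A Y F (tensR A (Cod A f)) t (tensR_nat A f)) (tensR_nat A g)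
     = nhcomp A Y F (fcomp A (tensR A (Cod A f)) (tensR A (Cod A g))) t
         (nhcomp A A (tensR A (Dom A f)) (tensR A (Cod A g)) (tensR_nat A f) (tensR_nat A g))"
    "nhcomp A Y (fcomp A F (tensL A (Dom A f))) (tensL A (Cod A g))
       (nhcomp A Y F (tensL A (Cod A f)) t (tensL_nat A f)) (tensL_nat A g)
     = nhcomp A Y F (fcomp A (tensL A (Cod A f)) (tensL A (Cod A g))) t
         (nhcomp A A (tensL A (Dom A f)) (tensL A (Cod A g)) (tensL_nat A f) (tensL_nat A g))"
    "nhcomp A Y (fcomp A F (tensL A (Dom A f))) (tensR A (Cod A g))
       (nhcomp A Y F (tensL A (Cod A f)) t (tensL_nat A f)) (tensR_nat A g)
     = nhcomp A Y F (fcomp A (tensL A (Cod A f)) (tensR A (Cod A g))) t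
         (nhcomp A A (tensL A (Dom A f)) (tensR A (Cod A g)) (tensL_nat A f) (tensR_nat A g))"
    "nhcomp A Y (fcomp A F (tensR A (Dom A f))) (tensL A (Cod A g))
       (nhcomp A Y F (tensR A (Cod A f)) t (tensR_nat A f)) (tensL_nat A g)
     = nhcomp A Y F (fcomp A (tensR A (Cod A f)) (tensL A (Cod A g))) t
         (nhcomp A A (tensR A (Dom A f)) (tensL A (Cod A g)) (tensR_nat A f) (tensL_nat A g))"
  using assms by (auto intro!: nhcomp_assoc[OF _ _ nats_nat_trans] intro: tens_nat_trans)

text \<open>The analogue of \<open>act_tob\<close> for arrows.\<close>

lemma act_tar:
  assumes "f \<in> Arr A" "g \<in> Arr A" "t \<in> nats A Y F G"
  shows "nhcomp A Y F (tensR A (tob A (Cod A f) (Cod A g))) t (tensR_nat A (tar A f g))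
     = nhcomp A Y (fcomp A F (tensR A (Dom A g))) (tensR A (Cod A f))
         (nhcomp A Y F (tensR A (Cod A g)) t (tensR_nat A g)) (tensR_nat A f)"
    "nhcomp A Y F (tensL A (tob A (Cod A f) (Cod A g))) t (tensL_nat A (tar A f g))
     = nhcomp A Y (fcomp A F (tensL A (Dom A f))) (tensL A (Cod A g))
         (nhcomp A Y F (tensL A (Cod A f)) t (tensL_nat A f)) (tensL_nat A g)"
    "nhcomp A Y (fcomp A F (tensL A (Dom A g))) (tensR A (Cod A f))
         (nhcomp A Y F (tensL A (Cod A g)) t (tensL_nat A g)) (tensR_nat A f)
     = nhcomp A Y (fcomp A F (tensR A (Dom A f))) (tensL A (Cod A g))
         (nhcomp A Y F (tensR A (Cod A f)) t (tensR_nat A f)) (tensL_nat A g)"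
  using assms act_nhcomp_assoc[OF assms(1,2,3)] act_nhcomp_assoc[OF assms(2,1,3)]
    tens_nat_tar[OF assms(1,2)] tens_tob(3)[of "Cod A f" "Cod A g"]
  by (simp_all add: tens_tob(1,2))

lemma fcomp_fid_funs [simp]: "F \<in> funs A Y \<Longrightarrow> fcomp A F (fid A) = F"
  by (rule fcomp_fid)

lemma nid_idem [simp]: "F \<in> funs A Y \<Longrightarrow> nvcomp A Y (nid A Y F) (nid A Y F) = nid A Y F"
  by (rule nvcomp_nid) (rule nats_nid)

text \<open>Naturality of \<open>\<chi>\<close> on \<open>[A,Y]\<close> is an equation in which both occurrences of \<open>\<chi>\<close> are identities; these
rules remove them.\<close>

lemma nid_act [simp]:
  assumes "t \<in> nats A Y F G" "f \<in> Arr A" "g \<in> Arr A"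
  defines "s \<equiv> nhcomp A Y (fcomp A F (tensR A (Dom A f))) (tensL A (Cod A g))
    (nhcomp A Y F (tensR A (Cod A f)) t (tensR_nat A f)) (tensL_nat A g)"
  shows "nvcomp A Y s (nid A Y (fcomp A (fcomp A F (tensR A (Dom A f))) (tensL A (Dom A g)))) = s"
    "nvcomp A Y (nid A Y (fcomp A (fcomp A G (tensR A (Cod A f))) (tensL A (Cod A g)))) s = s"
  using nats_act(2)[OF nats_act(1)[OF assms(1,2)] assms(3)] unfolding s_def by (simp_all add: nvcomp_nid)

lemma bimodule_Expo: "bimodule A (Expo_cat A Y)"
proof -
  interpret E: category "Expo_cat A Y" by (rule category_Expo)
  have L: "functr (prod_cat A (Expo_cat A Y)) (Expo_cat A Y)
      (FMap (\<lambda>(a, m). lob (Expo_cat A Y) a m) (\<lambda>(f, k). lar (Expo_cat A Y) f k))"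
    by (rule functrI)
      (auto simp: category_prod category_axioms category_Expo tens_nat_idn
        nhcomp_nid act_interchange)
  have R: "functr (prod_cat (Expo_cat A Y) A) (Expo_cat A Y)
      (FMap (\<lambda>(m, a). rob (Expo_cat A Y) m a) (\<lambda>(k, f). rar (Expo_cat A Y) k f))"
    by (rule functrI)
      (auto simp: category_prod category_axioms category_Expo tens_nat_idn
        nhcomp_nid act_interchange)
  show ?thesis
    by (intro bimoduleI bimodule_axioms.intro strict_monoidal_axioms category_Expo L R)
      (auto simp: hom_def act_tob act_tar tens_unt tens_nat_idn nhcomp_nid nhcomp_nid_right)
qed

end

section \<open>\<open>[A,-]\<close> is a 2-functor\<close>

definition post_nat :: "('o, 'a) moncat \<Rightarrow> ('p, 'b, 'q, 'c) fmap \<Rightarrow> ('o \<Rightarrow> 'b) \<Rightarrow> 'o \<Rightarrow> 'c" where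
  "post_nat A G t = (\<lambda>b\<in>Obj A. onArr G (t b))"

locale post_composition = strict_monoidal A + G: functr Y Z G
  for A :: "('o, 'a) moncat" and Y Z :: "(('o, 'a, 'x) univ, ('o, 'a, 'x) univ) cat" and G
begin

sublocale Y: functor_bimodule A Y by standard
sublocale Z: functor_bimodule A Z by standard

lemma post_funs [simp]: "F \<in> funs A Y \<Longrightarrow> fcomp A G F \<in> funs A Z"
  by (intro fcomp_funs[of A Y] G.functr_axioms) auto

lemma post_nats [simp]:
  assumes "t \<in> nats A Y F F'" shows "post_nat A G t \<in> nats A Z (fcomp A G F) (fcomp A G F')"
proof -
  interpret t: nat_trans A Y F F' t using assms by auto
  have natural: "onArr G (onArr F' f) \<cdot>\<^bsub>Z\<^esub> onArr G (t (Dom A f)) = onArr G (t (Cod A f)) \<cdot>\<^bsub>Z\<^esub> onArr G (onArr F f)"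
    if "f \<in> Arr A" for f using t.naturality[OF that] that by (simp flip: G.map_cmp)
  have "nat_trans A Z (fcomp A G F) (fcomp A G F') (post_nat A G t)"
    by (rule nat_transI[OF fcomp_functr[OF t.F.functr_axioms G.functr_axioms]
          fcomp_functr[OF t.G.functr_axioms G.functr_axioms]]) (simp_all add: post_nat_def natural)
  then show ?thesis by (rule natsI) (simp add: post_nat_def)
qed

lemma post_act:
  "a \<in> Obj A \<Longrightarrow> fcomp A G (fcomp A F (tensR A a)) = fcomp A (fcomp A G F) (tensR A a)"
  "a \<in> Obj A \<Longrightarrow> fcomp A G (fcomp A F (tensL A a)) = fcomp A (fcomp A G F) (tensL A a)"
  by (simp_all add: fcomp_assoc[OF tens_functr(1)] fcomp_assoc[OF tens_functr(2)])

text \<open>Postcomposition commutes strictly with precomposition, so \<open>[A,G]\<close> preserves both actions strictly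
and its comparison maps are identities.\<close>

lemma post_nat_act:
  assumes "t \<in> nats A Y F F'" "f \<in> Arr A"
  shows "post_nat A G (nhcomp A Y F (tensR A (Cod A f)) t (tensR_nat A f))
      = nhcomp A Z (fcomp A G F) (tensR A (Cod A f)) (post_nat A G t) (tensR_nat A f)"
    "post_nat A G (nhcomp A Y F (tensL A (Cod A f)) t (tensL_nat A f))
      = nhcomp A Z (fcomp A G F) (tensL A (Cod A f)) (post_nat A G t) (tensL_nat A f)"
proof -
  interpret t: nat_trans A Y F F' t using assms by auto
  show "post_nat A G (nhcomp A Y F (tensR A (Cod A f)) t (tensR_nat A f))
      = nhcomp A Z (fcomp A G F) (tensR A (Cod A f)) (post_nat A G t) (tensR_nat A f)"
    "post_nat A G (nhcomp A Y F (tensL A (Cod A f)) t (tensL_nat A f))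
      = nhcomp A Z (fcomp A G F) (tensL A (Cod A f)) (post_nat A G t) (tensL_nat A f)"
    using assms(2) by (auto simp: post_nat_def nhcomp_def intro!: restrict_ext)
qed

lemma post_nat_nid: "F \<in> funs A Y \<Longrightarrow> post_nat A G (nid A Y F) = nid A Z (fcomp A G F)"
  by (auto simp: post_nat_def nid_def functr.map_obj intro!: restrict_ext)

lemma post_nat_nvcomp:
  assumes "t \<in> nats A Y F F'" "s \<in> nats A Y F' F''"
  shows "post_nat A G (nvcomp A Y s t) = nvcomp A Z (post_nat A G s) (post_nat A G t)"
proof -
  interpret t: nat_trans A Y F F' t using assms by auto
  interpret s: nat_trans A Y F' F'' s using assms by auto
  show ?thesis by (auto simp: post_nat_def nvcomp_def intro!: restrict_ext)
qed

lemma Expo_fun_simps [simp]: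
  "F \<in> funs A Y \<Longrightarrow> onObj (bfun (dat (Expo_fun A (Cell Y Z G)))) (FunCode F) = FunCode (fcomp A G F)"
  "\<lbrakk>F \<in> funs A Y; F' \<in> funs A Y; t \<in> nats A Y F F'\<rbrakk> \<Longrightarrow>
    onArr (bfun (dat (Expo_fun A (Cell Y Z G)))) (ncode F F' t)
      = ncode (fcomp A G F) (fcomp A G F') (post_nat A G t)"
  "\<lbrakk>a \<in> Obj A; F \<in> funs A Y\<rbrakk> \<Longrightarrow> brr (dat (Expo_fun A (Cell Y Z G))) (a, FunCode F)
    = Idn (Expo_cat A Z) (FunCode (fcomp A (fcomp A G F) (tensR A a)))"
  by (auto simp: Expo_fun_def Expo_post_def post_nat_def Y.lob_rob_eq Expo_idn_def)

lemma Expo_fun_ext [simp]: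
  "onObj (bfun (dat (Expo_fun A (Cell Y Z G)))) \<in> extensional (FunCode ` funs A Y)"
  "onArr (bfun (dat (Expo_fun A (Cell Y Z G)))) \<in> extensional (Arr (Expo_cat A Y))"
  "brr (dat (Expo_fun A (Cell Y Z G))) \<in> extensional (Obj A \<times> FunCode ` funs A Y)"
  by (simp_all add: Expo_fun_def del: Expo_cat_simps(2))

lemma Expo_fun_funs: "bfun (dat (Expo_fun A (Cell Y Z G))) \<in> funs (Expo_cat A Y) (Expo_cat A Z)"
proof -
  have cmp: "onArr (bfun (dat (Expo_fun A (Cell Y Z G)))) (ncode F F'' (nvcomp A Y s t))
      = ncode (fcomp A G F) (fcomp A G F'') (nvcomp A Z (post_nat A G s) (post_nat A G t))"
    if "F \<in> funs A Y" "F'' \<in> funs A Y" "t \<in> nats A Y F F'" "s \<in> nats A Y F' F''" for F F' F'' s t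
    using that nvcomp_nats[of A Y F F' t F'' s] by (simp add: post_nat_nvcomp)
  have "functr (Expo_cat A Y) (Expo_cat A Z) (bfun (dat (Expo_fun A (Cell Y Z G))))"
    by (rule functrI) (auto simp: Y.category_Expo Z.category_Expo post_nat_nid cmp)
  then show ?thesis by (rule funsI) (simp_all del: Expo_cat_simps(2))
qed

lemma bimodule_map_Expo_fun:
  "bimodule_map A (Expo_cat A Y) (Expo_cat A Z) (dat (Expo_fun A (Cell Y Z G)))"
proof (rule bimodule_mapI)
  have natural: "nvcomp A Z
      (nhcomp A Z (fcomp A G F) (tensR A (Cod A f)) (post_nat A G t) (tensR_nat A f))
      (nid A Z (fcomp A (fcomp A G F) (tensR A (Dom A f)))) =
    nvcomp A Z (nid A Z (fcomp A (fcomp A G F') (tensR A (Cod A f))))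
      (nhcomp A Z (fcomp A G F) (tensR A (Cod A f)) (post_nat A G t) (tensR_nat A f))"
    if "f \<in> Arr A" "t \<in> nats A Y F F'" for f t F F'
    using nvcomp_nid[OF Z.nats_act(1)[OF post_nats[OF that(2)] that(1)]] by simp
  show "bimodule_map_axioms A (Expo_cat A Y) (Expo_cat A Z) (dat (Expo_fun A (Cell Y Z G)))"
    by (rule bimodule_map_axioms.intro)
      (auto simp: hom_def natural post_act post_nat_act post_nat_nid act_tob tens_unt
        tens_nat_idn nhcomp_nid)
qed (simp_all add: Y.bimodule_Expo Z.bimodule_Expo funs_functr[OF Expo_fun_funs])

end

lemma post_compositionI:
  "\<lbrakk>strict_monoidal A; functr Y Z G\<rbrakk> \<Longrightarrow> post_composition A Y Z G"
  by (simp add: post_composition_def)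

lemma Expo_fun_cells [simp]: "src (Expo_fun A G) = Expo_cat A (src G)" "tgt (Expo_fun A G) = Expo_cat A (tgt G)"
  by (simp_all add: Expo_fun_def)

lemma Expo_fun_id:
  assumes "strict_monoidal A" "category Y"
  shows "dat (Expo_fun A (Cell Y Y (fid Y))) = bimap_id A (Expo_cat A Y)"
proof -
  interpret post_composition A Y Y "fid Y"
    by (intro post_compositionI assms funs_functr fid_funs)
  have nats: "post_nat A (fid Y) t = t" if "t \<in> nats A Y F F'" for F F' t
    by (rule nats_eqI[OF post_nats[OF that] that])
      (use nat_trans.comp_simps(1)[OF nats_nat_trans[OF that]] in \<open>simp add: post_nat_def\<close>)
  show ?thesis
  proof (rule bimap_eqI[where A = A and M = "Expo_cat A Y"])
    show "bfun (dat (Expo_fun A (Cell Y Y (fid Y)))) = bfun (bimap_id A (Expo_cat A Y))"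
      unfolding bimap_simps
      by (rule funs_eqI[OF Expo_fun_funs fid_funs[OF Y.category_Expo]])
       (auto simp: nats fcomp_fid)
    show "brr (bimap_id A (Expo_cat A Y)) \<in> extensional (Obj A \<times> Obj (Expo_cat A Y))"
      by (rule bimap_simps)
  qed (auto simp: fcomp_fid)
qed

lemma Expo_fun_comp:
  assumes "strict_monoidal A" "functr Y Z G" "functr Z W H"
  shows "dat (Expo_fun A (Cell Y W (fcomp Y H G)))
    = bimap_comp A (Expo_cat A Y) (Expo_cat A W) (dat (Expo_fun A (Cell Z W H))) (dat (Expo_fun A (Cell Y Z G)))"
proof -
  interpret G: post_composition A Y Z G by (intro post_compositionI assms)
  interpret H: post_composition A Z W H by (intro post_compositionI assms)
  interpret HG: post_composition A Y W "fcomp Y H G" by (intro post_compositionI assms(1) fcomp_functr[OF assms(2,3)])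
  have nats: "post_nat A (fcomp Y H G) t = post_nat A H (post_nat A G t)" if "t \<in> nats A Y F F'" for F F' t
    using nat_trans.comp_simps(1)[OF nats_nat_trans[OF that]] by (auto simp: post_nat_def)
  have fcomp: "fcomp A (fcomp Y H G) F = fcomp A H (fcomp A G F)" if "F \<in> funs A Y" for F
    by (rule fcomp_assoc[OF funs_functr[OF that], symmetric])
  show ?thesis
  proof (rule bimap_eqI[where A = A and M = "Expo_cat A Y"])
    show "bfun (dat (Expo_fun A (Cell Y W (fcomp Y H G)))) = 
      bfun (bimap_comp A (Expo_cat A Y) (Expo_cat A W) (dat (Expo_fun A (Cell Z W H))) (dat (Expo_fun A (Cell Y Z G))))"
      unfolding bimap_simps
      by (rule funs_eqI[OF HG.Expo_fun_funs
           fcomp_funs[OF funs_functr[OF G.Expo_fun_funs] funs_functr[OF H.Expo_fun_funs]]])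
       (auto simp: nats fcomp)
    show "brr (bimap_comp A (Expo_cat A Y) (Expo_cat A W) (dat (Expo_fun A (Cell Z W H)))
        (dat (Expo_fun A (Cell Y Z G)))) \<in> extensional (Obj A \<times> Obj (Expo_cat A Y))"
      by (rule bimap_simps)
  qed (auto simp: fcomp H.post_nat_nid H.post_act)
qed

lemma Expo_nat_simps [simp]: "src (Expo_nat A \<gamma>) = Expo_fun A (src \<gamma>)" "tgt (Expo_nat A \<gamma>) = Expo_fun A (tgt \<gamma>)"
  "F \<in> funs A Y \<Longrightarrow> dat (Expo_nat A (Cell (Cell Y Z G) (Cell Y' Z' G') t)) (FunCode F)
    = ncode (fcomp A G F) (fcomp A G' F) (\<lambda>b\<in>Obj A. t (onObj F b))"
  "dat (Expo_nat A (Cell (Cell Y Z G) (Cell Y' Z' G') t)) \<in> extensional (FunCode ` funs A Y)"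
  by (simp_all add: Expo_nat_def Expo_post_def)

lemma whisker_nats:
  assumes "functr C D F" "nat_trans D E G G' t"
  shows "(\<lambda>b\<in>Obj C. t (onObj F b)) \<in> nats C E (fcomp C G F) (fcomp C G' F)"
proof -
  interpret F: functr C D F by fact
  interpret t: nat_trans D E G G' t by fact
  show ?thesis
    by (auto simp: nats_def t.natural intro!: nat_transI fcomp_functr[of C D] F.functr_axioms t.F.functr_axioms t.G.functr_axioms)
qed

text \<open>Both compatibilities hold because the component of \<open>[A,t]\<close> at \<open>F\<close> is \<open>t\<close> whiskered with \<open>F\<close>, and
acting on \<open>F\<close> only precomposes it with a further functor.\<close>

lemma bimodule_trans_Expo_nat:
  assumes "strict_monoidal A" "nat_trans Y Z G G' t"
  shows "bimodule_trans A (Expo_cat A Y) (Expo_cat A Z) (dat (Expo_fun A (Cell Y Z G))) (dat (Expo_fun A (Cell Y Z G')))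
     (dat (Expo_nat A (Cell (Cell Y Z G) (Cell Y Z G') t)))" (is "bimodule_trans A ?Y ?Z ?G ?G' ?t")
proof (rule bimodule_transI)
  interpret t: nat_trans Y Z G G' t by fact
  interpret G: post_composition A Y Z G by (intro post_compositionI assms t.F.functr_axioms)
  interpret G': post_composition A Y Z G' by (intro post_compositionI assms t.G.functr_axioms)
  show "bimodule_map A ?Y ?Z ?G" "bimodule_map A ?Y ?Z ?G'"
    by (rule G.bimodule_map_Expo_fun G'.bimodule_map_Expo_fun)+
  have comp: "(\<lambda>b\<in>Obj A. t (onObj F b)) \<in> nats A Z (fcomp A G F) (fcomp A G' F)" if "F \<in> funs A Y" for F
    using that by (intro whisker_nats[of A Y] assms) auto
  have natural: "nvcomp A Z (post_nat A G' s) (\<lambda>b\<in>Obj A. t (onObj F b))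
      = nvcomp A Z (\<lambda>b\<in>Obj A. t (onObj F' b)) (post_nat A G s)" if "s \<in> nats A Y F F'" for s F F'
  proof -
    interpret s: nat_trans A Y F F' s using that by auto
    show ?thesis by (auto simp: nvcomp_def post_nat_def t.natural intro!: restrict_ext)
  qed
  show "?t \<in> nats ?Y ?Z (bfun ?G) (bfun ?G')"
  proof (rule natsI[OF nat_transI[OF funs_functr[OF G.Expo_fun_funs] funs_functr[OF G'.Expo_fun_funs]]])
  qed (auto simp: comp natural)
  \<comment> \<open>The identities on the outside are the comparison maps of \<open>[A,G]\<close> and \<open>[A,G']\<close>.\<close>
  have act: "nvcomp A Z (\<lambda>b\<in>Obj A. t (onObj (fcomp A F (tensR A a)) b)) (nid A Z (fcomp A (fcomp A G F) (tensR A a)))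
      = nvcomp A Z (nid A Z (fcomp A (fcomp A G' F) (tensR A a)))
         (nhcomp A Z (fcomp A G F) (tensR A a) (\<lambda>b\<in>Obj A. t (onObj F b)) (tensR_nat A (Idn A a)))"
     "(\<lambda>b\<in>Obj A. t (onObj (fcomp A F (tensL A a)) b))
       = nhcomp A Z (fcomp A G F) (tensL A a) (\<lambda>b\<in>Obj A. t (onObj F b)) (tensL_nat A (Idn A a))"
    if "F \<in> funs A Y" "a \<in> Obj A" for F a
  proof -
    interpret F: functr A Y F using that by auto
    show "nvcomp A Z (\<lambda>b\<in>Obj A. t (onObj (fcomp A F (tensR A a)) b)) (nid A Z (fcomp A (fcomp A G F) (tensR A a)))
      = nvcomp A Z (nid A Z (fcomp A (fcomp A G' F) (tensR A a)))
         (nhcomp A Z (fcomp A G F) (tensR A a) (\<lambda>b\<in>Obj A. t (onObj F b)) (tensR_nat A (Idn A a)))"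
     "(\<lambda>b\<in>Obj A. t (onObj (fcomp A F (tensL A a)) b))
       = nhcomp A Z (fcomp A G F) (tensL A a) (\<lambda>b\<in>Obj A. t (onObj F b)) (tensL_nat A (Idn A a))"
      using that(2) by (auto simp: nvcomp_def nid_def nhcomp_def intro!: restrict_ext)
  qed
  show "?t (lob ?Y a m) \<cdot>\<^bsub>?Z\<^esub> brr ?G (a, m) = brr ?G' (a, m) \<cdot>\<^bsub>?Z\<^esub> lar ?Z (Idn A a) (?t m)"
    if "a \<in> Obj A" "m \<in> Obj ?Y" for a m
    using that act(1) by (auto simp: G.post_act G'.post_act)
  show "?t (rob ?Y m b) = rar ?Z (?t m) (Idn A b)" if "m \<in> Obj ?Y" "b \<in> Obj A" for m b
    using that act(2) by (auto simp: G.post_act G'.post_act)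
qed

lemma Expo_fun_arr:
  assumes "strict_monoidal A" "G \<in> Arr Cat1" shows "Expo_fun A G \<in> Arr (Bimod1 A)"
proof -
  obtain Y Z g where G: "G = Cell Y Z g" "functr Y Z g" using assms(2) by (rule Cat1_arrE)
  interpret post_composition A Y Z g by (intro post_compositionI assms G)
  show ?thesis by (simp add: G Expo_fun_funs bimodule_map_Expo_fun)
qed

lemma functr_Expo_Base:
  assumes "strict_monoidal A" shows "functr Cat1 (Bimod1 A) (FMap (Expo_cat A) (Expo_fun A))"
proof (rule functrI, goal_cases)
  case (3 Y)
  then interpret functor_bimodule A Y by (simp add: functor_bimodule_def assms)
  show ?case by (simp add: bimodule_Expo)
next
  case (4 G)
  then show ?case unfolding fmap.sel by (rule Expo_fun_arr[OF assms])
next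
  case (8 F G)
  obtain X Y f where F: "F = Cell X Y f" "functr X Y f" using 8(1) by (rule Cat1_arrE)
  obtain Y' Z g where G: "G = Cell Y' Z g" "functr Y' Z g" using 8(2) by (rule Cat1_arrE)
  have "Y' = Y" using 8(3) F G by simp
  then show ?case using F G assms by (simp add: Expo_fun_comp cell.expand)
qed (simp_all add: category_Bimod1 category_Cat1 Expo_fun_id assms cell.expand)

lemma functr_Expo_Vert:
  assumes "strict_monoidal A" shows "functr (Vert CAT) (Vert (BIMOD A)) (FMap (Expo_fun A) (Expo_nat A))"
proof (rule functrI, goal_cases)
  case (3 G)
  then show ?case using Expo_fun_arr[OF assms, of G] by simp
next
  case (4 \<alpha>)
  obtain Y Z f g t where \<alpha>: "\<alpha> = Cell (Cell Y Z f) (Cell Y Z g) t"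
      "f \<in> funs Y Z" "g \<in> funs Y Z" "nat_trans Y Z f g t"
    using 4 by (rule CAT_arrE)
  have "Expo_fun A (Cell Y Z f) \<in> Arr (Bimod1 A)" "Expo_fun A (Cell Y Z g) \<in> Arr (Bimod1 A)"
    using \<alpha> by (intro Expo_fun_arr assms; simp)+
  then show ?case
    using \<alpha> bimodule_trans_Expo_nat[OF assms \<alpha>(4)] by simp
next
  case (7 G)
  then have "G \<in> Arr Cat1" by (simp only: CAT_simps)
  then obtain Y Z g where G: "G = Cell Y Z g" "functr Y Z g" by (rule Cat1_arrE)
  interpret post_composition A Y Z g by (intro post_compositionI assms G)
  have "(\<lambda>b\<in>Obj A. nid Y Z g (onObj F b)) = nid A Z (fcomp A g F)" if "F \<in> funs A Y" for F
    using that by (auto simp: nid_def functr.map_obj intro!: restrict_ext)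
  then have "dat (Expo_nat A (Cell (Cell Y Z g) (Cell Y Z g) (nid Y Z g)))
      = nid (Expo_cat A Y) (Expo_cat A Z) (bfun (dat (Expo_fun A (Cell Y Z g))))"
    by (intro extensionalityI[where A = "FunCode ` funs A Y"])
      (auto simp: nid_def[of "Expo_cat A Y"])
  then show ?case by (simp add: G cell.expand)
next
  case (8 \<alpha> \<beta>)
  obtain Y Z f g t where \<alpha>: "\<alpha> = Cell (Cell Y Z f) (Cell Y Z g) t" "nat_trans Y Z f g t"
    using 8(1) by (rule CAT_arrE)
  obtain Y' Z' g' h s where \<beta>: "\<beta> = Cell (Cell Y' Z' g') (Cell Y' Z' h) s" "nat_trans Y' Z' g' h s"
    using 8(2) by (rule CAT_arrE)
  have [simp]: "Y' = Y" "Z' = Z" "g' = g" using 8(3) by (simp_all add: \<alpha> \<beta>)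
  have "(\<lambda>b\<in>Obj A. nvcomp Y Z s t (onObj F b)) = nvcomp A Z (\<lambda>b\<in>Obj A. s (onObj F b)) (\<lambda>b\<in>Obj A. t (onObj F b))"
    if "F \<in> funs A Y" for F
    using functr.map_obj[OF funs_functr[OF that]] by (auto simp: nvcomp_def intro!: restrict_ext)
  then have "dat (Expo_nat A (Cell (Cell Y Z f) (Cell Y Z h) (nvcomp Y Z s t)))
      = nvcomp (Expo_cat A Y) (Expo_cat A Z) (dat (Expo_nat A \<beta>)) (dat (Expo_nat A \<alpha>))"
    by (intro extensionalityI[where A = "FunCode ` funs A Y"])
      (auto simp: nvcomp_def[of "Expo_cat A Y"] \<alpha> \<beta>)
  then show ?case by (simp add: \<alpha> \<beta> cell.expand)
qed (simp_all add: category_Vert_BIMOD category_Vert_CAT)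

lemma Expo_simps [simp]: "on0 (Expo A) = Expo_cat A" "on1 (Expo A) = Expo_fun A" "on2 (Expo A) = Expo_nat A"
  by (simp_all add: Expo_def)

lemma two_functor_Expo:
  assumes "strict_monoidal A" shows "two_functor CAT (BIMOD A) (Expo A)"
proof (rule two_functorI, goal_cases)
  case (5 \<alpha> \<beta>)
  obtain X Y f f' t where \<alpha>: "\<alpha> = Cell (Cell X Y f) (Cell X Y f') t" "nat_trans X Y f f' t"
    using 5(1) by (rule CAT_arrE)
  obtain Y' Z g g' s where \<beta>: "\<beta> = Cell (Cell Y' Z g) (Cell Y' Z g') s" "nat_trans Y' Z g g' s"
    using 5(2) by (rule CAT_arrE)
  have [simp]: "Y' = Y" using 5(3) by (simp_all add: \<alpha> \<beta>)
  interpret t: nat_trans X Y f f' t by fact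
  interpret s: nat_trans Y Z g g' s using \<beta>(2) by simp
  interpret f: post_composition A X Y f by (intro post_compositionI assms t.F.functr_axioms)
  interpret f': post_composition A X Y f' by (intro post_compositionI assms t.G.functr_axioms)
  interpret g: post_composition A Y Z g by (intro post_compositionI assms s.F.functr_axioms)
  have comp: "(\<lambda>b\<in>Obj A. t (onObj F b)) \<in> nats A Y (fcomp A f F) (fcomp A f' F)" if "F \<in> funs A X" for F
    using that by (intro whisker_nats[of A X] \<alpha>(2)) auto
  have "(\<lambda>b\<in>Obj A. nhcomp X Z g f' s t (onObj F b))
      = nvcomp A Z (\<lambda>b\<in>Obj A. s (onObj (fcomp A f' F) b)) (post_nat A g (\<lambda>b\<in>Obj A. t (onObj F b)))"
    if "F \<in> funs A X" for F
    using functr.map_obj[OF funs_functr[OF that]]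
    by (auto simp: nvcomp_def nhcomp_def post_nat_def intro!: restrict_ext)
  moreover have "fcomp A (fcomp X g f) F = fcomp A g (fcomp A f F)"
    "fcomp A (fcomp X g' f') F = fcomp A g' (fcomp A f' F)" if "F \<in> funs A X" for F
    by (rule fcomp_assoc[OF funs_functr[OF that], symmetric])+
  ultimately have "dat (Expo_nat A (Cell (Cell X Z (fcomp X g f)) (Cell X Z (fcomp X g' f')) (nhcomp X Z g f' s t)))
      = nhcomp (Expo_cat A X) (Expo_cat A Z) (bfun (dat (Expo_fun A (Cell Y Z g))))
          (bfun (dat (Expo_fun A (Cell X Y f')))) (dat (Expo_nat A \<beta>)) (dat (Expo_nat A \<alpha>))"
    by (intro extensionalityI[where A = "FunCode ` funs A X"])
      (auto simp: nhcomp_def[of "Expo_cat A X"] \<alpha> \<beta> comp)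
  then show ?case
    by (simp add: \<alpha> \<beta> cell.expand Expo_fun_comp[OF assms t.F.functr_axioms s.F.functr_axioms]
       Expo_fun_comp[OF assms t.G.functr_axioms s.G.functr_axioms] Expo_def)
qed (simp_all add: two_category_BIMOD two_category_CAT functr_Expo_Base functr_Expo_Vert assms Expo_def)

section \<open>The unit\<close>

text \<open>The orbit functor \<open>b \<mapsto> m \<lhd> b\<close> from \<open>A\<close> to \<open>H0(A,M)\<close>, its dependence on \<open>m\<close>, and the transformation
\<open>a \<rhd> orbit m \<Rightarrow> orbit (a \<rhd> m)\<close> with components \<open>\<phi>\<close> followed by \<open>\<chi>\<close>. Together they form the unit.\<close>

definition orbit :: "('o, 'a) moncat \<Rightarrow> ('o, 'a, ('o, 'a, 'x) univ) bimod \<Rightarrow> ('o, 'a, 'x) univ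
    \<Rightarrow> ('o, 'a, ('o, 'a, 'x) univ, ('o, 'a, 'x) univ) fmap" where
  "orbit A M m = FMap (\<lambda>b\<in>Obj A. rob M m b) (\<lambda>g\<in>Arr A. H0_emb A M (rar M (Idn M m) g))"

definition orbit_nat :: "('o, 'a) moncat \<Rightarrow> ('o, 'a, ('o, 'a, 'x) univ) bimod \<Rightarrow> ('o, 'a, 'x) univ
    \<Rightarrow> 'o \<Rightarrow> ('o, 'a, 'x) univ" where
  "orbit_nat A M k = (\<lambda>b\<in>Obj A. H0_emb A M (rar M k (Idn A b)))"

definition orbit_twist :: "('o, 'a) moncat \<Rightarrow> ('o, 'a, ('o, 'a, 'x) univ) bimod \<Rightarrow> 'o \<Rightarrow> ('o, 'a, 'x) univ
    \<Rightarrow> 'o \<Rightarrow> ('o, 'a, 'x) univ" where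
  "orbit_twist A M a m = (\<lambda>b\<in>Obj A. H0_emb A M (chi M a m b) \<cdot>\<^bsub>H0_cat A M\<^esub> H0_phi A M a (rob M m b))"

definition unit_cell :: "('o, 'a) moncat \<Rightarrow> ('o, 'a, ('o, 'a, 'x) univ) bimod
    \<Rightarrow> ('o, 'a, ('o, 'a, 'x) univ) bimod1" where
  "unit_cell A M = Cell M (Expo_cat A (H0_cat A M)) (BiMap
     (FMap (\<lambda>m\<in>Obj M. FunCode (orbit A M m))
       (\<lambda>k\<in>Arr M. ncode (orbit A M (Dom M k)) (orbit A M (Cod M k)) (orbit_nat A M k)))
     (\<lambda>(a, m)\<in>Obj A \<times> Obj M.
        ncode (fcomp A (orbit A M m) (tensR A a)) (orbit A M (lob M a m)) (orbit_twist A M a m)))"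

lemma orbit_simps [simp]:
  "b \<in> Obj A \<Longrightarrow> onObj (orbit A M m) b = rob M m b"
  "g \<in> Arr A \<Longrightarrow> onArr (orbit A M m) g = H0_emb A M (rar M (Idn M m) g)"
  "b \<in> Obj A \<Longrightarrow> orbit_nat A M k b = H0_emb A M (rar M k (Idn A b))"
  "b \<in> Obj A \<Longrightarrow> orbit_twist A M a m b = H0_emb A M (chi M a m b) \<cdot>\<^bsub>H0_cat A M\<^esub> H0_phi A M a (rob M m b)"
  by (simp_all add: orbit_def orbit_nat_def orbit_twist_def)

lemma unit_cell_simps [simp]:
  "src (unit_cell A M) = M" "tgt (unit_cell A M) = Expo_cat A (H0_cat A M)"
  "m \<in> Obj M \<Longrightarrow> onObj (bfun (dat (unit_cell A M))) m = FunCode (orbit A M m)"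
  "k \<in> Arr M \<Longrightarrow> onArr (bfun (dat (unit_cell A M))) k
    = ncode (orbit A M (Dom M k)) (orbit A M (Cod M k)) (orbit_nat A M k)"
  "\<lbrakk>a \<in> Obj A; m \<in> Obj M\<rbrakk> \<Longrightarrow> brr (dat (unit_cell A M)) (a, m)
    = ncode (fcomp A (orbit A M m) (tensR A a)) (orbit A M (lob M a m)) (orbit_twist A M a m)"
  "onObj (bfun (dat (unit_cell A M))) \<in> extensional (Obj M)"
  "onArr (bfun (dat (unit_cell A M))) \<in> extensional (Arr M)"
  "brr (dat (unit_cell A M)) \<in> extensional (Obj A \<times> Obj M)"
  by (simp_all add: unit_cell_def)

context univ_bimodule
begin

text \<open>The right action of a pair of arrows, factored in the two possible orders into an action of an
identity of \<open>A\<close> and one on an identity of \<open>M\<close>.\<close>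

lemma rar_split:
  assumes "k \<in> Arr M" "f \<in> Arr A" "Dom M k = m" "Cod A f = b"
  shows "rar M k (Idn A b) \<cdot>\<^bsub>M\<^esub> rar M (Idn M m) f = rar M k f"
  using rar_cmp[of "Idn M m" k f "Idn A b"] assms by auto

lemma rar_split':
  assumes "k \<in> Arr M" "f \<in> Arr A" "Cod M k = m" "Dom A f = b"
  shows "rar M (Idn M m) f \<cdot>\<^bsub>M\<^esub> rar M k (Idn A b) = rar M k f"
  using rar_cmp[of k "Idn M m" "Idn A b" f] assms by auto

lemma emb_rar_split:
  assumes "k \<in> Arr M" "f \<in> Arr A" "Dom M k = m" "Cod A f = b"
  shows "H0_emb A M (rar M k (Idn A b)) \<cdot>\<^bsub>H0_cat A M\<^esub> H0_emb A M (rar M (Idn M m) f)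
    = H0_emb A M (rar M k f)"
  using assms rar_split[OF assms] by (auto simp flip: H0_emb_cmp)

lemma emb_rar_split':
  assumes "k \<in> Arr M" "f \<in> Arr A" "Cod M k = m" "Dom A f = b"
  shows "H0_emb A M (rar M (Idn M m) f) \<cdot>\<^bsub>H0_cat A M\<^esub> H0_emb A M (rar M k (Idn A b))
    = H0_emb A M (rar M k f)"
  using assms rar_split'[OF assms] by (auto simp flip: H0_emb_cmp)

sublocale E: functor_bimodule A "H0_cat A M" by standard

lemma orbit_funs [simp]: assumes "m \<in> Obj M" shows "orbit A M m \<in> funs A (H0_cat A M)"
proof (rule funsI[OF functrI])
  show "onArr (orbit A M m) (g \<cdot>\<^bsub>A\<^esub> f) = onArr (orbit A M m) g \<cdot>\<^bsub>H0_cat A M\<^esub> onArr (orbit A M m) f"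
    if "f \<in> Arr A" "g \<in> Arr A" "Cod A f = Dom A g" for f g
    using that assms rar_cmp[of "Idn M m" "Idn M m" f g] by simp
qed (use assms in \<open>simp_all add: A.category_axioms category_H0\<close>, simp_all add: orbit_def)

lemma orbit_nat_nats [simp]:
  assumes "k \<in> Arr M" "Dom M k = m" "Cod M k = n"
  shows "orbit_nat A M k \<in> nats A (H0_cat A M) (orbit A M m) (orbit A M n)"
  using assms
  by (intro natsI nat_transI) (auto simp: emb_rar_split emb_rar_split' orbit_nat_def intro: orbit_funs)

text \<open>Naturality in \<open>b\<close> is naturality of \<open>\<phi>\<close> and of \<open>\<chi>\<close>, both with an identity in the variable \<open>a\<close>.\<close>

lemma orbit_twist_nats [simp]:
  assumes "a \<in> Obj A" "m \<in> Obj M"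
  shows "orbit_twist A M a m \<in> nats A (H0_cat A M) (fcomp A (orbit A M m) (tensR A a)) (orbit A M (lob M a m))"
proof (intro natsI nat_transI)
  show "onArr (orbit A M (lob M a m)) g \<cdot>\<^bsub>H0_cat A M\<^esub> orbit_twist A M a m (Dom A g)
      = orbit_twist A M a m (Cod A g) \<cdot>\<^bsub>H0_cat A M\<^esub> onArr (fcomp A (orbit A M m) (tensR A a)) g"
    if "g \<in> Arr A" for g
  proof -
    have "rar M (Idn M (lob M a m)) g \<cdot>\<^bsub>M\<^esub> chi M a m (Dom A g)
        = chi M a m (Cod A g) \<cdot>\<^bsub>M\<^esub> lar M (Idn A a) (rar M (Idn M m) g)"
      using chi_natural[of "Idn A a" "Idn M m" g] assms that by simp
    from H0_emb_eq_assoc[OF this, of "H0_phi A M a (rob M m (Dom A g))"] show ?thesis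
      using assms that by (simp add: H0_phi_natural)
  qed
qed (use assms in \<open>simp_all add: orbit_twist_def\<close>)

text \<open>The unit preserves the right action strictly because \<open>(m \<lhd> a) \<lhd> b = m \<lhd> (a \<otimes> b)\<close>.\<close>

lemma orbit_rob: "\<lbrakk>m \<in> Obj M; a \<in> Obj A\<rbrakk> \<Longrightarrow> orbit A M (rob M m a) = fcomp A (orbit A M m) (tensL A a)"
  by (auto simp: orbit_def fcomp_def intro!: restrict_ext simp flip: rar_idn)

lemma orbit_nat_rar:
  assumes "k \<in> Arr M" "f \<in> Arr A"
  shows "orbit_nat A M (rar M k f) = nhcomp A (H0_cat A M) (orbit A M (Dom M k)) (tensL A (Cod A f))
      (orbit_nat A M k) (tensL_nat A f)"
  using assms by (auto simp: orbit_nat_def nhcomp_def emb_rar_split simp flip: rar_tar intro!: restrict_ext)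

lemma functr_unit_cell: "functr M (Expo_cat A (H0_cat A M)) (bfun (dat (unit_cell A M)))"
proof (rule functrI)
  show "onArr (bfun (dat (unit_cell A M))) (Idn M m) = Idn (Expo_cat A (H0_cat A M)) (onObj (bfun (dat (unit_cell A M))) m)"
    if "m \<in> Obj M" for m using that by (auto simp: orbit_nat_def nid_def intro!: restrict_ext)
  show "onArr (bfun (dat (unit_cell A M))) (l \<cdot>\<^bsub>M\<^esub> k) =
     onArr (bfun (dat (unit_cell A M))) l \<cdot>\<^bsub>Expo_cat A (H0_cat A M)\<^esub> onArr (bfun (dat (unit_cell A M))) k"
    if "k \<in> Arr M" "l \<in> Arr M" "Cod M k = Dom M l" for k l
    using that by (auto simp: orbit_nat_def nvcomp_def intro!: restrict_ext)
qed (auto simp: M.category_axioms E.category_Expo)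

text \<open>Multiplicativity of the comparison is the heart of the matter. At \<open>x\<close>, the relation for \<open>\<phi>\<close> at \<open>a \<otimes> b\<close>
and the law for \<open>\<chi>\<close> in its left variable expand one side into \<open>\<chi>, a \<rhd> \<chi>, \<phi>, \<chi>, \<phi>\<close>; naturality of \<open>\<phi>\<close>
moves \<open>a \<rhd> \<chi>\<close> across, where it becomes \<open>\<chi> \<lhd> a\<close> and combines with the other \<open>\<chi>\<close> by the law in its
right variable. The latter law alone gives the compatibility with \<open>\<chi>\<close>.\<close>

lemma bimodule_map_unit_cell: "bimodule_map A M (Expo_cat A (H0_cat A M)) (dat (unit_cell A M))"
proof (rule bimodule_mapI[OF _ _ functr_unit_cell])
  have natural: "nvcomp A (H0_cat A M) (orbit_nat A M (lar M f k)) (orbit_twist A M (Dom A f) (Dom M k))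
      = nvcomp A (H0_cat A M) (orbit_twist A M (Cod A f) (Cod M k))
         (nhcomp A (H0_cat A M) (orbit A M (Dom M k)) (tensR A (Cod A f)) (orbit_nat A M k) (tensR_nat A f))"
    if "f \<in> Arr A" "k \<in> Arr M" for f k
  proof -
    have "H0_emb A M (rar M (lar M f k) (Idn A b)) \<cdot>\<^bsub>H0_cat A M\<^esub>
        (H0_emb A M (chi M (Dom A f) (Dom M k) b) \<cdot>\<^bsub>H0_cat A M\<^esub> H0_phi A M (Dom A f) (rob M (Dom M k) b))
      = H0_emb A M (chi M (Cod A f) (Cod M k) b) \<cdot>\<^bsub>H0_cat A M\<^esub>
        (H0_phi A M (Cod A f) (rob M (Cod M k) b) \<cdot>\<^bsub>H0_cat A M\<^esub>
          H0_emb A M (rar M (rar M k (Idn A b)) f))" if "b \<in> Obj A" for b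
    proof -
      have "rar M (lar M f k) (Idn A b) \<cdot>\<^bsub>M\<^esub> chi M (Dom A f) (Dom M k) b
        = chi M (Cod A f) (Cod M k) b \<cdot>\<^bsub>M\<^esub> lar M f (rar M k (Idn A b))"
        using chi_natural[of f k "Idn A b"] \<open>f \<in> Arr A\<close> \<open>k \<in> Arr M\<close> that by simp
      from H0_emb_eq_assoc[OF this, of "H0_phi A M (Dom A f) (rob M (Dom M k) b)"] show ?thesis
        using \<open>f \<in> Arr A\<close> \<open>k \<in> Arr M\<close> that by (simp add: H0_phi_natural)
    qed
    with that show ?thesis
      by (auto simp: nvcomp_def nhcomp_def emb_rar_split simp flip: rar_tar intro!: restrict_ext)
  qed
  have tob: "orbit_twist A M (tob A a b) m = nvcomp A (H0_cat A M) (orbit_twist A M a (lob M b m))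
      (nhcomp A (H0_cat A M) (fcomp A (orbit A M m) (tensR A b)) (tensR A a) (orbit_twist A M b m) (tensR_nat A (Idn A a)))"
    if "a \<in> Obj A" "b \<in> Obj A" "m \<in> Obj M" for a b m
    using that
    by (auto simp: orbit_twist_def nvcomp_def nhcomp_def H0_phi_tob chi_tob_left chi_tob_right H0_phi_natural_assoc
      intro!: restrict_ext)
  have chi: "nvcomp A (H0_cat A M) (orbit_nat A M (chi M a m b)) (orbit_twist A M a (rob M m b))
     = nvcomp A (H0_cat A M)
         (nhcomp A (H0_cat A M) (fcomp A (orbit A M m) (tensR A a)) (tensL A b) (orbit_twist A M a m) (tensL_nat A (Idn A b)))
         (nid A (H0_cat A M) (fcomp A (fcomp A (orbit A M m) (tensL A b)) (tensR A a)))"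
    if "a \<in> Obj A" "b \<in> Obj A" "m \<in> Obj M" for a b m
    using that by (auto simp: nvcomp_def nhcomp_def nid_def chi_tob_right intro!: restrict_ext)
  have unt: "orbit_twist A M (unt A) m = nid A (H0_cat A M) (orbit A M m)" if "m \<in> Obj M" for m
    using that by (auto simp: orbit_twist_def nid_def intro!: restrict_ext)
  show "bimodule_map_axioms A M (Expo_cat A (H0_cat A M)) (dat (unit_cell A M))"
    by (rule bimodule_map_axioms.intro)
      (auto simp: hom_def orbit_rob orbit_nat_rar natural tob chi unt A.act_tob A.tens_unt)
qed (simp_all add: bimodule_axioms E.bimodule_Expo)

lemma unit_cell_arr: "unit_cell A M \<in> Arr (Bimod1 A)"
  by (simp add: bimodule_map_unit_cell funsI[OF functr_unit_cell])

end

section \<open>The counit\<close>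

definition counit_cell :: "('o, 'a) moncat \<Rightarrow> (('o, 'a, 'x) univ, ('o, 'a, 'x) univ) cat \<Rightarrow> ('o, 'a, 'x) univ fun1" where
  "counit_cell A Y = Cell (H0_cat A (Expo_cat A Y)) Y (H0_lift A (Expo_cat A Y) Y
     (FMap (\<lambda>F. onObj (unFun F) (unt A)) (\<lambda>t. dat (unNat t) (unt A)))
     (\<lambda>a F. Idn Y (onObj (unFun F) a)))"

lemma counit_cell_cells [simp]: "src (counit_cell A Y) = H0_cat A (Expo_cat A Y)" "tgt (counit_cell A Y) = Y"
  by (simp_all add: counit_cell_def)

text \<open>Kept apart from \<open>functor_bimodule\<close>: every bimodule \<open>M\<close> yields the category \<open>H0(A,M)\<close> and hence the
bimodule \<open>[A,H0(A,M)]\<close>, so a single locale containing both passages would refer to itself without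
end.\<close>

locale unit_evaluation = functor_bimodule A Y
  for A :: "('o, 'a) moncat" and Y :: "(('o, 'a, 'x) univ, ('o, 'a, 'x) univ) cat"
begin

sublocale U: univ_bimodule A "Expo_cat A Y"
  by (rule univ_bimoduleI[OF bimodule_Expo])

text \<open>At \<open>I\<close> the two actions agree, on objects and on arrows, because \<open>I\<close> is a strict two-sided unit. Hence
evaluation at \<open>I\<close> is a cocone with identities for \<open>\<psi>\<close>.\<close>

lemma cocone_counit: "trace_cocone A (Expo_cat A Y) Y
     (FMap (\<lambda>F. onObj (unFun F) (unt A)) (\<lambda>t. dat (unNat t) (unt A)))
     (\<lambda>a F. Idn Y (onObj (unFun F) a))"
proof -
  have [simp]: "t b \<in> Arr Y" "Dom Y (t b) = onObj F b" "Cod Y (t b) = onObj G b"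
    if "t \<in> nats A Y F G" "b \<in> Obj A" for t F G b
    using nat_trans.comp_simps[OF nats_nat_trans[OF that(1)] that(2)] by auto
  have [simp]: "onObj F b \<in> Obj Y" if "F \<in> funs A Y" "b \<in> Obj A" for F b
    using functr.map_obj[OF funs_functr[OF that(1)] that(2)] .
  have [simp]: "onArr F f \<in> Arr Y" "Dom Y (onArr F f) = onObj F (Dom A f)" "Cod Y (onArr F f) = onObj F (Cod A f)"
    if "F \<in> funs A Y" "f \<in> Arr A" for F f
    using functr.map_arr[OF funs_functr[OF that(1)] that(2)] by auto
  interpret ev: functr "Expo_cat A Y" Y "FMap (\<lambda>F. onObj (unFun F) (unt A)) (\<lambda>t. dat (unNat t) (unt A))"
    by (rule functrI) (auto simp: category_Expo Y.category_axioms)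
  show ?thesis
    by standard (auto simp: hom_def functr.map_idn[OF funs_functr])
qed

lemma counit_cell_funs: "dat (counit_cell A Y) \<in> funs (H0_cat A (Expo_cat A Y)) Y"
  unfolding counit_cell_def cell.sel by (rule trace_cocone.lift_funs[OF cocone_counit])

lemma counit_cell_simps [simp]:
  "F \<in> funs A Y \<Longrightarrow> onObj (dat (counit_cell A Y)) (FunCode F) = onObj F (unt A)"
  "\<lbrakk>F \<in> funs A Y; G \<in> funs A Y; t \<in> nats A Y F G\<rbrakk> \<Longrightarrow>
    onArr (dat (counit_cell A Y)) (H0_emb A (Expo_cat A Y) (ncode F G t)) = t (unt A)"
  "\<lbrakk>F \<in> funs A Y; a \<in> Obj A\<rbrakk> \<Longrightarrow>
    onArr (dat (counit_cell A Y)) (H0_phi A (Expo_cat A Y) a (FunCode F)) = Idn Y (onObj F a)"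
  by (auto simp: counit_cell_def trace_cocone.lift_simps[OF cocone_counit])

end

section \<open>The 2-adjunction\<close>

text \<open>The unit and the counit apply one of the two 2-functors to the image of the other, where the laws
proved for cells in normal form are needed.\<close>

lemma H0_fun_collapse: "Cell (H0_cat A M) (H0_cat A N) (dat (H0_fun A (Cell M N p))) = H0_fun A (Cell M N p)"
  by (simp add: cell.expand)

lemma Expo_fun_collapse: "Cell (Expo_cat A Y) (Expo_cat A Z) (dat (Expo_fun A (Cell Y Z G))) = Expo_fun A (Cell Y Z G)"
  by (simp add: cell.expand)

context univ_bimodule_map
begin

lemma post_H0_fun: "post_composition A (H0_cat A M) (H0_cat A N) (dat (H0_fun A (Cell M N P)))"
  by (rule post_compositionI[OF M.A.strict_monoidal_axioms funs_functr[OF H0_fun_funs]])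

lemma post_orbit:
  "m \<in> Obj M \<Longrightarrow> fcomp A (dat (H0_fun A (Cell M N P))) (orbit A M m) = orbit A N (onObj (bfun P) m)"
  by (auto simp: fcomp_def orbit_def simp flip: pres_rar intro!: restrict_ext)

lemma post_orbit_nat:
  "k \<in> Arr M \<Longrightarrow> post_nat A (dat (H0_fun A (Cell M N P))) (orbit_nat A M k) = orbit_nat A N (onArr (bfun P) k)"
  by (auto simp: post_nat_def orbit_nat_def intro!: restrict_ext)

text \<open>Compatibility of the unit with the comparison maps of \<open>(P, r)\<close>. At \<open>b\<close> it is the condition relating
\<open>r\<close> and \<open>\<chi>\<close>, precomposed with \<open>\<phi>\<close>; the identity on the left is the comparison of \<open>[A, H0 P]\<close>.\<close>

lemma post_orbit_twist:
  assumes "a \<in> Obj A" "m \<in> Obj M"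
  shows "nvcomp A (H0_cat A N) (post_nat A (dat (H0_fun A (Cell M N P))) (orbit_twist A M a m))
      (nid A (H0_cat A N) (fcomp A (orbit A N (onObj (bfun P) m)) (tensR A a)))
    = nvcomp A (H0_cat A N) (orbit_nat A N (brr P (a, m))) (orbit_twist A N a (onObj (bfun P) m))"
proof -
  interpret h: functr "H0_cat A M" "H0_cat A N" "dat (H0_fun A (Cell M N P))"
    using H0_fun_funs by (rule funs_functr)
  have "H0_emb A N (onArr (bfun P) (chi M a m b)) \<cdot>\<^bsub>H0_cat A N\<^esub>
      (H0_emb A N (brr P (a, rob M m b)) \<cdot>\<^bsub>H0_cat A N\<^esub> H0_phi A N a (onObj (bfun P) (rob M m b)))
    = H0_emb A N (rar N (brr P (a, m)) (Idn A b)) \<cdot>\<^bsub>H0_cat A N\<^esub>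
      (H0_emb A N (chi N a (onObj (bfun P) m) b) \<cdot>\<^bsub>H0_cat A N\<^esub>
        H0_phi A N a (onObj (bfun P) (rob M m b)))" if "b \<in> Obj A" for b
    by (rule N.H0_emb_eq_assoc[OF brr_chi]) (use assms that in \<open>simp_all flip: pres_rob\<close>)
  with assms show ?thesis
    by (auto simp: nvcomp_def nid_def post_nat_def intro!: restrict_ext)
qed

lemma unit_natural1:
  "bimap_comp A M (Expo_cat A (H0_cat A N)) (dat (Expo_fun A (H0_fun A (Cell M N P)))) (dat (unit_cell A M))
    = bimap_comp A M (Expo_cat A (H0_cat A N)) (dat (unit_cell A N)) P"
proof -
  interpret h: post_composition A "H0_cat A M" "H0_cat A N" "dat (H0_fun A (Cell M N P))"
    by (rule post_H0_fun)
  let ?h = "Cell (H0_cat A M) (H0_cat A N) (dat (H0_fun A (Cell M N P)))"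
  have "bimap_comp A M (Expo_cat A (H0_cat A N)) (dat (Expo_fun A ?h)) (dat (unit_cell A M))
    = bimap_comp A M (Expo_cat A (H0_cat A N)) (dat (unit_cell A N)) P"
  proof (rule bimap_eqI[where A = A and M = M])
    show "bfun (bimap_comp A M (Expo_cat A (H0_cat A N)) (dat (Expo_fun A ?h)) (dat (unit_cell A M)))
      = bfun (bimap_comp A M (Expo_cat A (H0_cat A N)) (dat (unit_cell A N)) P)"
      unfolding bimap_simps
      by (rule funs_eqI[OF fcomp_funs[OF M.functr_unit_cell funs_functr[OF h.Expo_fun_funs]]
           fcomp_funs[OF P.functr_axioms N.functr_unit_cell]])
        (simp_all add: post_orbit post_orbit_nat)
  qed (simp_all add: post_orbit post_orbit_twist)
  then show ?thesis by (simp only: H0_fun_collapse)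
qed

end

lemma H0_nat_cell: "H0_nat A (Cell (Cell M N p) (Cell M N q) t)
    = Cell (Cell (H0_cat A M) (H0_cat A N) (dat (H0_fun A (Cell M N p))))
        (Cell (H0_cat A M) (H0_cat A N) (dat (H0_fun A (Cell M N q)))) (\<lambda>m\<in>Obj M. H0_emb A N (t m))"
  by (simp add: cell.expand)

text \<open>On 2-cells naturality says that \<open>t\<close> at \<open>m \<lhd> b\<close> is \<open>t m \<lhd> b\<close>, the compatibility of 2-cells with the right
action.\<close>

lemma two_natural_unit:
  assumes "strict_monoidal A"
  shows "two_natural (BIMOD A) (BIMOD A) tfid (tfcomp (Expo A) (H0 A)) (unit_cell A)"
proof (rule two_naturalI, goal_cases)
  case 1
  show ?case by (rule two_functor_tfid[OF two_category_BIMOD])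
next
  case 2
  show ?case by (rule two_functor_tfcomp[OF two_functor_H0 two_functor_Expo[OF assms]])
next
  case (3 M)
  then interpret univ_bimodule A M by (simp add: univ_bimodule_def)
  show ?case using unit_cell_arr by (simp add: hom_def)
next
  case (4 P)
  then have "P \<in> Arr (Bimod1 A)" by (simp only: BIMOD_simps)
  then obtain M N p where P: "P = Cell M N p" "bimodule_map A M N p" by (rule Bimod1_arrE)
  then show ?case
    using univ_bimodule_map.unit_natural1[OF univ_bimodule_mapI] by (simp add: cell.expand)
next
  case (5 \<alpha>)
  obtain M N p q t where \<alpha>: "\<alpha> = Cell (Cell M N p) (Cell M N q) t" "bimodule_trans A M N p q t"
    using 5 by (rule BIMOD_arrE)
  interpret t: bimodule_trans A M N p q t by fact
  interpret p: univ_bimodule_map A M N p by (rule univ_bimodule_mapI) (rule t.P.bimodule_map_axioms)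
  interpret q: univ_bimodule_map A M N q by (rule univ_bimodule_mapI) (rule t.Q.bimodule_map_axioms)
  interpret h: post_composition A "H0_cat A M" "H0_cat A N" "dat (H0_fun A (Cell M N p))"
    by (rule p.post_H0_fun)
  have comp: "nvcomp A (H0_cat A N) (\<lambda>b\<in>Obj A. (\<lambda>m\<in>Obj M. H0_emb A N (t m)) (onObj (orbit A M m) b))
        (post_nat A (dat (H0_fun A (Cell M N p))) (nid A (H0_cat A M) (orbit A M m)))
      = nvcomp A (H0_cat A N) (nid A (H0_cat A N) (orbit A N (onObj (bfun q) m))) (orbit_nat A N (t m))"
    if "m \<in> Obj M" for m
    using that
    by (auto simp: nvcomp_def post_nat_def t.pres_right h.G.map_idn simp flip: t.P.pres_rob intro!: restrict_ext)
  have "nhcomp M (Expo_cat A (H0_cat A N)) (bfun (dat (Expo_fun A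
         (Cell (H0_cat A M) (H0_cat A N) (dat (H0_fun A (Cell M N p)))))))
       (bfun (dat (unit_cell A M))) (dat (Expo_nat A (H0_nat A \<alpha>)))
       (nid M (Expo_cat A (H0_cat A M)) (bfun (dat (unit_cell A M))))
     = nhcomp M (Expo_cat A (H0_cat A N)) (bfun (dat (unit_cell A N))) (bfun q)
        (nid N (Expo_cat A (H0_cat A N)) (bfun (dat (unit_cell A N)))) t"
    unfolding \<alpha>(1) H0_nat_cell
    by (rule extensionalityI[where A = "Obj M"]) (use comp in \<open>simp_all add: p.post_orbit q.post_orbit\<close>)
  then show ?case
    by (simp add: \<alpha> p.unit_natural1 q.unit_natural1 H0_fun_collapse)
qed

lemma unit_evaluationI: "\<lbrakk>strict_monoidal A; category Y\<rbrakk> \<Longrightarrow> unit_evaluation A Y"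
  by (simp add: unit_evaluation_def functor_bimodule_def)

context post_composition
begin

sublocale Y: unit_evaluation A Y by standard
sublocale Z: unit_evaluation A Z by standard

sublocale E: univ_bimodule_map A "Expo_cat A Y" "Expo_cat A Z" "dat (Expo_fun A (Cell Y Z G))"
  by (rule univ_bimodule_mapI[OF bimodule_map_Expo_fun])

text \<open>Evaluating \<open>G \<circ> F\<close> at \<open>I\<close> is applying \<open>G\<close> to \<open>F I\<close>, and on \<open>\<phi>\<close> both sides are identities; by the
uniqueness part of the universal property this is enough.\<close>

lemma counit_natural1: "fcomp (H0_cat A (Expo_cat A Y)) G (dat (counit_cell A Y))
    = fcomp (H0_cat A (Expo_cat A Y)) (dat (counit_cell A Z)) (dat (H0_fun A (Expo_fun A (Cell Y Z G))))"
proof -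
  have post_nat_apply: "post_nat A G s (unt A) = onArr G (s (unt A))" for s
    by (simp add: post_nat_def)
  let ?e = "dat (H0_fun A (Cell (Expo_cat A Y) (Expo_cat A Z) (dat (Expo_fun A (Cell Y Z G)))))"
  interpret \<epsilon>: functr "H0_cat A (Expo_cat A Y)" Y "dat (counit_cell A Y)"
    using Y.counit_cell_funs by (rule funs_functr)
  interpret \<epsilon>': functr "H0_cat A (Expo_cat A Z)" Z "dat (counit_cell A Z)"
    using Z.counit_cell_funs by (rule funs_functr)
  interpret e: functr "H0_cat A (Expo_cat A Y)" "H0_cat A (Expo_cat A Z)" ?e
    using E.H0_fun_funs by (rule funs_functr)
  have "fcomp (H0_cat A (Expo_cat A Y)) G (dat (counit_cell A Y))
    = fcomp (H0_cat A (Expo_cat A Y)) (dat (counit_cell A Z)) ?e"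
  proof (rule Y.U.H0_functor_eqI[OF fcomp_funs[OF \<epsilon>.functr_axioms G.functr_axioms]
        fcomp_funs[OF e.functr_axioms \<epsilon>'.functr_axioms]])
    fix F assume "F \<in> Obj (Expo_cat A Y)"
    then show "onObj (fcomp (H0_cat A (Expo_cat A Y)) G (dat (counit_cell A Y))) F =
      onObj (fcomp (H0_cat A (Expo_cat A Y)) (dat (counit_cell A Z)) ?e) F" by auto
  next
    fix t assume t: "t \<in> Arr (Expo_cat A Y)"
    then obtain F F' s where "t = ncode F F' s" "F \<in> funs A Y" "F' \<in> funs A Y" "s \<in> nats A Y F F'"
      by auto
    with t show "onArr (fcomp (H0_cat A (Expo_cat A Y)) G (dat (counit_cell A Y))) (H0_emb A (Expo_cat A Y) t) =
      onArr (fcomp (H0_cat A (Expo_cat A Y)) (dat (counit_cell A Z)) ?e) (H0_emb A (Expo_cat A Y) t)"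
      by (simp del: Expo_cat_simps(2)) (simp add: post_nat_apply)
  next
    fix a F assume a: "a \<in> Obj A" and "F \<in> Obj (Expo_cat A Y)"
    then obtain f where F: "F = FunCode f" "f \<in> funs A Y" by auto
    interpret f: functr A Y f using F(2) by (rule funs_functr)
    show "onArr (fcomp (H0_cat A (Expo_cat A Y)) G (dat (counit_cell A Y))) (H0_phi A (Expo_cat A Y) a F) =
      onArr (fcomp (H0_cat A (Expo_cat A Y)) (dat (counit_cell A Z)) ?e) (H0_phi A (Expo_cat A Y) a F)"
      using a F by simp
  qed
  then show ?thesis by (simp only: Expo_fun_collapse)
qed

end

lemma two_natural_counit:
  assumes "strict_monoidal A"
  shows "two_natural CAT CAT (tfcomp (H0 A) (Expo A)) tfid (counit_cell A)"
proof (rule two_naturalI, goal_cases)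
  case 1
  show ?case by (rule two_functor_tfcomp[OF two_functor_Expo[OF assms] two_functor_H0])
next
  case 2
  show ?case by (rule two_functor_tfid[OF two_category_CAT])
next
  case (3 Y)
  then interpret unit_evaluation A Y by (simp add: unit_evaluationI assms)
  show ?case using counit_cell_funs by (simp add: hom_def)
next
  case (4 G)
  then have "G \<in> Arr Cat1" by (simp only: CAT_simps)
  then obtain Y Z g where G: "G = Cell Y Z g" "functr Y Z g" by (rule Cat1_arrE)
  then show ?case
    using post_composition.counit_natural1[OF post_compositionI[OF assms G(2)]] by simp
next
  case (5 \<alpha>)
  obtain Y Z f g t where \<alpha>: "\<alpha> = Cell (Cell Y Z f) (Cell Y Z g) t" "nat_trans Y Z f g t"
    using 5 by (rule CAT_arrE)
  interpret t: nat_trans Y Z f g t by fact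
  interpret f: post_composition A Y Z f by (intro post_compositionI assms t.F.functr_axioms)
  interpret g: post_composition A Y Z g by (intro post_compositionI assms t.G.functr_axioms)
  have comp: "(\<lambda>b\<in>Obj A. t (onObj F b)) \<in> nats A Z (fcomp A f F) (fcomp A g F)" if "F \<in> funs A Y" for F
    using that by (intro whisker_nats[of A Y] \<alpha>(2)) auto
  have "nhcomp (H0_cat A (Expo_cat A Y)) Z f (dat (counit_cell A Y)) t
       (nid (H0_cat A (Expo_cat A Y)) Y (dat (counit_cell A Y)))
     = nhcomp (H0_cat A (Expo_cat A Y)) Z (dat (counit_cell A Z))
        (dat (H0_fun A (Cell (Expo_cat A Y) (Expo_cat A Z) (dat (Expo_fun A (Cell Y Z g))))))
        (nid (H0_cat A (Expo_cat A Z)) Z (dat (counit_cell A Z))) (dat (H0_nat A (Expo_nat A \<alpha>)))"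
    unfolding \<alpha>(1)
    by (rule extensionalityI[where A = "FunCode ` funs A Y"])
      (auto simp: nhcomp_def[of "H0_cat A (Expo_cat A Y)"] comp functr.map_obj[OF funs_functr])
  then show ?case
    by (simp add: \<alpha> f.counit_natural1 g.counit_natural1 Expo_fun_collapse)
qed

text \<open>On generators: an arrow \<open>k\<close> goes to \<open>k \<lhd> I = k\<close>, and \<open>\<phi>\<close> goes to the component at \<open>I\<close> of the twist,
which is \<open>\<phi>\<close> since \<open>\<chi> a m I\<close> is an identity.\<close>

lemma (in univ_bimodule) triangle_H0:
  "fcomp (H0_cat A M) (dat (counit_cell A (H0_cat A M))) (dat (H0_fun A (unit_cell A M))) = fid (H0_cat A M)"
proof -
  interpret E: unit_evaluation A "H0_cat A M" by standard
  interpret u: univ_bimodule_map A M "Expo_cat A (H0_cat A M)" "dat (unit_cell A M)"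
    by (rule univ_bimodule_mapI[OF bimodule_map_unit_cell])
  have u: "unit_cell A M = Cell M (Expo_cat A (H0_cat A M)) (dat (unit_cell A M))"
    by (simp add: cell.expand)
  interpret \<epsilon>: functr "H0_cat A (Expo_cat A (H0_cat A M))" "H0_cat A M" "dat (counit_cell A (H0_cat A M))"
    using E.counit_cell_funs by (rule funs_functr)
  have "fcomp (H0_cat A M) (dat (counit_cell A (H0_cat A M)))
      (dat (H0_fun A (Cell M (Expo_cat A (H0_cat A M)) (dat (unit_cell A M))))) = fid (H0_cat A M)"
    by (rule H0_functor_eqI[OF fcomp_funs[OF funs_functr[OF u.H0_fun_funs] \<epsilon>.functr_axioms]
        fid_funs[OF category_H0]]) simp_all
  then show ?thesis by (simp flip: u)
qed

text \<open>The composite sends \<open>F\<close> to \<open>b \<mapsto> (F \<lhd> b) I = F b\<close>, and its comparison maps are identities because both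
\<open>\<phi>\<close> and \<open>\<chi>\<close> are sent to identities by the counit.\<close>

lemma (in unit_evaluation) triangle_Expo:
  "bimap_comp A (Expo_cat A Y) (Expo_cat A Y) (dat (Expo_fun A (counit_cell A Y))) (dat (unit_cell A (Expo_cat A Y)))
    = bimap_id A (Expo_cat A Y)"
proof -
  define e where "e = dat (counit_cell A Y)"
  have e: "counit_cell A Y = Cell (H0_cat A (Expo_cat A Y)) Y e" by (simp add: e_def cell.expand)
  interpret e: post_composition A "H0_cat A (Expo_cat A Y)" Y e
    unfolding e_def using counit_cell_funs by (intro post_compositionI strict_monoidal_axioms funs_functr)
  have [simp]: "F \<in> funs A Y \<Longrightarrow> onObj e (FunCode F) = onObj F (unt A)"
    "\<lbrakk>F \<in> funs A Y; G \<in> funs A Y; t \<in> nats A Y F G\<rbrakk> \<Longrightarrow> onArr e (H0_emb A (Expo_cat A Y) (ncode F G t)) = t (unt A)"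
    "\<lbrakk>F \<in> funs A Y; a \<in> Obj A\<rbrakk> \<Longrightarrow> onArr e (H0_phi A (Expo_cat A Y) a (FunCode F)) = Idn Y (onObj F a)"
    for F G t a by (simp_all add: e_def)
  have orbit: "fcomp A e (orbit A (Expo_cat A Y) (FunCode F)) = F" if "F \<in> funs A Y" for F
  proof (rule funs_eqI[OF e.post_funs[OF U.orbit_funs] that])
    interpret F: functr A Y F using that by auto
    show "onArr (fcomp A e (orbit A (Expo_cat A Y) (FunCode F))) f = onArr F f" if "f \<in> Arr A" for f
      using that \<open>F \<in> funs A Y\<close> nats_act(2)[OF nats_nid[OF \<open>F \<in> funs A Y\<close>] that] by simp
  qed (use that in simp_all)
  have orbit_nat: "post_nat A e (orbit_nat A (Expo_cat A Y) (ncode F G t)) = t"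
    if "t \<in> nats A Y F G" "F \<in> funs A Y" "G \<in> funs A Y" for t F G
  proof (rule extensionalityI[where A = "Obj A"])
    interpret t: nat_trans A Y F G t using that by auto
    show "post_nat A e (orbit_nat A (Expo_cat A Y) (ncode F G t)) b = t b" if "b \<in> Obj A" for b
      using that \<open>F \<in> funs A Y\<close> \<open>G \<in> funs A Y\<close> nats_act(2)[OF \<open>t \<in> nats A Y F G\<close>, of "Idn A b"]
      by (simp add: post_nat_def)
  qed (use nats_extensional[OF that(1)] in \<open>simp_all add: post_nat_def\<close>)
  have orbit_twist: "nvcomp A Y (post_nat A e (orbit_twist A (Expo_cat A Y) a (FunCode F))) (nid A Y (fcomp A F (tensR A a)))
      = nid A Y (fcomp A F (tensR A a))" if "F \<in> funs A Y" "a \<in> Obj A" for F a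
  proof -
    interpret F: functr A Y F using that by auto
    show ?thesis
      using that by (intro extensionalityI[where A = "Obj A"]) (simp_all add: post_nat_def)
  qed
  have orbit_twist_nats: "orbit_twist A (Expo_cat A Y) a (FunCode F) \<in> nats A (H0_cat A (Expo_cat A Y))
      (fcomp A (orbit A (Expo_cat A Y) (FunCode F)) (tensR A a))
      (orbit A (Expo_cat A Y) (FunCode (fcomp A F (tensR A a))))" if "F \<in> funs A Y" "a \<in> Obj A" for F a
    using U.orbit_twist_nats[of a "FunCode F"] that by simp
  show ?thesis unfolding e
  proof (rule bimap_eqI[where A = A and M = "Expo_cat A Y"])
    show "bfun (bimap_comp A (Expo_cat A Y) (Expo_cat A Y) (dat (Expo_fun A (Cell (H0_cat A (Expo_cat A Y)) Y e)))
          (dat (unit_cell A (Expo_cat A Y)))) = bfun (bimap_id A (Expo_cat A Y))"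
      unfolding bimap_simps
      by (rule funs_eqI[OF fcomp_funs[OF U.functr_unit_cell funs_functr[OF e.Expo_fun_funs]]
            fid_funs[OF category_Expo]])
        (auto simp: orbit orbit_nat)
  qed (rule bimap_simps, rule bimap_simps, auto simp: orbit orbit_twist orbit_twist_nats e.post_act)
qed

theorem theorem5p2p4:
  fixes A :: "('o, 'a) moncat"
  assumes "strict_monoidal A"
  shows "two_adjunction
    (BIMOD A :: (('o, 'a, ('o, 'a, 'x) univ) bimod, ('o, 'a, ('o, 'a, 'x) univ) bimod1,
                 ('o, 'a, ('o, 'a, 'x) univ) bimod2) tcat)
    CAT (H0 A) (Expo A)"
  unfolding two_adjunction_def
proof (intro conjI exI[of _ "unit_cell A"] exI[of _ "counit_cell A"] ballI)
  fix M :: "('o, 'a, ('o, 'a, 'x) univ) bimod" assume "M \<in> Obj (Base (BIMOD A))"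
  then interpret univ_bimodule A M by (simp add: univ_bimodule_def)
  show "counit_cell A (on0 (H0 A) M) \<cdot>\<^bsub>Base CAT\<^esub> on1 (H0 A) (unit_cell A M) = Idn (Base CAT) (on0 (H0 A) M)"
    by (simp add: triangle_H0)
next
  fix Y :: "(('o, 'a, 'x) univ, ('o, 'a, 'x) univ) cat" assume "Y \<in> Obj (Base CAT)"
  then interpret unit_evaluation A Y by (simp add: unit_evaluationI assms)
  show "on1 (Expo A) (counit_cell A Y) \<cdot>\<^bsub>Base (BIMOD A)\<^esub> unit_cell A (on0 (Expo A) Y)
      = Idn (Base (BIMOD A)) (on0 (Expo A) Y)"
    by (simp add: triangle_Expo)
qed (rule two_functor_H0 two_functor_Expo[OF assms] two_natural_unit[OF assms] two_natural_counit[OF assms])+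

end
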